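(* Let $(X,T,\mathcal{A},\mu)$ be a conservative ergodic measure preserving dynamical system, where $\mu$ is an infinite $\sigma$-finite measure. Let $A\in\mathcal{A}$ with $0<\mu(A)<\infty$ be a uniform set. Suppose the wandering rate $(W_n)=(W_n(A))$ is regularly varying with exponent $1-\alpha$. (1) If $0\le\alpha\le1$, then $$\Phi_n\ \stackrel{\mathcal{L}(\mu)}{\Longrightarrow}\ X_\alpha,$$ where, for $\alpha\in(0,1)$, $X_\alpha$ denotes the random variable on $[0,1]$ with density $$f_{X_\alpha}(x)=\frac{1}{1-\alpha}\,\frac{\sin\pi\alpha}{\pi}\,\frac{1}{x^{\frac{1-2\alpha}{1-\alpha}}\left(1-x^{\frac1{1-\alpha}}\right)^{\alpha}},\qquad 0<x<1,$$ and $X_0=0$, $X_1=1$. (2) If $0\le\alpha<1$, then $$\Psi_n\ \stackrel{\mathcal{L}(\mu)}{\Longrightarrow}\ Y_\alpha,$$ where, for $\alpha\in(0,1)$, $Y_\alpha$ denotes the random variable on $[0,1]$ with density $$f_{Y_\alpha}(x)=\frac{1}{1-\alpha}\,\frac{\sin\pi\alpha}{\pi}\,\frac{1}{\left(1-x^{\frac1{1-\alpha}}\right)^{1-\alpha}},\qquad 0<x<1,$$ and $Y_0=1$.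
   Context: $\mathcal{P}_\mu$ denotes the set of probability measures $\nu$ on $\mathcal{A}$ with $\nu\ll\mu$; the same symbol is used for the set of the corresponding densities $d\nu/d\mu$. The transfer operator $\hat T:L_1(\mu)\to L_1(\mu)$ is the positive linear operator characterized by $\int_B\hat T(f)\,d\mu=\int_{T^{-1}(B)}f\,d\mu$ for all $f\in L_1(\mu)$, $B\in\mathcal{A}$. A set $A\in\mathcal{A}$ with $0<\mu(A)<\infty$ is uniform for $f\in\mathcal{P}_\mu$ if there is a sequence $(a_n)$ of positive reals such that $\frac1{a_n}\sum_{k=0}^{n-1}\hat T^k(f)\to1$ $\mu$-a.e. uniformly on $A$ (i.e. in $L_\infty$-norm on $A$). It is called uniform if it is uniform for some $f\in\mathcal{P}_\mu$. Put $A_n:=\bigcup_{k=0}^nT^{-k}A$. The wandering rate of $A$ is $W_n=W_n(A):=\mu(A_n)$, $n\ge0$. The first return time to $A$ is $\varphi(x)=\inf\{n\ge1:T^n(x)\in A\}$, $x\in X$. $Z_n(x):=\max\{k\le n: T^k(x)\in A\}$ (with $k\geq 0$) if $x\in A_n$, and $Z_n(x):=0$ otherwise. The normalized Kac process and the normalized spent time Kac process are $$\Phi_n:=\frac{\sum_{k=0}^{Z_n}\mu(A\cap\{\varphi>k\})}{\mu(A_n)},\qquad\Psi_n:=\frac{\sum_{k=0}^{n-Z_n}\mu(A\cap\{\varphi>k\})}{\mu(A_n)}.$$ A measurable function $R:\mathbb{R}^+\to\mathbb{R}$ with $R>0$ on $(a,\infty)$ for some $a>0$ is regularly varying (at $\infty$)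 with exponent $\rho\in\mathbb{R}$ if $\lim_{t\to\infty}R(\lambda t)/R(t)=\lambda^\rho$ for all $\lambda>0$. A sequence $(u_n)$ is regularly varying with exponent $\rho$ if $u_n=R(n)$, $n\ge1$, for some function $R$ regularly varying with exponent $\rho$. Strong distributional convergence $R_n\stackrel{\mathcal{L}(\mu)}{\Longrightarrow}R$ of measurable functions $R_n:X\to\mathbb{R}$ to a random variable $R$ means that for every $\nu\in\mathcal{P}_\mu$ the $R_n$, viewed as random variables on $(X,\mathcal{A},\nu)$, converge in distribution to $R$. *)

theory Defs
  imports "HOL-Probability.Probability"
begin

section \<open>Measure preserving systems\<close>

locale measure_preserving_system = sigma_finite_measure M
  for M :: "'a measure" and T :: "'a \<Rightarrow> 'a" +
  assumes T_measurable [measurable]: "T \<in> measurable M M"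
    and T_preserves: "distr M M T = M"

text \<open>Conservativity: wandering sets are null.  Ergodicity: invariant sets are trivial.\<close>

locale conservative_ergodic_system = measure_preserving_system M T
  for M :: "'a measure" and T :: "'a \<Rightarrow> 'a" +
  assumes conservative:
      "\<And>B. B \<in> sets M \<Longrightarrow> disjoint_family (\<lambda>n::nat. (T ^^ n) -` B \<inter> space M) \<Longrightarrow> emeasure M B = 0"
    and ergodic:
      "\<And>B. B \<in> sets M \<Longrightarrow> T -` B \<inter> space M = B \<Longrightarrow> emeasure M B = 0 \<or> emeasure M (space M - B) = 0"


section \<open>Probability measures and densities dominated by a measure\<close>

definition ac_probs :: "'a measure \<Rightarrow> 'a measure set" where
  "ac_probs M = {N. prob_space N \<and> sets N = sets M \<and> absolutely_continuous M N}"

definition ac_densities :: "'a measure \<Rightarrow> ('a \<Rightarrow> real) set" where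
  "ac_densities M = {f \<in> borel_measurable M.
     (AE x in M. 0 \<le> f x) \<and> density M (\<lambda>x. ennreal (f x)) \<in> ac_probs M}"


section \<open>Transfer operator\<close>

text \<open>
  Elements of \<open>L\<^sub>1\<close> are handled through representatives, so the image of \<open>f\<close> is determined only
  up to a null set; the operator picks some representative of the class.  Existence and
  almost everywhere uniqueness are shown below.
\<close>

definition is_transfer :: "'a measure \<Rightarrow> ('a \<Rightarrow> 'a) \<Rightarrow> ('a \<Rightarrow> real) \<Rightarrow> ('a \<Rightarrow> real) \<Rightarrow> bool" where
  "is_transfer M T f g \<longleftrightarrow> integrable M g \<and>
     (\<forall>B\<in>sets M. (LINT x:B|M. g x) = (LINT x:(T -` B \<inter> space M)|M. f x))"

definition transfer :: "'a measure \<Rightarrow> ('a \<Rightarrow> 'a) \<Rightarrow> ('a \<Rightarrow> real) \<Rightarrow> ('a \<Rightarrow> real)" where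
  "transfer M T f = (SOME g. is_transfer M T f g)"

context measure_preserving_system
begin

lemma is_transfer_exists_nonneg:
  assumes f: "integrable M f" and nn: "\<And>x. 0 \<le> f x"
  shows "\<exists>g. is_transfer M T f g"
proof -
  have [measurable]: "f \<in> borel_measurable M" using f by simp
  define D where "D = density M (\<lambda>x. ennreal (f x))"
  define N where "N = distr D M T"
  have TD [measurable]: "T \<in> measurable D M" by (simp add: D_def)
  have sN: "sets N = sets M" by (simp add: N_def)
  have eN: "emeasure N B = (\<integral>\<^sup>+x. ennreal (f x) * indicator (T -` B \<inter> space M) x \<partial>M)"
    if "B \<in> sets M" for B
    using that by (simp add: N_def D_def emeasure_distr emeasure_density)
  have eN': "emeasure N B = ennreal (LINT x:(T -` B \<inter> space M)|M. f x)" if [measurable]: "B \<in> sets M" for B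
  proof -
    have "T -` B \<inter> space M \<in> sets M" by measurable
    then have "integrable M (\<lambda>x. f x * indicator (T -` B \<inter> space M) x)"
      using f by (rule integrable_real_mult_indicator)
    then have "(\<integral>\<^sup>+x. ennreal (f x * indicator (T -` B \<inter> space M) x) \<partial>M)
        = ennreal (\<integral>x. f x * indicator (T -` B \<inter> space M) x \<partial>M)"
      by (rule nn_integral_eq_integral) (use nn in auto)
    then show ?thesis
      unfolding eN[OF that] set_lebesgue_integral_def
      by (simp add: ennreal_mult' nn ennreal_indicator mult.commute)
  qed
  have ac: "absolutely_continuous M N"
    unfolding absolutely_continuous_def
  proof
    fix B assume B: "B \<in> null_sets M"
    then have Bs [measurable]: "B \<in> sets M" by auto
    have "emeasure M (T -` B \<inter> space M) = emeasure (distr M M T) B"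
      by (simp add: emeasure_distr)
    then have "T -` B \<inter> space M \<in> null_sets M"
      using B T_preserves by (intro null_setsI) auto
    then have "AE x in M. ennreal (f x) * indicator (T -` B \<inter> space M) x = 0"
      by (rule AE_mp[OF AE_not_in]) (auto simp: indicator_def)
    then have "emeasure N B = 0"
      unfolding eN[OF Bs] by (subst nn_integral_0_iff_AE) auto
    then show "B \<in> null_sets N" using Bs sN by auto
  qed
  have fN: "finite_measure N"
  proof (rule finite_measureI)
    have "space N = space M" using sN by (rule sets_eq_imp_space_eq)
    then show "emeasure N (space N) \<noteq> \<infinity>" by (simp add: eN')
  qed
  have dN: "density M (RN_deriv M N) = N" using ac sN by (rule density_RN_deriv)
  have fin: "AE x in M. RN_deriv M N x \<noteq> \<infinity>"
    using finite_measure.sigma_finite_measure[OF fN] ac sN by (rule RN_deriv_finite)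
  define g where "g = (\<lambda>x. enn2real (RN_deriv M N x))"
  have [measurable]: "g \<in> borel_measurable M" by (simp add: g_def)
  have gB: "(\<integral>\<^sup>+x. ennreal (indicator B x * g x) \<partial>M) = emeasure N B" if "B \<in> sets M" for B
  proof -
    have "emeasure N B = (\<integral>\<^sup>+x. RN_deriv M N x * indicator B x \<partial>M)"
      using that by (subst dN[symmetric]) (simp add: emeasure_density)
    also have "\<dots> = (\<integral>\<^sup>+x. ennreal (indicator B x * g x) \<partial>M)"
    proof (rule nn_integral_cong_AE)
      show "AE x in M. RN_deriv M N x * indicator B x = ennreal (indicator B x * g x)"
        using fin by eventually_elim
          (auto simp: g_def indicator_def less_top[symmetric])
    qed
    finally show ?thesis by simp
  qed
  have intg: "integrable M g"
  proof (rule integrableI_nonneg)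
    have "(\<integral>\<^sup>+x. ennreal (g x) \<partial>M) = (\<integral>\<^sup>+x. ennreal (indicator (space M) x * g x) \<partial>M)"
      by (rule nn_integral_cong) simp
    also have "\<dots> < \<infinity>" by (simp add: gB eN')
    finally show "(\<integral>\<^sup>+x. ennreal (g x) \<partial>M) < \<infinity>" .
  qed (auto simp: g_def)
  have "(LINT x:B|M. g x) = (LINT x:(T -` B \<inter> space M)|M. f x)" if [measurable]: "B \<in> sets M" for B
  proof -
    have "(LINT x:B|M. g x) = enn2real (\<integral>\<^sup>+x. ennreal (indicator B x * g x) \<partial>M)"
      unfolding set_lebesgue_integral_def
      by (subst integral_eq_nn_integral) (auto simp: g_def)
    also have "\<dots> = (LINT x:(T -` B \<inter> space M)|M. f x)"
      by (simp add: gB eN' set_lebesgue_integral_def nn)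
    finally show ?thesis .
  qed
  with intg show ?thesis unfolding is_transfer_def by blast
qed

lemma is_transfer_exists:
  assumes f: "integrable M f"
  shows "\<exists>g. is_transfer M T f g"
proof -
  obtain g where g: "is_transfer M T (\<lambda>x. max 0 (f x)) g"
    using is_transfer_exists_nonneg[of "\<lambda>x. max 0 (f x)"] f by auto
  obtain h where h: "is_transfer M T (\<lambda>x. max 0 (- f x)) h"
    using is_transfer_exists_nonneg[of "\<lambda>x. max 0 (- f x)"] f by auto
  have "(LINT x:B|M. g x - h x) = (LINT x:(T -` B \<inter> space M)|M. f x)" if B [measurable]: "B \<in> sets M" for B
  proof -
    have TB: "T -` B \<inter> space M \<in> sets M" by measurable
    have si: "set_integrable M S k" if "S \<in> sets M" "integrable M k" for S and k :: "'a \<Rightarrow> real"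
      using that unfolding set_integrable_def by (intro integrable_mult_indicator)
    have "(LINT x:B|M. g x - h x) = (LINT x:B|M. g x) - (LINT x:B|M. h x)"
      using g h B by (intro set_integral_diff si) (auto simp: is_transfer_def)
    also have "\<dots> = (LINT x:(T -` B \<inter> space M)|M. max 0 (f x)) - (LINT x:(T -` B \<inter> space M)|M. max 0 (- f x))"
      using g h B by (simp add: is_transfer_def)
    also have "\<dots> = (LINT x:(T -` B \<inter> space M)|M. max 0 (f x) - max 0 (- f x))"
      using f TB by (intro set_integral_diff(2)[symmetric] si) auto
    also have "(\<lambda>x. max 0 (f x) - max 0 (- f x)) = f" by (auto simp: max_def)
    finally show ?thesis .
  qed
  with g h show ?thesis
    by (intro exI[of _ "\<lambda>x. g x - h x"]) (auto simp: is_transfer_def)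
qed

lemma is_transfer_transfer: "integrable M f \<Longrightarrow> is_transfer M T f (transfer M T f)"
  unfolding transfer_def by (rule someI_ex[OF is_transfer_exists])

lemma is_transfer_unique:
  assumes "is_transfer M T f g" "is_transfer M T f h"
  shows "AE x in M. g x = h x"
  using assms by (intro density_unique_real) (auto simp: is_transfer_def)

end


section \<open>Uniform sets\<close>

definition uniform_for :: "'a measure \<Rightarrow> ('a \<Rightarrow> 'a) \<Rightarrow> 'a set \<Rightarrow> ('a \<Rightarrow> real) \<Rightarrow> bool" where
  "uniform_for M T A f \<longleftrightarrow>
     A \<in> sets M \<and> 0 < emeasure M A \<and> emeasure M A < \<infinity> \<and> f \<in> ac_densities M \<and>
     (\<exists>a :: nat \<Rightarrow> real. (\<forall>n. 0 < a n) \<and>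
        (\<lambda>n. esssup (restrict_space M A)
               (\<lambda>x. ereal \<bar>1 / a n * (\<Sum>k<n. (transfer M T ^^ k) f x) - 1\<bar>)) \<longlonglongrightarrow> 0)"

definition uniform_set :: "'a measure \<Rightarrow> ('a \<Rightarrow> 'a) \<Rightarrow> 'a set \<Rightarrow> bool" where
  "uniform_set M T A \<longleftrightarrow> (\<exists>f \<in> ac_densities M. uniform_for M T A f)"


section \<open>Wandering rate and Kac processes\<close>

definition hit_by :: "'a measure \<Rightarrow> ('a \<Rightarrow> 'a) \<Rightarrow> 'a set \<Rightarrow> nat \<Rightarrow> 'a set" where
  "hit_by M T A n = (\<Union>k\<le>n. (T ^^ k) -` A \<inter> space M)"

text \<open>
  Real-valued \<^const>\<open>measure\<close> is harmless here: for a measure preserving system,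
  \<open>emeasure M A < \<infinity>\<close> implies that \<open>hit_by M T A n\<close> has finite measure.
\<close>

definition wandering_rate :: "'a measure \<Rightarrow> ('a \<Rightarrow> 'a) \<Rightarrow> 'a set \<Rightarrow> nat \<Rightarrow> real" where
  "wandering_rate M T A n = measure M (hit_by M T A n)"

definition return_time :: "('a \<Rightarrow> 'a) \<Rightarrow> 'a set \<Rightarrow> 'a \<Rightarrow> enat" where
  "return_time T A x = Inf {enat n |n. 1 \<le> n \<and> (T ^^ n) x \<in> A}"

definition last_visit :: "'a measure \<Rightarrow> ('a \<Rightarrow> 'a) \<Rightarrow> 'a set \<Rightarrow> nat \<Rightarrow> 'a \<Rightarrow> nat" where
  "last_visit M T A n x =
     (if x \<in> hit_by M T A n then Max {k. k \<le> n \<and> (T ^^ k) x \<in> A} else 0)"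

definition return_tail :: "'a measure \<Rightarrow> ('a \<Rightarrow> 'a) \<Rightarrow> 'a set \<Rightarrow> nat \<Rightarrow> real" where
  "return_tail M T A k = measure M (A \<inter> {x \<in> space M. enat k < return_time T A x})"

definition kac_process :: "'a measure \<Rightarrow> ('a \<Rightarrow> 'a) \<Rightarrow> 'a set \<Rightarrow> nat \<Rightarrow> 'a \<Rightarrow> real" where
  "kac_process M T A n x =
     (\<Sum>k\<le>last_visit M T A n x. return_tail M T A k) / measure M (hit_by M T A n)"

definition spent_time_kac_process :: "'a measure \<Rightarrow> ('a \<Rightarrow> 'a) \<Rightarrow> 'a set \<Rightarrow> nat \<Rightarrow> 'a \<Rightarrow> real" where
  "spent_time_kac_process M T A n x =
     (\<Sum>k\<le>n - last_visit M T A n x. return_tail M T A k) / measure M (hit_by M T A n)"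


section \<open>Regular variation\<close>

text \<open>Only the values of \<open>R\<close> on the positive half-line are relevant.\<close>

definition regularly_varying :: "(real \<Rightarrow> real) \<Rightarrow> real \<Rightarrow> bool" where
  "regularly_varying R \<rho> \<longleftrightarrow>
     R \<in> borel_measurable (restrict_space borel {0<..}) \<and>
     (\<exists>a>0. \<forall>t>a. 0 < R t) \<and>
     (\<forall>c>0. ((\<lambda>t. R (c * t) / R t) \<longlongrightarrow> c powr \<rho>) at_top)"

definition regularly_varying_seq :: "(nat \<Rightarrow> real) \<Rightarrow> real \<Rightarrow> bool" where
  "regularly_varying_seq u \<rho> \<longleftrightarrow>
     (\<exists>R. regularly_varying R \<rho> \<and> (\<forall>n\<ge>1. u n = R (real n)))"


section \<open>Strong distributional convergence and the limit laws\<close>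

text \<open>The limiting random variable enters through its distribution \<open>L\<close> on the real line.\<close>

definition strong_distr_conv ::
    "'a measure \<Rightarrow> (nat \<Rightarrow> 'a \<Rightarrow> real) \<Rightarrow> real measure \<Rightarrow> bool" where
  "strong_distr_conv M R L \<longleftrightarrow>
     (\<forall>n. R n \<in> borel_measurable M) \<and> real_distribution L \<and>
     (\<forall>N\<in>ac_probs M. weak_conv_m (\<lambda>n. distr N borel (R n)) L)"

definition X_density :: "real \<Rightarrow> real \<Rightarrow> real" where
  "X_density \<alpha> x =
     1 / (1 - \<alpha>) * (sin (pi * \<alpha>) / pi) *
     (1 / (x powr ((1 - 2 * \<alpha>) / (1 - \<alpha>)) * (1 - x powr (1 / (1 - \<alpha>))) powr \<alpha>))"

definition Y_density :: "real \<Rightarrow> real \<Rightarrow> real" where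
  "Y_density \<alpha> x =
     1 / (1 - \<alpha>) * (sin (pi * \<alpha>) / pi) *
     (1 / (1 - x powr (1 / (1 - \<alpha>))) powr (1 - \<alpha>))"

text \<open>The distributions of \<open>X\<^sub>\<alpha>\<close> for \<open>0 \<le> \<alpha> \<le> 1\<close> and of \<open>Y\<^sub>\<alpha>\<close> for \<open>0 \<le> \<alpha> < 1\<close>.\<close>

definition X_law :: "real \<Rightarrow> real measure" where
  "X_law \<alpha> =
     (if \<alpha> = 0 then return borel 0
      else if \<alpha> = 1 then return borel 1
      else density lborel (\<lambda>x. ennreal (X_density \<alpha> x) * indicator {0<..<1} x))"

definition Y_law :: "real \<Rightarrow> real measure" where
  "Y_law \<alpha> =
     (if \<alpha> = 0 then return borel 1
      else density lborel (\<lambda>x. ennreal (Y_density \<alpha> x) * indicator {0<..<1} x))"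

end

theory Submission
  imports Defs
begin

text \<open>
  Disintegrating \<open>A\<^sub>n\<close> at the last visit gives \<open>W\<^sub>n = \<Sum>\<^sub>k\<^sub>\<le>\<^sub>n \<mu>(A \<inter> {\<phi> > k})\<close>, so the two Kac processes
  are \<open>W(Z\<^sub>n) / W\<^sub>n\<close> and \<open>W(n - Z\<^sub>n) / W\<^sub>n\<close>, and by regular variation everything reduces to the
  Dynkin-Lamperti arcsine law for \<open>Z\<^sub>n / n\<close>.

  Under the density \<open>f\<close> for which \<open>A\<close> is uniform, \<open>Z\<^sub>m = k\<close> has probability
  \<open>p(k, m - k)\<close>, where \<open>p(k, j)\<close> is the integral of the \<open>k\<close>-th transfer iterate of \<open>f\<close> over
  \<open>A \<inter> {\<phi> > j}\<close>.  Uniformity makes the double power series of \<open>p\<close> asymptotically a product, one factor of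
  which is the Laplace transform of the return tail; the other is eliminated through total mass one.
  This determines the limits of the time-averaged moments of \<open>(e\<^bsup>-m/n\<^esup>, e\<^bsup>-Z\<^sub>m/n\<^esup>)\<close>, which are
  generalized Stieltjes transforms of the arcsine law.  The Stone-Weierstrass theorem passes from moments to
  continuous functions, and monotonicity of \<open>m \<mapsto> Z\<^sub>m\<close> removes the averaging, without any
  Tauberian theorem.

  For another initial law, \<open>h\<^sub>n = \<beta>(Z\<^sub>n / n)\<close> with \<open>\<beta>\<close> nonincreasing is asymptotically subinvariant, because
  \<open>Z\<^sub>n \<circ> T \<ge> Z\<^sub>n - 1\<close>.  Its weak-* limit points in \<open>L\<^sub>\<infinity>\<close> are subinvariant, hence constant, so
  the limit law does not depend on the initial law.
\<close>

section \<open>Abelian asymptotics of double power series\<close>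

text \<open>Time is averaged with the weights \<open>(1 - v) * v ^ m\<close>,
  \<open>v = exp (- 1 / (n + 1))\<close>, under which \<open>v ^ m\<close> becomes uniform on [0, 1]
  and the time \<open>m = n + 1\<close> sits at the point \<open>exp (- 1)\<close>. Every exponent
  in the moment computation is then an integer, so regular variation enters it only through integer
  dilations, and the averaging is undone by continuous windows on the two sides of
  \<open>exp (- 1)\<close>. Nonincreasing test functions serve three ends: they make averages over
  earlier and later times one-sided bounds, they turn the one-sided estimate for the last visit
  along \<open>T\<close> into approximate subinvariance, and they include the ramps that detect weak
  convergence. Exact invariance is out of reach, because passing to \<open>T x\<close> may bring in
  a visit at time n + 1 and move the last visit far ahead. The map
  \<open>t powr (1 - \<alpha>)\<close> from Z_n / n to the Kac process is discontinuous at 0 when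
  \<alpha> = 1. That case is therefore argued separately: the limit of Z_n / n is 1, and slow
  variation makes W constant to first order between n / 2 and n.\<close>

lemma summable_power_bounded:
  fixes x :: "nat \<Rightarrow> real"
  assumes "0 \<le> w" "w < 1" and B: "\<And>k. \<bar>x k\<bar> \<le> B"
  shows "summable (\<lambda>k. w ^ k * x k)"
proof (rule summable_comparison_test')
  show "summable (\<lambda>k. B * w ^ k)" using assms by (intro summable_mult summable_geometric) auto
  show "norm (w ^ n * x n) \<le> B * w ^ n" for n
    using assms(1) B[of n] by (simp add: abs_mult mult.commute mult_right_mono)
qed

text \<open>This is the Cauchy product with the geometric series. It presents the series as the mean
  of its partial sums under the probability weights \<open>(1 - w) * w ^ n\<close>.\<close>

lemma power_series_by_parts:
  fixes x :: "nat \<Rightarrow> real"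
  assumes w: "0 \<le> w" "w < 1" and B: "\<And>k. \<bar>x k\<bar> \<le> B"
  shows "summable (\<lambda>n. w ^ n * (\<Sum>k\<le>n. x k))"
    and "(\<Sum>k. w ^ k * x k) = (1 - w) * (\<Sum>n. w ^ n * (\<Sum>k\<le>n. x k))"
proof -
  have "summable (\<lambda>k. norm (w ^ k * x k))"
    using summable_power_bounded[OF w, of "\<lambda>k. \<bar>x k\<bar>" B] B w by (simp add: abs_mult)
  moreover have "summable (\<lambda>k. norm (w ^ k))" using w by (simp add: summable_geometric)
  ultimately have "(\<lambda>n. \<Sum>i\<le>n. (w ^ i * x i) * w ^ (n - i)) sums ((\<Sum>k. w ^ k * x k) * (\<Sum>k. w ^ k))"
    by (rule Cauchy_product_sums)
  moreover have "(\<Sum>i\<le>n. (w ^ i * x i) * w ^ (n - i)) = w ^ n * (\<Sum>k\<le>n. x k)" for n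
    unfolding sum_distrib_left by (rule sum.cong) (auto simp: power_add[symmetric] mult.commute mult.left_commute)
  moreover have "(\<Sum>k. w ^ k) = 1 / (1 - w)" using w by (intro suminf_geometric) simp
  ultimately have *: "(\<lambda>n. w ^ n * (\<Sum>k\<le>n. x k)) sums ((\<Sum>k. w ^ k * x k) * (1 / (1 - w)))"
    by simp
  from * show "summable (\<lambda>n. w ^ n * (\<Sum>k\<le>n. x k))" by (rule sums_summable)
  from sums_unique[OF *] w
  show "(\<Sum>k. w ^ k * x k) = (1 - w) * (\<Sum>n. w ^ n * (\<Sum>k\<le>n. x k))"
    by (simp add: field_simps)
qed

text \<open>An average with positive weights of total mass one preserves linear inequalities, so the
  relative error \<open>\<eta>\<close> and the absolute error \<open>D\<close> come through with
  unchanged constants.\<close>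

lemma power_series_compare:
  fixes x y :: "nat \<Rightarrow> real"
  assumes w: "0 \<le> w" "w < 1" and x: "\<And>k. \<bar>x k\<bar> \<le> B" and y: "\<And>k. \<bar>y k\<bar> \<le> C"
    and d: "\<And>n. \<bar>(\<Sum>k\<le>n. x k) - (\<Sum>k\<le>n. y k)\<bar> \<le> \<eta> * (\<Sum>k\<le>n. y k) + D"
  shows "\<bar>(\<Sum>k. w ^ k * x k) - (\<Sum>k. w ^ k * y k)\<bar> \<le> \<eta> * (\<Sum>k. w ^ k * y k) + D"
proof -
  note X = power_series_by_parts[OF w x] and Y = power_series_by_parts[OF w y]
  let ?X = "\<lambda>n. w ^ n * (\<Sum>k\<le>n. x k)" and ?Y = "\<lambda>n. w ^ n * (\<Sum>k\<le>n. y k)"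
  have g: "summable (\<lambda>n. D * w ^ n)" using w by (intro summable_mult summable_geometric) auto
  have le: "norm (?X n - ?Y n) \<le> \<eta> * ?Y n + D * w ^ n" for n
  proof -
    have "norm (?X n - ?Y n) = w ^ n * \<bar>(\<Sum>k\<le>n. x k) - (\<Sum>k\<le>n. y k)\<bar>"
      using w by (simp add: abs_mult flip: right_diff_distrib)
    also have "\<dots> \<le> w ^ n * (\<eta> * (\<Sum>k\<le>n. y k) + D)" using d w by (intro mult_left_mono) auto
    finally show ?thesis by (simp add: algebra_simps)
  qed
  have s: "summable (\<lambda>n. \<eta> * ?Y n + D * w ^ n)" by (intro summable_add g summable_mult Y)
  have "\<bar>(\<Sum>n. ?X n) - (\<Sum>n. ?Y n)\<bar> = norm (\<Sum>n. ?X n - ?Y n)"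
    by (simp add: suminf_diff[OF X(1) Y(1)])
  also have "\<dots> \<le> (\<Sum>n. \<eta> * ?Y n + D * w ^ n)"
    by (rule norm_suminf_le[OF le s])
  also have "\<dots> = \<eta> * (\<Sum>n. ?Y n) + D * (1 / (1 - w))"
    using w by (subst suminf_add[symmetric]) (auto intro!: g summable_mult Y simp: suminf_mult Y suminf_geometric summable_geometric)
  finally have "(1 - w) * \<bar>(\<Sum>n. ?X n) - (\<Sum>n. ?Y n)\<bar> \<le> (1 - w) * (\<eta> * (\<Sum>n. ?Y n) + D * (1 / (1 - w)))"
    using w by (intro mult_left_mono) auto
  moreover have "\<bar>(\<Sum>k. w ^ k * x k) - (\<Sum>k. w ^ k * y k)\<bar> = (1 - w) * \<bar>(\<Sum>n. ?X n) - (\<Sum>n. ?Y n)\<bar>"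
    unfolding X(2) Y(2) using w by (simp add: abs_mult flip: right_diff_distrib)
  moreover have "(1 - w) * (\<eta> * (\<Sum>n. ?Y n) + D * (1 / (1 - w))) = \<eta> * ((1 - w) * (\<Sum>n. ?Y n)) + D"
    using w by (simp add: distrib_left mult.left_commute)
  ultimately show ?thesis unfolding Y(2) by simp
qed

text \<open>The Toeplitz argument: the weights \<open>(1 - w) * w ^ n\<close> form a probability
  that escapes every initial segment as \<open>w\<close> tends to 1.\<close>

lemma abel_mean_tendsto:
  fixes x :: "nat \<Rightarrow> real"
  assumes lim: "x \<longlonglongrightarrow> l"
    and w: "(w \<longlongrightarrow> 1) F" "eventually (\<lambda>s. 0 \<le> w s \<and> w s < 1) F"
  shows "((\<lambda>s. (1 - w s) * (\<Sum>n. w s ^ n * x n)) \<longlongrightarrow> l) F"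
proof -
  obtain C where C: "\<And>n. \<bar>x n\<bar> \<le> C"
    using convergent_imp_Bseq[OF convergentI[OF lim]] by (auto simp: Bseq_def)
  define y where "y n = x n - l" for n
  have yC: "\<bar>y n\<bar> \<le> C + \<bar>l\<bar>" for n using C[of n] by (simp add: y_def)
  have C0: "0 \<le> C + \<bar>l\<bar>" using yC[of 0] by linarith
  have "((\<lambda>s. (1 - w s) * (\<Sum>n. w s ^ n * y n)) \<longlongrightarrow> 0) F"
  proof (rule tendstoI)
    fix e :: real assume e: "0 < e"
    from lim have "y \<longlonglongrightarrow> 0" unfolding y_def by (simp add: LIM_zero)
    then have "eventually (\<lambda>n. \<bar>y n\<bar> < e / 2) sequentially"
      using e by (auto dest!: tendstoD[where e = "e/2"])
    then obtain K where K: "\<And>n. n \<ge> K \<Longrightarrow> \<bar>y n\<bar> < e / 2" by (auto simp: eventually_sequentially)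
    have "((\<lambda>s. (1 - w s) * (real K * (C + \<bar>l\<bar>))) \<longlongrightarrow> (1 - 1) * (real K * (C + \<bar>l\<bar>))) F"
      by (intro tendsto_intros w)
    then have "eventually (\<lambda>s. (1 - w s) * (real K * (C + \<bar>l\<bar>)) < e / 2) F"
      using e by (intro order_tendstoD(2)) auto
    with w(2) show "eventually (\<lambda>s. dist ((1 - w s) * (\<Sum>n. w s ^ n * y n)) 0 < e) F"
    proof eventually_elim
      fix s assume ws: "0 \<le> w s \<and> w s < 1" and sm: "(1 - w s) * (real K * (C + \<bar>l\<bar>)) < e / 2"
      let ?w = "w s"
      \<comment> \<open>\<open>?z\<close> bounds the finitely many terms before \<open>K\<close>
        without any decay; its sum is fixed and is killed by the factor
        \<open>1 - w s\<close>.\<close>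
      let ?z = "\<lambda>n. if n < K then C + \<bar>l\<bar> else 0"
      have sz: "summable ?z" by (rule summable_finite[of "{..<K}"]) auto
      have sg: "summable (\<lambda>n. e / 2 * ?w ^ n)" using ws by (intro summable_mult summable_geometric) auto
      have le: "norm (?w ^ n * y n) \<le> e / 2 * ?w ^ n + ?z n" for n
      proof (cases "n < K")
        case True
        have "?w ^ n * \<bar>y n\<bar> \<le> 1 * (C + \<bar>l\<bar>)"
          using ws yC by (intro mult_mono power_le_one) auto
        moreover have "0 \<le> e / 2 * ?w ^ n" using ws e by simp
        ultimately show ?thesis using True ws by (simp add: abs_mult)
      next
        case False
        then show ?thesis
          using K[of n] ws mult_right_mono[of "\<bar>y n\<bar>" "e / 2" "?w ^ n"] by (simp add: abs_mult mult.commute)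
      qed
      have "norm (\<Sum>n. ?w ^ n * y n) \<le> (\<Sum>n. e / 2 * ?w ^ n + ?z n)"
        by (rule norm_suminf_le[OF le summable_add[OF sg sz]])
      also have "\<dots> = e / 2 * (1 / (1 - ?w)) + real K * (C + \<bar>l\<bar>)"
      proof -
        have "(\<Sum>n. ?z n) = (\<Sum>n<K. ?z n)" by (rule suminf_finite) auto
        also have "\<dots> = real K * (C + \<bar>l\<bar>)" by simp
        finally show ?thesis
          using ws by (subst suminf_add[symmetric, OF sg sz])
            (simp add: suminf_mult summable_geometric suminf_geometric del: times_divide_eq_left)
      qed
      finally have "(1 - ?w) * norm (\<Sum>n. ?w ^ n * y n)
          \<le> (1 - ?w) * (e / 2 * (1 / (1 - ?w)) + real K * (C + \<bar>l\<bar>))"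
        using ws by (intro mult_left_mono) auto
      also have "\<dots> = e / 2 + (1 - ?w) * (real K * (C + \<bar>l\<bar>))" using ws by (simp add: field_simps)
      also have "\<dots> < e" using sm by simp
      finally show "dist ((1 - ?w) * (\<Sum>n. ?w ^ n * y n)) 0 < e" using ws by (simp add: abs_mult)
    qed
  qed
  then have "((\<lambda>s. (1 - w s) * (\<Sum>n. w s ^ n * y n) + l) \<longlongrightarrow> 0 + l) F" by (intro tendsto_intros)
  moreover have "eventually (\<lambda>s. (1 - w s) * (\<Sum>n. w s ^ n * y n) + l = (1 - w s) * (\<Sum>n. w s ^ n * x n)) F"
    using w(2)
  proof eventually_elim
    fix s assume ws: "0 \<le> w s \<and> w s < 1"
    have g: "summable (\<lambda>n. l * w s ^ n)" using ws by (intro summable_mult summable_geometric) auto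
    have "(\<Sum>n. w s ^ n * x n) = (\<Sum>n. w s ^ n * y n + l * w s ^ n)"
      by (simp add: y_def algebra_simps)
    also have "\<dots> = (\<Sum>n. w s ^ n * y n) + l * (1 / (1 - w s))"
      using ws yC by (subst suminf_add[symmetric])
        (auto intro!: summable_power_bounded g simp: suminf_mult summable_geometric suminf_geometric)
    finally show "(1 - w s) * (\<Sum>n. w s ^ n * y n) + l = (1 - w s) * (\<Sum>n. w s ^ n * x n)"
      using ws by (simp add: field_simps)
  qed
  ultimately show ?thesis by (simp add: Lim_transform_eventually)
qed

section \<open>Laplace transforms of sequences with divergent sums\<close>

lemma power_sum_partial_le:
  fixes q :: "nat \<Rightarrow> real"
  assumes w: "0 \<le> w" "w < 1" and q: "\<And>k. 0 \<le> q k" "\<And>k. q k \<le> B"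
  shows "w ^ J * (\<Sum>k\<le>J. q k) \<le> (\<Sum>k. w ^ k * q k)"
proof -
  have "w ^ J * (\<Sum>k\<le>J. q k) \<le> (\<Sum>k\<le>J. w ^ k * q k)"
    unfolding sum_distrib_left using w q by (intro sum_mono mult_right_mono power_decreasing) auto
  also have "\<dots> \<le> (\<Sum>k. w ^ k * q k)"
    using w q by (intro sum_le_suminf summable_power_bounded[of _ _ B]) (auto simp: abs_of_nonneg)
  finally show ?thesis .
qed

lemma laplace_at_top:
  fixes q :: "nat \<Rightarrow> real"
  assumes q: "\<And>k. 0 \<le> q k" "\<And>k. q k \<le> B"
    and W: "filterlim (\<lambda>n. \<Sum>k\<le>n. q k) at_top sequentially"
    and w: "(w \<longlongrightarrow> 1) F" "eventually (\<lambda>s. 0 \<le> w s \<and> w s < 1) F"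
  shows "filterlim (\<lambda>s. \<Sum>k. w s ^ k * q k) at_top F"
  unfolding filterlim_at_top_gt[where c = 0]
proof (intro allI impI)
  fix Z :: real assume Z: "0 < Z"
  from W obtain J where J: "2 * Z \<le> (\<Sum>k\<le>J. q k)"
    unfolding filterlim_at_top eventually_sequentially by (meson order_refl)
  have "((\<lambda>s. w s ^ J) \<longlongrightarrow> 1 ^ J) F" by (intro tendsto_intros w)
  then have "eventually (\<lambda>s. 1 / 2 < w s ^ J) F" by (intro order_tendstoD(1)) auto
  with w(2) show "eventually (\<lambda>s. Z \<le> (\<Sum>k. w s ^ k * q k)) F"
  proof eventually_elim
    fix s assume ws: "0 \<le> w s \<and> w s < 1" and h: "1 / 2 < w s ^ J"
    have "1 / 2 * (2 * Z) \<le> w s ^ J * (\<Sum>k\<le>J. q k)" using h J Z by (intro mult_mono) auto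
    also have "\<dots> \<le> (\<Sum>k. w s ^ k * q k)" using ws q by (intro power_sum_partial_le) auto
    finally show "Z \<le> (\<Sum>k. w s ^ k * q k)" by simp
  qed
qed

text \<open>Write \<open>n = l * c + i\<close> with \<open>i < c\<close>. In block \<open>l\<close>
  the partial sums stay near \<open>g\<close> times the \<open>l\<close>-th one, while the weights
  \<open>v ^ n\<close> add up to \<open>(v ^ c) ^ l * G\<close>. Since
  \<open>(1 - v) * G = 1 - v ^ c\<close>, the normalisation at \<open>v\<close> turns into the one
  at \<open>v ^ c\<close>.\<close>

lemma laplace_dilate_bound:
  fixes q :: "nat \<Rightarrow> real"
  assumes q: "\<And>k. 0 \<le> q k" "\<And>k. q k \<le> B"
    and W: "\<And>l i. i < c \<Longrightarrow>
      \<bar>(\<Sum>k\<le>l * c + i. q k) - g * (\<Sum>k\<le>l. q k)\<bar> \<le> \<eta> * (\<Sum>k\<le>l. q k) + D"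
    and c: "0 < c" and v: "0 \<le> v" "v < 1"
  shows "\<bar>(\<Sum>k. v ^ k * q k) - g * (\<Sum>k. (v ^ c) ^ k * q k)\<bar> \<le> \<eta> * (\<Sum>k. (v ^ c) ^ k * q k) + D"
proof -
  have qB: "\<bar>q k\<bar> \<le> B" for k using q[of k] by simp
  have vc: "0 \<le> v ^ c" "v ^ c < 1" using v c by (auto simp: power_less_one_iff)
  note X = power_series_by_parts[OF v qB] and Y = power_series_by_parts[OF vc qB]
  define W where "W n = (\<Sum>k\<le>n. q k)" for n
  define G where "G = (\<Sum>i<c. v ^ i)"
  let ?X = "\<Sum>n. v ^ n * W n" and ?Y = "\<Sum>l. (v ^ c) ^ l * W l"
  have G: "(1 - v) * G = 1 - v ^ c" unfolding G_def by (simp add: one_diff_power_eq)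
  have G0: "0 \<le> G" unfolding G_def using v by (intro sum_nonneg) auto
  have sX: "(\<lambda>n. v ^ n * W n) sums ?X" using X(1) unfolding W_def by (rule summable_sums)
  have sY: "summable (\<lambda>l. (v ^ c) ^ l * W l)" using Y(1) unfolding W_def .
  have sG: "(\<lambda>l. \<Sum>i<c. v ^ (l * c + i) * W (l * c + i)) sums ?X"
    using sums_group[OF sX c] unfolding sum.shift_bounds_nat_ivl
    by (simp add: sum.atLeastLessThan_shift_0[of _ "_ * c"] lessThan_atLeast0 add.commute)
  define x where "x l = (\<Sum>i<c. v ^ (l * c + i) * W (l * c + i))" for l
  have x: "summable x" "(\<Sum>l. x l) = ?X"
    using sG unfolding x_def by (auto simp: sums_iff)
  have le: "norm (x l - g * G * ((v ^ c) ^ l * W l)) \<le> \<eta> * G * ((v ^ c) ^ l * W l) + G * D * (v ^ c) ^ l" for l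
  proof -
    have "x l - g * G * ((v ^ c) ^ l * W l) = (\<Sum>i<c. (v ^ c) ^ l * v ^ i * (W (l * c + i) - g * W l))"
      unfolding x_def G_def
      by (simp add: sum_subtractf[symmetric] sum_distrib_left sum_distrib_right power_add power_mult[symmetric] algebra_simps)
    also have "norm \<dots> \<le> (\<Sum>i<c. (v ^ c) ^ l * v ^ i * (\<eta> * W l + D))"
    proof (rule sum_norm_le)
      fix i assume "i \<in> {..<c}"
      then show "norm ((v ^ c) ^ l * v ^ i * (W (l * c + i) - g * W l)) \<le> (v ^ c) ^ l * v ^ i * (\<eta> * W l + D)"
        using W[of i l] v vc by (auto simp: abs_mult W_def intro!: mult_left_mono)
    qed
    also have "\<dots> = \<eta> * G * ((v ^ c) ^ l * W l) + G * D * (v ^ c) ^ l"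
      unfolding G_def by (simp add: sum_distrib_left sum_distrib_right sum.distrib[symmetric] algebra_simps)
    finally show ?thesis .
  qed
  have g: "summable (\<lambda>l. G * D * (v ^ c) ^ l)" using vc by (intro summable_mult summable_geometric) auto
  have "norm (\<Sum>l. x l - g * G * ((v ^ c) ^ l * W l)) \<le> (\<Sum>l. \<eta> * G * ((v ^ c) ^ l * W l) + G * D * (v ^ c) ^ l)"
    by (rule norm_suminf_le[OF le]) (intro summable_add summable_mult sY g)
  also have "\<dots> = \<eta> * G * ?Y + G * D * (1 / (1 - v ^ c))"
    using vc by (subst suminf_add[symmetric])
      (auto intro!: g summable_mult sY simp: suminf_mult sY suminf_geometric summable_geometric)
  also have "(\<Sum>l. x l - g * G * ((v ^ c) ^ l * W l)) = ?X - g * G * ?Y"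
    by (subst suminf_diff[symmetric]) (auto intro!: summable_mult sY x simp: suminf_mult sY x)
  finally have "(1 - v) * norm (?X - g * G * ?Y)
      \<le> (1 - v) * (\<eta> * G * ?Y + G * D * (1 / (1 - v ^ c)))"
    using v by (intro mult_left_mono) auto
  also have "(1 - v) * norm (?X - g * G * ?Y)
      = \<bar>(1 - v) * ?X - g * ((1 - v) * G * ?Y)\<bar>"
  proof -
    have "(1 - v) * x - g * ((1 - v) * G * y) = (1 - v) * (x - g * G * y)" for x y by (simp add: algebra_simps)
    then show ?thesis using v by (simp only: abs_mult) simp
  qed
  also have "(1 - v) * (\<eta> * G * ?Y + G * D * (1 / (1 - v ^ c)))
     = \<eta> * ((1 - v) * G * ?Y) + (1 - v) * G * D * (1 / (1 - v ^ c))"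
    by (simp only: distrib_left mult_ac)
  finally have "\<bar>(1 - v) * ?X - g * ((1 - v) * G * ?Y)\<bar>
     \<le> \<eta> * ((1 - v) * G * ?Y) + (1 - v) * G * D * (1 / (1 - v ^ c))" .
  moreover have "(1 - v ^ c) * D * (1 / (1 - v ^ c)) = D" using vc by simp
  ultimately show ?thesis unfolding G X(2) Y(2) W_def[symmetric] by simp
qed

text \<open>The Abelian half of Karamata's theorem, for integer dilations. The additive constant of
  the block comparison is harmless because the transform itself diverges.\<close>

lemma laplace_dilate_limit:
  fixes q :: "nat \<Rightarrow> real"
  assumes q: "\<And>k. 0 \<le> q k" "\<And>k. q k \<le> B"
    and W: "filterlim (\<lambda>n. \<Sum>k\<le>n. q k) at_top sequentially"
    and rv: "(\<lambda>l. (\<Sum>k\<le>l * c. q k) / (\<Sum>k\<le>l. q k)) \<longlonglongrightarrow> g" and c: "0 < c"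
    and v: "(v \<longlongrightarrow> 1) F" "eventually (\<lambda>s. 0 \<le> v s \<and> v s < 1) F"
  shows "((\<lambda>s. (\<Sum>k. v s ^ k * q k) / (\<Sum>k. (v s ^ c) ^ k * q k)) \<longlongrightarrow> g) F"
proof (rule tendstoI)
  fix e :: real assume e: "0 < e"
  define W where "W n = (\<Sum>k\<le>n. q k)" for n
  have W0: "0 \<le> W n" for n unfolding W_def using q by (intro sum_nonneg) auto
  have B0: "0 \<le> B" using q[of 0] by linarith
  from W have "eventually (\<lambda>l. 0 < W l) sequentially"
    unfolding W_def by (auto simp: filterlim_at_top_dense)
  moreover from rv e have "eventually (\<lambda>l. dist (W (l * c) / W l) g < e / 2) sequentially"
    unfolding W_def by (intro tendstoD) auto
  ultimately have "eventually (\<lambda>l. \<bar>W (l * c) - g * W l\<bar> \<le> e / 2 * W l) sequentially"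
  proof eventually_elim
    case (elim l)
    then have "\<bar>W (l * c) - g * W l\<bar> = dist (W (l * c) / W l) g * W l"
      using abs_mult[of "W (l * c) / W l - g" "W l"] by (simp add: dist_real_def left_diff_distrib)
    also have "\<dots> \<le> e / 2 * W l" using elim by (intro mult_right_mono) auto
    finally show ?case .
  qed
  then obtain L where L: "\<And>l. l \<ge> L \<Longrightarrow> \<bar>W (l * c) - g * W l\<bar> \<le> e / 2 * W l"
    by (auto simp: eventually_sequentially)
  \<comment> \<open>The first summand pays for the blocks before \<open>L\<close>, where the ratio
    is not yet close to \<open>g\<close>; the second for the growth of the partial sums inside one
    block, which has fewer than \<open>c\<close> further terms, each at most
    \<open>B\<close>.\<close>
  define D where "D = (\<Sum>l<L. \<bar>W (l * c) - g * W l\<bar>) + real c * B"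
  have step: "\<bar>W (l * c + i) - W (l * c)\<bar> \<le> real c * B" if "i < c" for l i
  proof -
    have "W (l * c + i) - W (l * c) = sum q {l * c<..l * c + i}"
      unfolding W_def by (subst sum_diff[symmetric]) (auto intro!: sum.cong)
    moreover have "sum q {l * c<..l * c + i} \<le> (\<Sum>k\<in>{l * c<..l * c + i}. B)" using q by (intro sum_mono)
    moreover have "0 \<le> sum q {l * c<..l * c + i}" using q by (intro sum_nonneg)
    moreover have "real i * B \<le> real c * B" using that B0 by (intro mult_right_mono) auto
    ultimately show ?thesis by simp
  qed
  have D: "\<bar>W (l * c + i) - g * W l\<bar> \<le> e / 2 * W l + D" if i: "i < c" for l i
  proof (cases "l < L")
    case True
    then have "\<bar>W (l * c) - g * W l\<bar> \<le> (\<Sum>l<L. \<bar>W (l * c) - g * W l\<bar>)"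
      by (intro member_le_sum) auto
    moreover have "0 \<le> e / 2 * W l" using e W0[of l] by simp
    ultimately show ?thesis using step[OF i, of l] unfolding D_def by linarith
  next
    case False
    moreover have "0 \<le> (\<Sum>l<L. \<bar>W (l * c) - g * W l\<bar>)" by (intro sum_nonneg) auto
    ultimately show ?thesis using step[OF i, of l] L[of l] unfolding D_def by linarith
  qed
  have vc: "((\<lambda>s. v s ^ c) \<longlongrightarrow> 1) F" using tendsto_power[OF v(1), of c] by simp
  have vc': "eventually (\<lambda>s. 0 \<le> v s ^ c \<and> v s ^ c < 1) F"
    using v(2) by (rule eventually_mono) (use c in \<open>auto simp: power_less_one_iff\<close>)
  have "filterlim (\<lambda>s. \<Sum>k. (v s ^ c) ^ k * q k) at_top F"
    by (rule laplace_at_top[OF q W vc vc'])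
  then have "eventually (\<lambda>s. max 0 (2 * D / e) < (\<Sum>k. (v s ^ c) ^ k * q k)) F"
    unfolding filterlim_at_top_dense by blast
  with v(2) show "eventually (\<lambda>s. dist ((\<Sum>k. v s ^ k * q k) / (\<Sum>k. (v s ^ c) ^ k * q k)) g < e) F"
  proof eventually_elim
    case (elim s)
    define P where "P = (\<Sum>k. (v s ^ c) ^ k * q k)"
    have P: "0 < P" "D < e / 2 * P" using elim e by (auto simp: P_def field_simps)
    have "\<bar>(\<Sum>k. v s ^ k * q k) - g * P\<bar> \<le> e / 2 * P + D"
      unfolding P_def using elim D c by (intro laplace_dilate_bound[OF q]) (auto simp: W_def)
    also have "\<dots> < e * P" using P by simp
    finally have "\<bar>(\<Sum>k. v s ^ k * q k) - g * P\<bar> / P < e" using P by (simp add: field_simps)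
    moreover have "dist ((\<Sum>k. v s ^ k * q k) / P) g = \<bar>(\<Sum>k. v s ^ k * q k) - g * P\<bar> / P"
    proof -
      have "(\<Sum>k. v s ^ k * q k) / P - g = ((\<Sum>k. v s ^ k * q k) - g * P) / P"
        using P by (simp add: diff_divide_distrib)
      then show ?thesis using P by (simp add: dist_real_def)
    qed
    ultimately show ?case unfolding P_def by simp
  qed
qed

section \<open>Double series that factorise asymptotically\<close>

lemma double_series_rearrange:
  fixes p :: "nat \<Rightarrow> nat \<Rightarrow> real"
  assumes w: "0 \<le> w" "w < 1" and r: "0 \<le> r" "r < 1"
    and p: "\<And>k j. 0 \<le> p k j" "\<And>k j. p k j \<le> 1"
  shows "summable (\<lambda>j. r ^ j * (\<Sum>k. w ^ k * p k j))"
    and "(\<lambda>m. \<Sum>k\<le>m. w ^ k * r ^ (m - k) * p k (m - k)) sums (\<Sum>j. r ^ j * (\<Sum>k. w ^ k * p k j))"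
proof -
  define R where "R j = (\<Sum>k. w ^ k * p k j)" for j
  have sR: "summable (\<lambda>k. w ^ k * p k j)" for j
    using w p by (intro summable_power_bounded[of _ _ 1]) (auto simp: abs_of_nonneg)
  have R0: "0 \<le> R j" for j unfolding R_def using w p by (intro suminf_nonneg sR) auto
  have "R j \<le> (\<Sum>k. w ^ k)" for j unfolding R_def
    using w p by (intro suminf_le sR summable_geometric) (auto intro: mult_left_le)
  then have "\<bar>R j\<bar> \<le> (\<Sum>k. w ^ k)" for j using R0[of j] by simp
  then have s: "summable (\<lambda>j. r ^ j * R j)" using r by (intro summable_power_bounded)
  then show "summable (\<lambda>j. r ^ j * (\<Sum>k. w ^ k * p k j))" unfolding R_def .
  let ?f = "\<lambda>(j, k). r ^ j * (w ^ k * p k j)"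
  have inner: "((\<lambda>k. ?f (j, k)) has_sum r ^ j * R j) UNIV" for j
  proof -
    have "((\<lambda>k. w ^ k * p k j) has_sum R j) UNIV"
      unfolding R_def using w p by (intro sums_nonneg_imp_has_sum summable_sums sR) auto
    then show ?thesis by (simp add: has_sum_cmult_right)
  qed
  have outer: "((\<lambda>j. r ^ j * R j) has_sum (\<Sum>j. r ^ j * R j)) UNIV"
    using r R0 by (intro sums_nonneg_imp_has_sum summable_sums s) auto
  have "?f summable_on UNIV \<times> UNIV"
    using w r p by (intro summable_on_SigmaI[where g = "\<lambda>j. r ^ j * R j"] inner has_sum_imp_summable[OF outer]) auto
  then have "(?f has_sum (\<Sum>j. r ^ j * R j)) (UNIV \<times> UNIV)"
    using inner outer by (intro has_sum_SigmaI) auto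
  \<comment> \<open>The pair (j, k) is relabelled by the time m = j + k and the position k;
    unconditional summability makes the order irrelevant.\<close>
  also have "(?f has_sum (\<Sum>j. r ^ j * R j)) (UNIV \<times> UNIV) \<longleftrightarrow>
      ((\<lambda>(m, k). w ^ k * r ^ (m - k) * p k (m - k)) has_sum (\<Sum>j. r ^ j * R j)) (Sigma UNIV (\<lambda>m. {..m}))"
    by (rule has_sum_reindex_bij_witness[where i = "\<lambda>(m, k). (m - k, k)" and j = "\<lambda>(j, k). (j + k, k)"])
      (auto simp: mult_ac)
  finally have "((\<lambda>m. \<Sum>k\<le>m. w ^ k * r ^ (m - k) * p k (m - k)) has_sum (\<Sum>j. r ^ j * R j)) UNIV"
    by (rule has_sum_SigmaD) (auto intro: has_sum_finiteI)
  then show "(\<lambda>m. \<Sum>k\<le>m. w ^ k * r ^ (m - k) * p k (m - k)) sums (\<Sum>j. r ^ j * (\<Sum>k. w ^ k * p k j))"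
    unfolding R_def by (rule has_sum_imp_sums)
qed

text \<open>What the limit theorem uses of the dynamics. In the application \<open>p k j\<close> is
  the probability of a visit at time k followed by j steps without one, \<open>q\<close> is the
  return tail, \<open>u k\<close> is the probability of a visit at time k divided by the measure of
  the set, and \<open>diag\<close> expresses total mass one. The error in \<open>unif\<close> is
  proportional to \<open>q j\<close>; without this decay it would sum over j to the order of 1 / (1
  - r), which exceeds \<open>Q r\<close> because \<open>q\<close> tends to 0.\<close>

locale asymptotic_product =
  fixes p :: "nat \<Rightarrow> nat \<Rightarrow> real" and q u :: "nat \<Rightarrow> real" and B C :: real
  assumes p: "\<And>k j. 0 \<le> p k j" "\<And>k j. p k j \<le> 1"
    and q: "\<And>k. 0 \<le> q k" "\<And>k. q k \<le> B"
    and u: "\<And>k. 0 \<le> u k" "\<And>k. u k \<le> C"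
    and unif: "\<And>\<eta>. 0 < \<eta> \<Longrightarrow> \<eta> \<le> 1 \<Longrightarrow> \<exists>K. \<forall>n\<ge>K. \<forall>j.
      \<bar>(\<Sum>k\<le>n. p k j) - (\<Sum>k\<le>n. u k) * q j\<bar> \<le> \<eta> * ((\<Sum>k\<le>n. u k) * q j)"
    and diag: "(\<lambda>m. \<Sum>k\<le>m. p k (m - k)) \<longlonglongrightarrow> 1"
    and q_lim: "q \<longlonglongrightarrow> 0"
    and q_sum: "filterlim (\<lambda>n. \<Sum>k\<le>n. q k) at_top sequentially"
begin

definition P where "P w r = (\<Sum>j. r ^ j * (\<Sum>k. w ^ k * p k j))"
definition Q where "Q r = (\<Sum>j. r ^ j * q j)"
definition U where "U w = (\<Sum>k. w ^ k * u k)"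

lemma P_approx:
  assumes "0 < \<eta>" "\<eta> \<le> 1"
  obtains D where "0 \<le> D"
    "\<And>w r. 0 \<le> w \<Longrightarrow> w < 1 \<Longrightarrow> 0 \<le> r \<Longrightarrow> r < 1 \<Longrightarrow> \<bar>P w r - U w * Q r\<bar> \<le> (\<eta> * U w + D) * Q r"
proof -
  obtain K where K: "\<And>n j. n \<ge> K \<Longrightarrow>
      \<bar>(\<Sum>k\<le>n. p k j) - (\<Sum>k\<le>n. u k) * q j\<bar> \<le> \<eta> * ((\<Sum>k\<le>n. u k) * q j)"
    using unif[OF assms] by blast
  \<comment> \<open>For n < K both sums are bounded by their values at \<open>K\<close>, where
    \<open>unif\<close> with \<open>\<eta> \<le> 1\<close> bounds the first by twice the
    second.\<close>
  define D where "D = 2 * (\<Sum>k\<le>K. u k)"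
  have D0: "0 \<le> D" unfolding D_def using u by (auto intro: sum_nonneg)
  have part: "\<bar>(\<Sum>k\<le>n. p k j) - (\<Sum>k\<le>n. u k * q j)\<bar> \<le> \<eta> * (\<Sum>k\<le>n. u k * q j) + D * q j" for n j
  proof (cases "n \<ge> K")
    case True
    moreover have "0 \<le> D * q j" using D0 q(1) by simp
    ultimately show ?thesis using K[of n j] by (simp add: sum_distrib_right[symmetric])
  next
    case False
    have a: "0 \<le> (\<Sum>k\<le>n. p k j)" "(\<Sum>k\<le>n. p k j) \<le> (\<Sum>k\<le>K. p k j)"
      using p False by (auto intro!: sum_nonneg sum_mono2)
    have b: "0 \<le> (\<Sum>k\<le>n. u k) * q j" "(\<Sum>k\<le>n. u k) * q j \<le> (\<Sum>k\<le>K. u k) * q j" "0 \<le> (\<Sum>k\<le>K. u k) * q j"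
      using u q False by (auto intro!: mult_nonneg_nonneg mult_right_mono sum_nonneg sum_mono2)
    have c: "\<eta> * ((\<Sum>k\<le>K. u k) * q j) \<le> (\<Sum>k\<le>K. u k) * q j" "0 \<le> \<eta> * ((\<Sum>k\<le>n. u k) * q j)"
      using assms b by (auto intro: mult_left_le_one_le)
    from a b c K[of K j] show ?thesis unfolding D_def
      by (simp add: sum_distrib_right[symmetric])
  qed
  have sq: "summable (\<lambda>j. r ^ j * q j)" if "0 \<le> r" "r < 1" for r
    using that q by (intro summable_power_bounded[of _ _ B]) (auto simp: abs_of_nonneg)
  have su: "summable (\<lambda>j. r ^ j * u j)" if "0 \<le> r" "r < 1" for r
    using that u by (intro summable_power_bounded[of _ _ C]) (auto simp: abs_of_nonneg)
  show ?thesis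
  proof (rule that[OF D0])
    fix w r :: real assume w: "0 \<le> w" "w < 1" and r: "0 \<le> r" "r < 1"
    have le: "\<bar>(\<Sum>k. w ^ k * p k j) - U w * q j\<bar> \<le> (\<eta> * U w + D) * q j" for j
    proof -
      have uq: "\<bar>u k * q j\<bar> \<le> C * q j" for k using u q by (simp add: abs_of_nonneg mult_right_mono)
      have "(\<Sum>k. w ^ k * (u k * q j)) = U w * q j"
        unfolding U_def using suminf_mult2[OF su[OF w], of "q j"] by (simp add: mult.assoc)
      with power_series_compare[OF w _ uq part, where B = 1] p show ?thesis
        by (simp add: abs_of_nonneg algebra_simps)
    qed
    have le': "norm (r ^ j * (\<Sum>k. w ^ k * p k j) - U w * (r ^ j * q j)) \<le> (\<eta> * U w + D) * (r ^ j * q j)" for j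
    proof -
      have "r ^ j * (\<Sum>k. w ^ k * p k j) - U w * (r ^ j * q j) = r ^ j * ((\<Sum>k. w ^ k * p k j) - U w * q j)"
        by (simp add: algebra_simps)
      also have "norm \<dots> \<le> r ^ j * ((\<eta> * U w + D) * q j)"
        using r le by (simp add: abs_mult mult_left_mono)
      finally show ?thesis by (simp add: mult_ac)
    qed
    have "norm (\<Sum>j. r ^ j * (\<Sum>k. w ^ k * p k j) - U w * (r ^ j * q j)) \<le> (\<Sum>j. (\<eta> * U w + D) * (r ^ j * q j))"
      by (rule norm_suminf_le[OF le']) (intro summable_mult sq r)
    moreover have "(\<Sum>j. r ^ j * (\<Sum>k. w ^ k * p k j) - U w * (r ^ j * q j)) = P w r - U w * Q r"
      unfolding P_def Q_def
      by (subst suminf_diff[symmetric])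
        (auto intro!: summable_mult sq r double_series_rearrange w p simp: suminf_mult[OF sq[OF r]])
    ultimately show "\<bar>P w r - U w * Q r\<bar> \<le> (\<eta> * U w + D) * Q r"
      by (simp add: suminf_mult[OF sq[OF r]] Q_def)
  qed
qed

context
  fixes v :: "nat \<Rightarrow> real"
  assumes v: "v \<longlonglongrightarrow> 1" and v01: "eventually (\<lambda>n. 0 \<le> v n \<and> v n < 1) sequentially"
begin

lemma pow_v:
  assumes "0 < a"
  shows "(\<lambda>n. v n ^ a) \<longlonglongrightarrow> 1" "eventually (\<lambda>n. 0 \<le> v n ^ a \<and> v n ^ a < 1) sequentially"
proof -
  show "(\<lambda>n. v n ^ a) \<longlonglongrightarrow> 1" using tendsto_power[OF v, of a] by simp
  show "eventually (\<lambda>n. 0 \<le> v n ^ a \<and> v n ^ a < 1) sequentially"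
    using v01 by (rule eventually_mono) (use assms in \<open>auto simp: power_less_one_iff\<close>)
qed

text \<open>With both arguments equal to r the monomial \<open>w ^ k * r ^ (m - k)\<close> no longer
  depends on k, so \<open>(1 - r) * P r r\<close> is the Abel mean of the antidiagonal sums.\<close>

lemma P_diag_limit:
  assumes a: "0 < a"
  shows "(\<lambda>n. (1 - v n ^ a) * P (v n ^ a) (v n ^ a)) \<longlonglongrightarrow> 1"
proof (rule Lim_transform_eventually)
  show "(\<lambda>n. (1 - v n ^ a) * (\<Sum>m. (v n ^ a) ^ m * (\<Sum>k\<le>m. p k (m - k)))) \<longlonglongrightarrow> 1"
    by (rule abel_mean_tendsto[OF diag pow_v[OF a]])
  show "eventually (\<lambda>n. (1 - v n ^ a) * (\<Sum>m. (v n ^ a) ^ m * (\<Sum>k\<le>m. p k (m - k)))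
      = (1 - v n ^ a) * P (v n ^ a) (v n ^ a)) sequentially"
    using pow_v(2)[OF a]
  proof eventually_elim
    case (elim n)
    have "(\<Sum>k\<le>m. (v n ^ a) ^ k * (v n ^ a) ^ (m - k) * p k (m - k)) = (v n ^ a) ^ m * (\<Sum>k\<le>m. p k (m - k))" for m
      unfolding sum_distrib_left by (rule sum.cong) (auto simp: power_add[symmetric])
    with double_series_rearrange(2)[of "v n ^ a" "v n ^ a" p] elim p show ?case
      unfolding P_def by (simp add: sums_iff)
  qed
qed

lemma Q_pos:
  assumes a: "0 < a"
  shows "eventually (\<lambda>n. 0 < Q (v n ^ a)) sequentially"
  using laplace_at_top[OF q q_sum pow_v[OF a]] unfolding Q_def filterlim_at_top_dense by blast

text \<open>On the diagonal \<open>P r r\<close> is of order 1 / (1 - r), but \<open>Q r\<close> is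
  of smaller order because \<open>q\<close> tends to 0; the remaining factor has to diverge. With
  relative error 1 the approximation gives \<open>P r r \<le> (2 * U r + D) * Q r\<close>, which
  fixes the threshold \<open>1 / (2 * (2 * Z + D))\<close>.\<close>

lemma U_at_top:
  assumes a: "0 < a"
  shows "filterlim (\<lambda>n. U (v n ^ a)) at_top sequentially"
  unfolding filterlim_at_top_gt[where c = 0]
proof (intro allI impI)
  fix Z :: real assume Z: "0 < Z"
  obtain D where D: "0 \<le> D"
    "\<And>w r. 0 \<le> w \<Longrightarrow> w < 1 \<Longrightarrow> 0 \<le> r \<Longrightarrow> r < 1 \<Longrightarrow> \<bar>P w r - U w * Q r\<bar> \<le> (1 * U w + D) * Q r"
    using P_approx[of 1] by auto
  have "eventually (\<lambda>n. 1 / 2 < (1 - v n ^ a) * P (v n ^ a) (v n ^ a)) sequentially"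
    by (rule order_tendstoD(1)[OF P_diag_limit[OF a]]) simp
  moreover have "eventually (\<lambda>n. (1 - v n ^ a) * Q (v n ^ a) < 1 / (2 * (2 * Z + D))) sequentially"
    unfolding Q_def using Z D(1)
    by (intro order_tendstoD(2)[OF abel_mean_tendsto[OF q_lim pow_v[OF a]]]) auto
  ultimately show "eventually (\<lambda>n. Z \<le> U (v n ^ a)) sequentially"
    using pow_v(2)[OF a] Q_pos[OF a]
  proof eventually_elim
    case (elim n)
    let ?r = "v n ^ a"
    show ?case
    proof (rule ccontr)
      assume "\<not> Z \<le> U ?r"
      then have lt: "U ?r < Z" by simp
      have "P ?r ?r \<le> (2 * U ?r + D) * Q ?r" using D(2)[of ?r ?r] elim by (simp add: algebra_simps abs_le_iff)
      also have "\<dots> \<le> (2 * Z + D) * Q ?r" using lt elim by (intro mult_right_mono) auto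
      finally have "(1 - ?r) * P ?r ?r \<le> (1 - ?r) * ((2 * Z + D) * Q ?r)" using elim by (intro mult_left_mono) auto
      also have "\<dots> = (2 * Z + D) * ((1 - ?r) * Q ?r)" by simp
      also have "\<dots> < (2 * Z + D) * (1 / (2 * (2 * Z + D)))"
        using elim Z D(1) by (intro mult_strict_left_mono) auto
      also have "\<dots> = 1 / 2" using Z D(1) by (simp add: field_simps)
      finally show False using elim by simp
    qed
  qed
qed

text \<open>Divergence of \<open>U\<close> absorbs the constant \<open>D\<close> into the relative
  error.\<close>

lemma P_asymp:
  assumes a: "0 < a" and d: "0 < d"
  shows "(\<lambda>n. P (v n ^ d) (v n ^ a) / (U (v n ^ d) * Q (v n ^ a))) \<longlonglongrightarrow> 1"
proof (rule tendstoI)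
  fix e :: real assume e: "0 < e"
  define \<eta> where "\<eta> = min 1 (e / 2)"
  have \<eta>: "0 < \<eta>" "\<eta> \<le> 1" "\<eta> \<le> e / 2" using e by (auto simp: \<eta>_def)
  obtain D where D: "0 \<le> D"
    "\<And>w r. 0 \<le> w \<Longrightarrow> w < 1 \<Longrightarrow> 0 \<le> r \<Longrightarrow> r < 1 \<Longrightarrow> \<bar>P w r - U w * Q r\<bar> \<le> (\<eta> * U w + D) * Q r"
    using P_approx[OF \<eta>(1,2)] by auto
  have "eventually (\<lambda>n. max 0 (2 * D / e) < U (v n ^ d)) sequentially"
    using U_at_top[OF d] unfolding filterlim_at_top_dense by blast
  with pow_v(2)[OF a] pow_v(2)[OF d] Q_pos[OF a]
  show "eventually (\<lambda>n. dist (P (v n ^ d) (v n ^ a) / (U (v n ^ d) * Q (v n ^ a))) 1 < e) sequentially"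
  proof eventually_elim
    case (elim n)
    let ?P = "P (v n ^ d) (v n ^ a)" and ?U = "U (v n ^ d)" and ?Q = "Q (v n ^ a)"
    have U: "0 < ?U" "D < e / 2 * ?U" using elim e by (auto simp: field_simps)
    have "\<eta> * ?U \<le> e / 2 * ?U" using \<eta> U by (intro mult_right_mono) auto
    moreover have "e / 2 * ?U + e / 2 * ?U = e * ?U" by simp
    ultimately have lt: "\<eta> * ?U + D < e * ?U" using U by linarith
    have "\<bar>?P - ?U * ?Q\<bar> \<le> (\<eta> * ?U + D) * ?Q" using elim by (intro D(2)) auto
    also have "\<dots> < e * ?U * ?Q" using lt elim by (intro mult_strict_right_mono) auto
    finally have "\<bar>?P - ?U * ?Q\<bar> < e * (?U * ?Q)" by simp
    moreover have "0 < ?U * ?Q" using U elim by simp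
    moreover have "?P / (?U * ?Q) - 1 = (?P - ?U * ?Q) / (?U * ?Q)" using U elim by (simp add: diff_divide_distrib)
    ultimately show ?case by (simp add: dist_real_def abs_divide pos_divide_less_eq)
  qed
qed

text \<open>On the diagonal, \<open>U (v ^ d)\<close> is asymptotic to the inverse of
  \<open>(1 - v ^ d) * Q (v ^ d)\<close>. Inserted into the asymptotics of
  \<open>P (v ^ d) (v ^ a)\<close>, this leaves the factor (1 - v) / (1 - v ^ d), which tends to 1 /
  d, times the ratio of \<open>Q (v ^ a)\<close> to \<open>Q (v ^ d)\<close>, which regular
  variation evaluates.\<close>

theorem P_limit:
  assumes rv: "\<And>c. 0 < c \<Longrightarrow> (\<lambda>l. (\<Sum>k\<le>l * c. q k) / (\<Sum>k\<le>l. q k)) \<longlonglongrightarrow> real c powr \<rho>"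
    and a: "0 < a" and d: "0 < d"
  shows "(\<lambda>n. (1 - v n) * (\<Sum>m. \<Sum>k\<le>m. (v n ^ d) ^ k * (v n ^ a) ^ (m - k) * p k (m - k)))
    \<longlonglongrightarrow> real d powr \<rho> / real a powr \<rho> / real d"
proof (rule Lim_transform_eventually)
  let ?PU = "\<lambda>a d n. P (v n ^ d) (v n ^ a) / (U (v n ^ d) * Q (v n ^ a))"
  let ?V = "\<lambda>c n. Q (v n) / Q (v n ^ c)"
  have V: "?V c \<longlonglongrightarrow> real c powr \<rho>" if "0 < c" for c
    unfolding Q_def by (rule laplace_dilate_limit[OF q q_sum rv[OF that] that v v01])
  have "(\<lambda>n. (\<Sum>i<d. v n ^ i)) \<longlonglongrightarrow> (\<Sum>i<d. 1 ^ i)" by (intro tendsto_intros v)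
  then have "(\<lambda>n. (\<Sum>i<d. v n ^ i)) \<longlonglongrightarrow> real d" by simp
  \<comment> \<open>The product is arranged so that every factor has a known limit; \<open>U\<close>
    occurs in two of them and cancels.\<close>
  then have "(\<lambda>n. ?PU a d n * ((1 - v n ^ d) * P (v n ^ d) (v n ^ d) / ?PU d d n) * (?V d n / ?V a n)
      * (1 / (\<Sum>i<d. v n ^ i))) \<longlonglongrightarrow> 1 * (1 / 1) * (real d powr \<rho> / real a powr \<rho>) * (1 / real d)"
    using a d by (intro tendsto_mult tendsto_divide P_asymp P_diag_limit V tendsto_const) auto
  then show "(\<lambda>n. ?PU a d n * ((1 - v n ^ d) * P (v n ^ d) (v n ^ d) / ?PU d d n) * (?V d n / ?V a n)
      * (1 / (\<Sum>i<d. v n ^ i))) \<longlonglongrightarrow> real d powr \<rho> / real a powr \<rho> / real d" by simp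
  have "eventually (\<lambda>n. 0 < v n) sequentially" using v by (rule order_tendstoD) simp
  moreover have "eventually (\<lambda>n. 0 < U (v n ^ d)) sequentially"
    using U_at_top[OF d] unfolding filterlim_at_top_dense by blast
  moreover have "eventually (\<lambda>n. 1 / 2 < (1 - v n ^ d) * P (v n ^ d) (v n ^ d)) sequentially"
    by (rule order_tendstoD(1)[OF P_diag_limit[OF d]]) simp
  moreover have "eventually (\<lambda>n. 0 < Q (v n)) sequentially" using Q_pos[of 1] by simp
  ultimately show "eventually (\<lambda>n. ?PU a d n * ((1 - v n ^ d) * P (v n ^ d) (v n ^ d) / ?PU d d n) * (?V d n / ?V a n)
      * (1 / (\<Sum>i<d. v n ^ i))
    = (1 - v n) * (\<Sum>m. \<Sum>k\<le>m. (v n ^ d) ^ k * (v n ^ a) ^ (m - k) * p k (m - k))) sequentially"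
    using pow_v(2)[OF a] pow_v(2)[OF d] Q_pos[OF a] Q_pos[OF d] v01
  proof eventually_elim
    case (elim n)
    define S where "S = (\<Sum>i<d. v n ^ i)"
    have S: "1 - v n ^ d = (1 - v n) * S" unfolding S_def by (simp add: one_diff_power_eq)
    have S0: "S \<noteq> 0" using elim S by auto
    have P0: "P (v n ^ d) (v n ^ d) \<noteq> 0" using elim by auto
    have "(\<Sum>m. \<Sum>k\<le>m. (v n ^ d) ^ k * (v n ^ a) ^ (m - k) * p k (m - k)) = P (v n ^ d) (v n ^ a)"
      using double_series_rearrange(2)[of "v n ^ d" "v n ^ a" p] elim p unfolding P_def by (simp add: sums_iff)
    moreover have "p1 / (u1 * qa) * ((1 - v n) * S * p2 / (p2 / (u1 * qd))) * ((qv / qd) / (qv / qa)) * (1 / S)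
        = (1 - v n) * p1"
      if "u1 \<noteq> 0" "qa \<noteq> 0" "qd \<noteq> 0" "qv \<noteq> 0" "p2 \<noteq> 0" for p1 p2 u1 qa qd qv :: real
      using that S0 by simp
    ultimately show ?case
      unfolding S_def[symmetric] S using elim P0 by simp
  qed
qed

end

end

section \<open>From averaged moments to limit laws of monotone processes\<close>

text \<open>Functionals act on functions on the whole plane, as polynomial functions are given
  there, but the bound looks only at the unit square, where Stone-Weierstrass approximates.\<close>

definition contractive_functional :: "((real \<times> real \<Rightarrow> real) \<Rightarrow> real) \<Rightarrow> bool" where
  "contractive_functional J \<longleftrightarrow>
     (\<forall>f g. continuous_on UNIV f \<longrightarrow> continuous_on UNIV g \<longrightarrow> J (\<lambda>z. f z + g z) = J f + J g) \<and>
     (\<forall>c f. continuous_on UNIV f \<longrightarrow> J (\<lambda>z. c * f z) = c * J f) \<and>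
     (\<forall>f B. continuous_on UNIV f \<longrightarrow> (\<forall>z\<in>{0..1} \<times> {0..1}. \<bar>f z\<bar> \<le> B) \<longrightarrow> \<bar>J f\<bar> \<le> B)"

lemma contractive_functionalD:
  assumes "contractive_functional J" and "continuous_on UNIV f"
  shows "continuous_on UNIV g \<Longrightarrow> J (\<lambda>z. f z + g z) = J f + J g"
    and "J (\<lambda>z. c * f z) = c * J f"
    and "(\<And>z. z \<in> {0..1} \<times> {0..1} \<Longrightarrow> \<bar>f z\<bar> \<le> B) \<Longrightarrow> \<bar>J f\<bar> \<le> B"
  using assms unfolding contractive_functional_def by blast+

lemma contractive_functional_diff:
  assumes "contractive_functional J" "continuous_on UNIV f" "continuous_on UNIV g"
  shows "J (\<lambda>z. f z - g z) = J f - J g"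
  using contractive_functionalD(1)[OF assms(1,2), of "\<lambda>z. (-1) * g z"] assms
    contractive_functionalD(2)[OF assms(1,3), of "-1"]
  by (simp add: continuous_on_minus)

lemma continuous_on_real_polynomial: "real_polynomial_function g \<Longrightarrow> continuous_on S g"
  by (simp add: continuous_at_imp_continuous_on continuous_real_polymonial_function)

text \<open>The induction carries a continuous weight \<open>h\<close>: in the product case the
  hypothesis for one factor is used with the other factor moved into the weight. A linear form
  raises one of the exponents by one, which is why all \<open>i\<close> and \<open>j\<close> are
  treated at once.\<close>

lemma real_polynomial_functional_limit:
  fixes L :: "nat \<Rightarrow> (real \<times> real \<Rightarrow> real) \<Rightarrow> real" and h :: "real \<times> real \<Rightarrow> real"
  assumes L: "\<And>n. contractive_functional (L n)" and K: "contractive_functional K"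
    and g: "real_polynomial_function g"
    and h: "continuous_on UNIV h"
    and lim: "\<And>i j. (\<lambda>n. L n (\<lambda>z. fst z ^ i * snd z ^ j * h z)) \<longlonglongrightarrow> K (\<lambda>z. fst z ^ i * snd z ^ j * h z)"
  shows "(\<lambda>n. L n (\<lambda>z. fst z ^ i * snd z ^ j * (g z * h z))) \<longlonglongrightarrow> K (\<lambda>z. fst z ^ i * snd z ^ j * (g z * h z))"
  using g h lim
proof (induction arbitrary: h i j rule: real_polynomial_function.induct)
  case (linear f)
  have f: "f z = f (1, 0) * fst z + f (0, 1) * snd z" for z
  proof -
    have "f z = f (fst z *\<^sub>R (1, 0) + snd z *\<^sub>R (0, 1))" by (cases z) (simp add: scaleR_prod_def)
    also have "\<dots> = fst z *\<^sub>R f (1, 0) + snd z *\<^sub>R f (0, 1)"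
      using linear(1) by (simp only: linear_simps bounded_linear.linear linear_add linear_scale)
    finally show ?thesis by simp
  qed
  have eq: "fst z ^ i * snd z ^ j * (f z * h z) =
      f (1, 0) * (fst z ^ Suc i * snd z ^ j * h z) + f (0, 1) * (fst z ^ i * snd z ^ Suc j * h z)" for z
    by (subst f) (simp add: algebra_simps)
  have c: "continuous_on UNIV (\<lambda>z. fst z ^ i * snd z ^ j * h z)" for i j
    by (intro continuous_intros linear)
  have e: "J (\<lambda>z. fst z ^ i * snd z ^ j * (f z * h z)) = f (1, 0) * J (\<lambda>z. fst z ^ Suc i * snd z ^ j * h z)
      + f (0, 1) * J (\<lambda>z. fst z ^ i * snd z ^ Suc j * h z)" if "contractive_functional J" for J
    unfolding eq using contractive_functionalD(1)[OF that continuous_on_mult_left[OF c] continuous_on_mult_left[OF c]]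
      contractive_functionalD(2)[OF that c] by (simp del: power_Suc)
  show ?case unfolding e[OF L] e[OF K] by (intro tendsto_intros linear)
next
  case (const c)
  have cc: "continuous_on UNIV (\<lambda>z. fst z ^ i * snd z ^ j * h z)" by (intro continuous_intros const)
  have eq: "fst z ^ i * snd z ^ j * (c * h z) = c * (fst z ^ i * snd z ^ j * h z)" for z by simp
  show ?case unfolding eq contractive_functionalD(2)[OF L cc] contractive_functionalD(2)[OF K cc]
    by (intro tendsto_intros const)
next
  case (add f g)
  have fg: "continuous_on UNIV f" "continuous_on UNIV g"
    using add(1,2) by (auto intro!: continuous_on_real_polynomial)
  have c: "continuous_on UNIV (\<lambda>z. fst z ^ i * snd z ^ j * (f z * h z))"
    "continuous_on UNIV (\<lambda>z. fst z ^ i * snd z ^ j * (g z * h z))"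
    by (intro continuous_intros fg add)+
  have eq: "fst z ^ i * snd z ^ j * ((f z + g z) * h z) =
      fst z ^ i * snd z ^ j * (f z * h z) + fst z ^ i * snd z ^ j * (g z * h z)" for z
    by (simp add: algebra_simps)
  show ?case unfolding eq contractive_functionalD(1)[OF L c] contractive_functionalD(1)[OF K c]
    by (intro tendsto_add add.IH add.prems)
next
  case (mult f g)
  have "continuous_on UNIV (\<lambda>z. g z * h z)"
    using mult(2) by (intro continuous_intros mult.prems continuous_on_real_polynomial)
  from mult.IH(1)[OF this mult.IH(2)[OF mult.prems]] show ?case by (simp add: mult.assoc)
qed

theorem functional_limit_of_moments:
  fixes L :: "nat \<Rightarrow> (real \<times> real \<Rightarrow> real) \<Rightarrow> real"
  assumes L: "\<And>n. contractive_functional (L n)" and K: "contractive_functional K"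
    and lim: "\<And>i j. (\<lambda>n. L n (\<lambda>z. fst z ^ i * snd z ^ j)) \<longlonglongrightarrow> K (\<lambda>z. fst z ^ i * snd z ^ j)"
    and f: "continuous_on UNIV f"
  shows "(\<lambda>n. L n f) \<longlonglongrightarrow> K f"
proof (rule tendstoI)
  fix e :: real assume e: "0 < e"
  have "compact ({0..1} \<times> {0..1} :: (real \<times> real) set)" by (intro compact_Times compact_Icc)
  then obtain g where g: "real_polynomial_function g" and fg: "\<And>z. z \<in> {0..1} \<times> {0..1} \<Longrightarrow> \<bar>f z - g z\<bar> < e / 3"
    using Stone_Weierstrass_real_polynomial_function[of "{0..1} \<times> {0..1}" f "e / 3"] e continuous_on_subset[OF f subset_UNIV]
    by auto
  have gc: "continuous_on UNIV g" using g by (rule continuous_on_real_polynomial)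
  have "(\<lambda>n. L n (\<lambda>z. fst z ^ 0 * snd z ^ 0 * (g z * 1))) \<longlonglongrightarrow> K (\<lambda>z. fst z ^ 0 * snd z ^ 0 * (g z * 1))"
    using lim by (intro real_polynomial_functional_limit[OF L K g]) auto
  then have "(\<lambda>n. L n g) \<longlonglongrightarrow> K g" by simp
  then have "eventually (\<lambda>n. dist (L n g) (K g) < e / 3) sequentially" using e by (intro tendstoD) auto
  then show "eventually (\<lambda>n. dist (L n f) (K f) < e) sequentially"
  proof eventually_elim
    case (elim n)
    have d: "\<bar>J f - J g\<bar> \<le> e / 3" if l: "contractive_functional J" for J
      unfolding contractive_functional_diff[OF l f gc, symmetric]
    proof (rule contractive_functionalD(3)[OF l continuous_on_diff[OF f gc]])
      show "\<bar>f z - g z\<bar> \<le> e / 3" if "z \<in> {0..1} \<times> {0..1}" for z using fg[OF that] by simp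
    qed
    from elim d[OF L[of n]] d[OF K] show ?case unfolding dist_real_def by linarith
  qed
qed

section \<open>Time windows and the uniform law\<close>

definition tent :: "real \<Rightarrow> real \<Rightarrow> real \<Rightarrow> real" where
  "tent l r u = max 0 (min (u - l) (r - u))"

lemma tent_nonneg: "0 \<le> tent l r u" by (simp add: tent_def)

lemma tent_eq_0: "u \<le> l \<or> r \<le> u \<Longrightarrow> tent l r u = 0" by (auto simp: tent_def)

lemma continuous_on_tent [continuous_intros]: "continuous_on S f \<Longrightarrow> continuous_on S (\<lambda>x. tent l r (f x))"
  unfolding tent_def by (intro continuous_intros)

text \<open>Lets test functions be evaluated at points of the unit square for every real argument,
  so that no almost-everywhere restriction is carried along.\<close>

definition clamp01 :: "real \<Rightarrow> real" where "clamp01 t = max 0 (min 1 t)"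

lemma clamp01: "0 \<le> clamp01 t" "clamp01 t \<le> 1" "0 \<le> t \<Longrightarrow> t \<le> 1 \<Longrightarrow> clamp01 t = t"
  by (auto simp: clamp01_def)

lemma clamp01_measurable [measurable]: "clamp01 \<in> borel_measurable borel"
  unfolding clamp01_def by measurable

text \<open>The limit law of \<open>v ^ m\<close> when m has the geometric weights
  \<open>(1 - v) * v ^ m\<close> and v tends to 1: a rescaled geometric time becomes exponential,
  and the exponential of its negative is uniform.\<close>

abbreviation unit_law :: "real measure" where
  "unit_law \<equiv> density lborel (\<lambda>u. ennreal (indicator {0..1} u))"

lemma prob_space_unit_law: "prob_space unit_law"
  by (rule prob_spaceI) (simp add: emeasure_density ennreal_indicator)

lemma integral_unit_law:
  fixes f :: "real \<Rightarrow> real"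
  assumes [measurable]: "f \<in> borel_measurable borel"
  shows "integral\<^sup>L unit_law f = (\<integral>u. indicator {0..1} u * f u \<partial>lborel)"
  by (subst integral_density) auto

lemma integral_unit_law_powr:
  assumes "0 \<le> a"
  shows "(\<integral>u. u powr a \<partial>unit_law) = 1 / (a + 1)"
proof -
  have "((\<lambda>u. u powr a) has_integral (1 powr (a + 1) / (a + 1))) {0..1}"
    using assms by (intro has_integral_powr_from_0) auto
  then have "(\<integral>\<^sup>+u. ennreal (u powr a) * indicator {0..1} u \<partial>lborel) = ennreal (1 / (a + 1))"
    by (intro nn_integral_has_integral_lebesgue') auto
  then have "(\<integral>\<^sup>+u. ennreal (indicator {0..1} u * u powr a) \<partial>lborel) = ennreal (1 / (a + 1))"
    by (simp add: ennreal_mult' ennreal_indicator mult.commute)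
  then have "(\<integral>u. indicator {0..1} u * u powr a \<partial>lborel) = 1 / (a + 1)"
    using assms by (subst integral_eq_nn_integral) auto
  then show ?thesis by (simp add: integral_unit_law)
qed

lemma integral_unit_law_tent_pos:
  assumes "0 \<le> l" "l < r" "r \<le> 1"
  shows "0 < (\<integral>u. tent l r (clamp01 u) \<partial>unit_law)"
proof -
  interpret prob_space unit_law by (rule prob_space_unit_law)
  \<comment> \<open>The tent is at least \<open>h\<close> on the middle third of its support, an
    interval of length \<open>h\<close>.\<close>
  define h where "h = (r - l) / 3"
  have h: "0 < h" "3 * h = r - l" using assms by (auto simp: h_def)
  have [measurable]: "tent l r \<in> borel_measurable borel" unfolding tent_def by measurable
  have "0 < h * h" using h by simp
  also have "h * h = (\<integral>u. h * indicator {l + h..r - h} u \<partial>lborel)" using h by simp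
  also have "\<dots> = (\<integral>u. h * indicator {l + h..r - h} u \<partial>unit_law)"
  proof -
    have "indicator {0..1} u * (h * indicator {l + h..r - h} u) = h * indicator {l + h..r - h} u" for u :: real
      using assms h by (auto simp: indicator_def)
    moreover have "(\<integral>u. h * indicator {l + h..r - h} u \<partial>unit_law) = (\<integral>u. indicator {0..1} u * (h * indicator {l + h..r - h} u) \<partial>lborel)"
      by (rule integral_unit_law) measurable
    ultimately show ?thesis by (simp only:)
  qed
  also have "\<dots> \<le> (\<integral>u. tent l r (clamp01 u) \<partial>unit_law)"
  proof (rule integral_mono)
    show "integrable unit_law (\<lambda>u. h * indicator {l + h..r - h} u)"
      by (rule integrable_const_bound[where B = h]) (use h in \<open>auto simp: indicator_def\<close>)
    show "integrable unit_law (\<lambda>u. tent l r (clamp01 u))"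
    proof (rule integrable_const_bound[where B = "r - l"])
      have "tent l r u \<le> r - l" for u using assms by (simp add: tent_def)
      then show "AE u in unit_law. norm (tent l r (clamp01 u)) \<le> r - l"
        using tent_nonneg[of l r] by auto
    qed measurable
    fix u
    show "h * indicator {l + h..r - h} u \<le> tent l r (clamp01 u)"
      using assms h by (auto simp: indicator_def tent_nonneg clamp01) (auto simp: tent_def)
  qed
  finally show ?thesis .
qed

text \<open>The hypothesis \<open>moments\<close> concerns the pair (v ^ m, v ^ Z m x) with m
  averaged over the geometric weights. Its limit is (U, U powr Y) with U uniform and Y independent
  of law \<open>\<kappa>\<close>: the mixed moment, the mean of U powr (i + j Y), equals the mean of
  1 / (1 + i + j Y).\<close>

locale monotone_visits = prob_space N for N :: "'a measure" +
  fixes Z :: "nat \<Rightarrow> 'a \<Rightarrow> nat" and \<kappa> :: "real measure"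
  assumes Z_measurable [measurable]: "\<And>m. Z m \<in> measurable N (count_space UNIV)"
    and Z_mono: "\<And>x m m'. x \<in> space N \<Longrightarrow> m \<le> m' \<Longrightarrow> Z m x \<le> Z m' x"
    and \<kappa>: "real_distribution \<kappa>" and \<kappa>01: "AE y in \<kappa>. 0 \<le> y \<and> y \<le> 1"
    and moments: "\<And>i j. (\<lambda>n. (1 - exp (- 1 / real (Suc n))) *
        (\<Sum>m. exp (- 1 / real (Suc n)) ^ m *
          (\<integral>x. (exp (- 1 / real (Suc n)) ^ m) ^ i * (exp (- 1 / real (Suc n)) ^ Z m x) ^ j \<partial>N)))
      \<longlonglongrightarrow> (\<integral>y. 1 / (1 + real i + real j * y) \<partial>\<kappa>)"
begin

definition v :: "nat \<Rightarrow> real" where "v n = exp (- 1 / real (Suc n))"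

lemma v: "0 < v n" "v n < 1" "0 \<le> v n" "v n ^ k \<le> 1"
  unfolding v_def by (auto intro!: power_le_one simp: divide_less_0_iff)

lemma v_power: "v n ^ k = exp (- (real k / real (Suc n)))"
  by (simp add: v_def exp_of_nat_mult[symmetric])

definition L :: "nat \<Rightarrow> (real \<times> real \<Rightarrow> real) \<Rightarrow> real" where
  "L n g = (1 - v n) * (\<Sum>m. v n ^ m * (\<integral>x. g (v n ^ m, v n ^ Z m x) \<partial>N))"

definition K :: "(real \<times> real \<Rightarrow> real) \<Rightarrow> real" where
  "K g = (\<integral>(u, y). g (clamp01 u, clamp01 u powr clamp01 y) \<partial>(unit_law \<Otimes>\<^sub>M \<kappa>))"

lemma square_bounded:
  fixes g :: "real \<times> real \<Rightarrow> real"
  assumes "continuous_on UNIV g"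
  obtains B where "\<And>z. z \<in> {0..1} \<times> {0..1} \<Longrightarrow> \<bar>g z\<bar> \<le> B"
proof -
  have "compact (g ` ({0..1} \<times> {0..1}))"
    by (intro compact_continuous_image continuous_on_subset[OF assms] compact_Times compact_Icc) auto
  then have "bounded (g ` ({0..1} \<times> {0..1}))" by (rule compact_imp_bounded)
  then obtain B where B: "\<forall>x\<in>g ` ({0..1} \<times> {0..1}). norm x \<le> B" unfolding bounded_iff by blast
  show ?thesis
  proof (rule that)
    show "\<bar>g z\<bar> \<le> B" if "z \<in> {0..1} \<times> {0..1}" for z using B that by (metis imageI real_norm_def)
  qed
qed

lemma L_integrable:
  fixes g :: "real \<times> real \<Rightarrow> real"
  assumes g: "continuous_on UNIV g"
  shows "integrable N (\<lambda>x. g (v n ^ m, v n ^ Z m x))"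
proof -
  obtain B where B: "\<And>z. z \<in> {0..1} \<times> {0..1} \<Longrightarrow> \<bar>g z\<bar> \<le> B" using square_bounded[OF g] by blast
  have [measurable]: "g \<in> borel_measurable borel" using g by (rule borel_measurable_continuous_onI)
  show ?thesis
    by (rule integrable_const_bound[where B = B]) (use v in \<open>auto intro!: B\<close>)
qed

lemma L_inner_bound:
  fixes g :: "real \<times> real \<Rightarrow> real"
  assumes g: "continuous_on UNIV g" and B: "\<And>z. z \<in> {0..1} \<times> {0..1} \<Longrightarrow> \<bar>g z\<bar> \<le> B"
  shows "\<bar>\<integral>x. g (v n ^ m, v n ^ Z m x) \<partial>N\<bar> \<le> B"
proof -
  have "\<bar>\<integral>x. g (v n ^ m, v n ^ Z m x) \<partial>N\<bar> \<le> (\<integral>x. \<bar>g (v n ^ m, v n ^ Z m x)\<bar> \<partial>N)"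
    by (rule integral_abs_bound)
  also have "\<dots> \<le> (\<integral>x. B \<partial>N)"
    using v by (intro integral_mono integrable_abs L_integrable g B) auto
  finally show ?thesis by (simp add: prob_space)
qed

lemma L_summable:
  fixes g :: "real \<times> real \<Rightarrow> real"
  assumes g: "continuous_on UNIV g"
  shows "summable (\<lambda>m. v n ^ m * (\<integral>x. g (v n ^ m, v n ^ Z m x) \<partial>N))"
proof -
  obtain B where B: "\<And>z. z \<in> {0..1} \<times> {0..1} \<Longrightarrow> \<bar>g z\<bar> \<le> B" using square_bounded[OF g] by blast
  show ?thesis using v by (intro summable_power_bounded[where B = B] L_inner_bound[OF g B])
qed

lemma contractive_L: "contractive_functional (L n)"
  unfolding contractive_functional_def
proof (intro conjI allI impI)
  fix f g :: "real \<times> real \<Rightarrow> real" assume fg: "continuous_on UNIV f" "continuous_on UNIV g"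
  show "L n (\<lambda>z. f z + g z) = L n f + L n g"
    unfolding L_def using fg
    by (simp add: L_integrable distrib_left suminf_add[OF L_summable L_summable, symmetric])
next
  fix f :: "real \<times> real \<Rightarrow> real" and c assume f: "continuous_on UNIV f"
  show "L n (\<lambda>z. c * f z) = c * L n f"
    unfolding L_def using suminf_mult[OF L_summable[OF f], of c] by (simp add: mult.left_commute)
next
  fix f :: "real \<times> real \<Rightarrow> real" and B assume f: "continuous_on UNIV f" and B: "\<forall>z\<in>{0..1} \<times> {0..1}. \<bar>f z\<bar> \<le> B"
  have "norm (\<Sum>m. v n ^ m * (\<integral>x. f (v n ^ m, v n ^ Z m x) \<partial>N)) \<le> (\<Sum>m. B * v n ^ m)"
  proof (rule norm_suminf_le)
    show "norm (v n ^ m * (\<integral>x. f (v n ^ m, v n ^ Z m x) \<partial>N)) \<le> B * v n ^ m" for m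
      using L_inner_bound[OF f, of B n m] B v[of n] by (simp add: abs_mult mult.commute mult_right_mono)
    show "summable (\<lambda>m. B * v n ^ m)" using v by (intro summable_mult summable_geometric) auto
  qed
  also have "\<dots> = B * (1 / (1 - v n))"
    using v[of n] by (simp add: suminf_mult summable_geometric suminf_geometric del: times_divide_eq_right)
  finally have "(1 - v n) * norm (\<Sum>m. v n ^ m * (\<integral>x. f (v n ^ m, v n ^ Z m x) \<partial>N)) \<le> (1 - v n) * (B * (1 / (1 - v n)))"
    using v[of n] by (intro mult_left_mono) auto
  also have "\<dots> = B" using v[of n] by simp
  finally show "\<bar>L n f\<bar> \<le> B" using v[of n] by (simp add: L_def abs_mult)
qed

interpretation \<kappa>: real_distribution \<kappa> by (rule \<kappa>)

interpretation unit: prob_space unit_law by (rule prob_space_unit_law)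

interpretation prod: pair_prob_space unit_law \<kappa> ..

lemma K_point: "(clamp01 u, clamp01 u powr clamp01 y) \<in> {0..1} \<times> {0..1}"
  by (auto simp: clamp01 powr_le1)

lemma K_integrable:
  fixes g :: "real \<times> real \<Rightarrow> real"
  assumes g: "continuous_on UNIV g"
  shows "integrable (unit_law \<Otimes>\<^sub>M \<kappa>) (\<lambda>(u, y). g (clamp01 u, clamp01 u powr clamp01 y))"
proof -
  obtain B where B: "\<And>z. z \<in> {0..1} \<times> {0..1} \<Longrightarrow> \<bar>g z\<bar> \<le> B" using square_bounded[OF g] by blast
  have [measurable]: "g \<in> borel_measurable borel" using g by (rule borel_measurable_continuous_onI)
  show ?thesis
    by (rule prod.integrable_const_bound[where B = B]) (use B[OF K_point] in \<open>auto\<close>)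
qed

lemma contractive_K: "contractive_functional K"
  unfolding contractive_functional_def
proof (intro conjI allI impI)
  fix f g :: "real \<times> real \<Rightarrow> real" assume fg: "continuous_on UNIV f" "continuous_on UNIV g"
  show "K (\<lambda>z. f z + g z) = K f + K g"
    using Bochner_Integration.integral_add[OF K_integrable[OF fg(1)] K_integrable[OF fg(2)]]
    by (simp add: K_def split_beta')
next
  fix f :: "real \<times> real \<Rightarrow> real" and c assume f: "continuous_on UNIV f"
  show "K (\<lambda>z. c * f z) = c * K f" by (simp add: K_def split_beta')
next
  fix f :: "real \<times> real \<Rightarrow> real" and B assume f: "continuous_on UNIV f" and B: "\<forall>z\<in>{0..1} \<times> {0..1}. \<bar>f z\<bar> \<le> B"
  have "\<bar>K f\<bar> \<le> (\<integral>w. \<bar>case w of (u, y) \<Rightarrow> f (clamp01 u, clamp01 u powr clamp01 y)\<bar> \<partial>(unit_law \<Otimes>\<^sub>M \<kappa>))"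
    unfolding K_def by (rule integral_abs_bound)
  also have "\<dots> \<le> (\<integral>w. B \<partial>(unit_law \<Otimes>\<^sub>M \<kappa>))"
    using B K_point by (intro integral_mono integrable_abs K_integrable f) auto
  finally show "\<bar>K f\<bar> \<le> B" by (simp add: prod.prob_space)
qed

lemma K_iterated:
  fixes g :: "real \<times> real \<Rightarrow> real"
  assumes g: "continuous_on UNIV g"
  shows "K g = (\<integral>y. (\<integral>u. g (clamp01 u, clamp01 u powr clamp01 y) \<partial>unit_law) \<partial>\<kappa>)"
  unfolding K_def by (rule prod.integral_snd[OF K_integrable[OF g], symmetric])

lemma K_moment: "K (\<lambda>z. fst z ^ i * snd z ^ j) = (\<integral>y. 1 / (1 + real i + real j * y) \<partial>\<kappa>)"
proof -
  have "continuous_on UNIV (\<lambda>z :: real \<times> real. fst z ^ i * snd z ^ j)" by (intro continuous_intros)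
  then have "K (\<lambda>z. fst z ^ i * snd z ^ j)
      = (\<integral>y. (\<integral>u. clamp01 u ^ i * (clamp01 u powr clamp01 y) ^ j \<partial>unit_law) \<partial>\<kappa>)"
    by (subst K_iterated) auto
  also have "\<dots> = (\<integral>y. 1 / (1 + real i + real j * y) \<partial>\<kappa>)"
  proof (rule integral_cong_AE)
    show "AE y in \<kappa>. (\<integral>u. clamp01 u ^ i * (clamp01 u powr clamp01 y) ^ j \<partial>unit_law) = 1 / (1 + real i + real j * y)"
      using \<kappa>01
    proof eventually_elim
      case (elim y)
      have "(\<integral>u. clamp01 u ^ i * (clamp01 u powr clamp01 y) ^ j \<partial>unit_law) = (\<integral>u. u powr (real i + real j * y) \<partial>unit_law)"
      proof (rule integral_cong_AE)
        \<comment> \<open>At u = 0 the two sides differ when i = j = 0, since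
          \<open>0 powr 0 = 0\<close>; this null set is discarded.\<close>
        have "AE u in lborel. (u::real) \<noteq> 0" by (rule AE_lborel_singleton)
        then show "AE u in unit_law. clamp01 u ^ i * (clamp01 u powr clamp01 y) ^ j = u powr (real i + real j * y)"
          using elim by (subst AE_density)
            (auto simp: indicator_def clamp01 powr_add powr_realpow powr_powr[symmetric] mult.commute
              simp flip: powr_realpow elim!: eventually_mono)
      qed auto
      then show ?case using elim by (simp add: integral_unit_law_powr add.assoc add.commute)
    qed
  qed measurable
  finally show ?thesis .
qed

lemma L_limit:
  fixes g :: "real \<times> real \<Rightarrow> real"
  assumes "continuous_on UNIV g"
  shows "(\<lambda>n. L n g) \<longlonglongrightarrow> K g"
proof (rule functional_limit_of_moments[OF contractive_L contractive_K _ assms])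
  fix i j
  show "(\<lambda>n. L n (\<lambda>z. fst z ^ i * snd z ^ j)) \<longlonglongrightarrow> K (\<lambda>z. fst z ^ i * snd z ^ j)"
    unfolding K_moment using moments[of i j] by (simp add: L_def v_def)
qed

context
  fixes \<beta> :: "real \<Rightarrow> real"
  assumes \<beta>_cont: "continuous_on UNIV \<beta>" and \<beta>_anti: "antimono \<beta>" and \<beta>_const: "\<And>z. 1 \<le> z \<Longrightarrow> \<beta> z = \<beta> 1"
begin

text \<open>Transports \<open>\<beta>\<close> to the variable \<open>w = exp (- z)\<close>.
  Truncation at \<open>exp (- 1)\<close> removes the singularity of the logarithm at 0 and loses
  nothing, because \<open>\<beta>\<close> is constant beyond 1.\<close>

definition b :: "real \<Rightarrow> real" where "b w = \<beta> (- ln (max w (exp (- 1))))"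

lemma b_exp: "b (exp (- z)) = \<beta> z"
proof -
  have "max (exp (- z)) (exp (- 1)) = exp (- min z 1)" by (auto simp: max_def min_def)
  then show ?thesis using \<beta>_const[of z] by (simp add: b_def min_def)
qed

lemma b_cont: "continuous_on S f \<Longrightarrow> continuous_on S (\<lambda>x. b (f x))"
proof -
  assume f: "continuous_on S f"
  have "0 < max (f x) (exp (- 1))" for x by (simp add: less_max_iff_disj)
  then have "max (f x) (exp (- 1)) \<noteq> 0" for x by (metis less_irrefl)
  then have "continuous_on S (\<lambda>x. - ln (max (f x) (exp (- 1))))"
    by (intro continuous_on_minus continuous_on_ln continuous_on_max f continuous_on_const ballI)
  from continuous_on_compose2[OF \<beta>_cont this] show ?thesis unfolding b_def by simp
qed

lemma \<beta>_integrable: "integrable \<kappa> \<beta>"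
proof -
  have "compact (\<beta> ` {0..1})" by (intro compact_continuous_image continuous_on_subset[OF \<beta>_cont]) auto
  then have "bounded (\<beta> ` {0..1})" by (rule compact_imp_bounded)
  then obtain B where B: "\<forall>x\<in>\<beta> ` {0..1}. norm x \<le> B" unfolding bounded_iff by blast
  have [measurable]: "\<beta> \<in> borel_measurable borel" using \<beta>_cont by (rule borel_measurable_continuous_onI)
  show ?thesis
  proof (rule \<kappa>.integrable_const_bound)
    show "AE y in \<kappa>. norm (\<beta> y) \<le> B" using \<kappa>01 by eventually_elim (use B in auto)
  qed simp
qed

text \<open>Time m and scale n + 1 are kept apart, so that m can run through a window while n is
  fixed.\<close>

definition E :: "nat \<Rightarrow> nat \<Rightarrow> real" where "E n m = (\<integral>x. \<beta> (real (Z m x) / real (Suc n)) \<partial>N)"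

lemma b_v: "b (v n ^ k) = \<beta> (real k / real (Suc n))"
  by (simp only: v_power b_exp)

lemma E_integrable: "integrable N (\<lambda>x. \<beta> (real (Z m x) / real (Suc n)))"
  using L_integrable[of "\<lambda>z. b (snd z)" n m] by (simp add: b_cont continuous_on_snd b_v del: of_nat_Suc)

lemma E_anti: "m \<le> m' \<Longrightarrow> E n m' \<le> E n m"
  unfolding E_def
  by (intro integral_mono E_integrable antimonoD[OF \<beta>_anti] divide_right_mono) (auto dest: Z_mono)

lemma L_tent: "L n (\<lambda>z. tent l r (fst z)) = (1 - v n) * (\<Sum>m. v n ^ m * tent l r (v n ^ m))"
  by (simp add: L_def prob_space)

lemma L_tent_b: "L n (\<lambda>z. tent l r (fst z) * b (snd z)) = (1 - v n) * (\<Sum>m. v n ^ m * (tent l r (v n ^ m) * E n m))"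
  by (simp add: L_def E_def b_v del: of_nat_Suc)

lemma tent_cont: "continuous_on UNIV (\<lambda>z. tent l r (fst z))"
  and tent_b_cont: "continuous_on UNIV (\<lambda>z. tent l r (fst z) * b (snd z))"
  by (intro continuous_intros b_cont)+

lemma L_tent_summable: "summable (\<lambda>m. v n ^ m * tent l r (v n ^ m))"
  using L_summable[OF tent_cont, of n l r] by (simp add: prob_space)

lemma L_tent_b_summable: "summable (\<lambda>m. v n ^ m * (tent l r (v n ^ m) * E n m))"
  using L_summable[OF tent_b_cont, of n l r] by (simp add: E_def b_v del: of_nat_Suc)

text \<open>A tent to the left of \<open>exp (- 1)\<close> only sees times \<open>m > n\<close>, one to the right only times \<open>m \<le> n\<close>;
  this is where monotonicity of the process removes the averaging over time.\<close>

lemma L_tent_b_le: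
  assumes "r \<le> exp (- 1)"
  shows "L n (\<lambda>z. tent l r (fst z) * b (snd z)) \<le> E n (Suc n) * L n (\<lambda>z. tent l r (fst z))"
proof -
  have le: "v n ^ m * (tent l r (v n ^ m) * E n m) \<le> E n (Suc n) * (v n ^ m * tent l r (v n ^ m))" for m
  proof (cases "m \<le> Suc n")
    case True
    then have "real m / real (Suc n) \<le> 1" by simp
    then have "r \<le> v n ^ m" unfolding v_power using assms by (intro order_trans[OF assms]) simp
    then show ?thesis by (simp add: tent_eq_0)
  next
    case False
    then have "v n ^ m * tent l r (v n ^ m) * E n m \<le> v n ^ m * tent l r (v n ^ m) * E n (Suc n)"
      using v[of n] by (intro mult_left_mono E_anti mult_nonneg_nonneg tent_nonneg) auto
    then show ?thesis by (simp add: mult_ac)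
  qed
  have "(\<Sum>m. v n ^ m * (tent l r (v n ^ m) * E n m)) \<le> (\<Sum>m. E n (Suc n) * (v n ^ m * tent l r (v n ^ m)))"
    by (intro suminf_le le L_tent_b_summable summable_mult L_tent_summable)
  then show ?thesis
    unfolding L_tent L_tent_b suminf_mult[OF L_tent_summable]
    using v[of n] mult_left_mono[of _ _ "1 - v n"] by (simp add: mult.left_commute)
qed

lemma L_tent_b_ge:
  assumes "exp (- 1) \<le> l"
  shows "E n (Suc n) * L n (\<lambda>z. tent l r (fst z)) \<le> L n (\<lambda>z. tent l r (fst z) * b (snd z))"
proof -
  have le: "E n (Suc n) * (v n ^ m * tent l r (v n ^ m)) \<le> v n ^ m * (tent l r (v n ^ m) * E n m)" for m
  proof (cases "Suc n \<le> m")
    case True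
    then have "1 \<le> real m / real (Suc n)" by (simp del: of_nat_Suc)
    then have "v n ^ m \<le> l" unfolding v_power by (intro order_trans[OF _ assms]) simp
    then show ?thesis by (simp add: tent_eq_0)
  next
    case False
    then have "v n ^ m * tent l r (v n ^ m) * E n (Suc n) \<le> v n ^ m * tent l r (v n ^ m) * E n m"
      using v[of n] by (intro mult_left_mono E_anti mult_nonneg_nonneg tent_nonneg) auto
    then show ?thesis by (simp add: mult_ac)
  qed
  have "(\<Sum>m. E n (Suc n) * (v n ^ m * tent l r (v n ^ m))) \<le> (\<Sum>m. v n ^ m * (tent l r (v n ^ m) * E n m))"
    by (intro suminf_le le L_tent_b_summable summable_mult L_tent_summable)
  then show ?thesis
    unfolding L_tent L_tent_b suminf_mult[OF L_tent_summable]
    using v[of n] mult_left_mono[of _ _ "1 - v n"] by (simp add: mult.left_commute)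
qed

lemma K_tent: "K (\<lambda>z. tent l r (fst z)) = (\<integral>u. tent l r (clamp01 u) \<partial>unit_law)"
  using \<kappa>.prob_space by (subst K_iterated[OF tent_cont]) simp

text \<open>On the window, \<open>b (u powr y)\<close> is \<open>\<beta> (- ln u * y)\<close>. Near
  \<open>exp (- 1)\<close> the factor \<open>- ln u\<close> is close to 1, so the integral nearly
  factorises into the mass of the tent and the mean of \<open>\<beta>\<close>.\<close>

lemma K_tent_b:
  assumes lr: "0 < l" "l < r" "r \<le> 1"
    and close: "\<And>u y. l < u \<Longrightarrow> u < r \<Longrightarrow> 0 \<le> y \<Longrightarrow> y \<le> 1 \<Longrightarrow> \<bar>\<beta> (- ln u * y) - \<beta> y\<bar> \<le> e"
  shows "\<bar>K (\<lambda>z. tent l r (fst z) * b (snd z)) - K (\<lambda>z. tent l r (fst z)) * (\<integral>y. \<beta> y \<partial>\<kappa>)\<bar>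
    \<le> e * K (\<lambda>z. tent l r (fst z))"
proof -
  let ?A = "\<integral>u. tent l r (clamp01 u) \<partial>unit_law"
  let ?I = "\<lambda>y. \<integral>u. tent l r (clamp01 u) * b (clamp01 u powr clamp01 y) \<partial>unit_law"
  have [measurable]: "tent l r \<in> borel_measurable borel" unfolding tent_def by measurable
  have [measurable]: "b \<in> borel_measurable borel"
    using b_cont[OF continuous_on_id] by (rule borel_measurable_continuous_onI)
  have [measurable]: "\<beta> \<in> borel_measurable borel" using \<beta>_cont by (rule borel_measurable_continuous_onI)
  have tint: "integrable unit_law (\<lambda>u. tent l r (clamp01 u))"
  proof (rule unit.integrable_const_bound[where B = "r - l"])
    have "tent l r u \<le> r - l" for u using lr by (simp add: tent_def)
    then show "AE u in unit_law. norm (tent l r (clamp01 u)) \<le> r - l" using tent_nonneg[of l r] by auto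
  qed measurable
  have intI: "integrable \<kappa> ?I"
    using prod.integrable_snd[OF K_integrable[OF tent_b_cont], of l r] by simp
  have diff: "\<bar>?I y - \<beta> y * ?A\<bar> \<le> e * ?A" if y: "0 \<le> y" "y \<le> 1" for y
  proof -
    have pt: "\<bar>tent l r (clamp01 u) * b (clamp01 u powr clamp01 y) - \<beta> y * tent l r (clamp01 u)\<bar>
        \<le> e * tent l r (clamp01 u)" for u
    proof (cases "l < clamp01 u \<and> clamp01 u < r")
      case True
      let ?u = "clamp01 u"
      have "?u powr clamp01 y = exp (- (- ln ?u * y))" using True lr y by (simp add: powr_def clamp01 mult.commute)
      then have "b (?u powr clamp01 y) = \<beta> (- ln ?u * y)" by (simp only: b_exp)
      then have "tent l r ?u * b (?u powr clamp01 y) - \<beta> y * tent l r ?u = tent l r ?u * (\<beta> (- ln ?u * y) - \<beta> y)"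
        by (simp add: algebra_simps)
      then have "\<bar>tent l r ?u * b (?u powr clamp01 y) - \<beta> y * tent l r ?u\<bar> = tent l r ?u * \<bar>\<beta> (- ln ?u * y) - \<beta> y\<bar>"
        by (simp only: abs_mult abs_of_nonneg[OF tent_nonneg])
      also have "\<dots> \<le> tent l r ?u * e" using close[of ?u y] True y by (intro mult_left_mono tent_nonneg) auto
      finally show ?thesis by (simp add: mult.commute)
    next
      case False
      then have "tent l r (clamp01 u) = 0" by (intro tent_eq_0) auto
      then show ?thesis by simp
    qed
    have i1: "integrable unit_law (\<lambda>u. tent l r (clamp01 u) * b (clamp01 u powr clamp01 y))"
    proof -
      obtain B where B: "\<And>z. z \<in> {0..1} \<times> {0..1} \<Longrightarrow> \<bar>tent l r (fst z) * b (snd z)\<bar> \<le> B"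
        using square_bounded[OF tent_b_cont] by blast
      show ?thesis
      proof (rule unit.integrable_const_bound[where B = B])
        show "AE u in unit_law. norm (tent l r (clamp01 u) * b (clamp01 u powr clamp01 y)) \<le> B"
          using B[OF K_point] by (intro AE_I2) simp
      qed measurable
    qed
    have eq: "?I y - \<beta> y * ?A = (\<integral>u. tent l r (clamp01 u) * b (clamp01 u powr clamp01 y) - \<beta> y * tent l r (clamp01 u) \<partial>unit_law)"
      using i1 tint by simp
    have "\<bar>?I y - \<beta> y * ?A\<bar> \<le> (\<integral>u. \<bar>tent l r (clamp01 u) * b (clamp01 u powr clamp01 y) - \<beta> y * tent l r (clamp01 u)\<bar> \<partial>unit_law)"
      unfolding eq by (rule integral_abs_bound)
    also have "\<dots> \<le> (\<integral>u. e * tent l r (clamp01 u) \<partial>unit_law)"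
    proof (rule integral_mono)
      fix u
      show "\<bar>tent l r (clamp01 u) * b (clamp01 u powr clamp01 y) - \<beta> y * tent l r (clamp01 u)\<bar> \<le> e * tent l r (clamp01 u)"
        by (rule pt)
    next
      show "integrable unit_law (\<lambda>u. \<bar>tent l r (clamp01 u) * b (clamp01 u powr clamp01 y) - \<beta> y * tent l r (clamp01 u)\<bar>)"
        by (intro integrable_abs Bochner_Integration.integrable_diff i1 integrable_mult_right tint)
      show "integrable unit_law (\<lambda>u. e * tent l r (clamp01 u))" by (intro integrable_mult_right tint)
    qed
    also have "\<dots> = e * ?A" by simp
    finally show ?thesis .
  qed
  have eq: "K (\<lambda>z. tent l r (fst z) * b (snd z)) - ?A * (\<integral>y. \<beta> y \<partial>\<kappa>) = (\<integral>y. ?I y - \<beta> y * ?A \<partial>\<kappa>)"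
    using intI \<beta>_integrable by (subst K_iterated[OF tent_b_cont]) simp
  have "\<bar>K (\<lambda>z. tent l r (fst z) * b (snd z)) - ?A * (\<integral>y. \<beta> y \<partial>\<kappa>)\<bar> \<le> (\<integral>y. \<bar>?I y - \<beta> y * ?A\<bar> \<partial>\<kappa>)"
    unfolding eq by (rule integral_abs_bound)
  also have "\<dots> \<le> (\<integral>y. e * ?A \<partial>\<kappa>)"
  proof (rule integral_mono_AE)
    show "AE y in \<kappa>. \<bar>?I y - \<beta> y * ?A\<bar> \<le> e * ?A" using \<kappa>01 by eventually_elim (use diff in auto)
  qed (use intI \<beta>_integrable in auto)
  finally show ?thesis unfolding K_tent using \<kappa>.prob_space by simp
qed

text \<open>The time \<open>m = n + 1\<close> corresponds to \<open>v ^ m = exp (- 1)\<close>.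
  Normalised windows just to the left and just to the right of this point average later and earlier
  times, so they bound \<open>E n (Suc n)\<close> from below and from above; both limits lie within
  \<open>e / 3\<close> of the mean of \<open>\<beta>\<close>.\<close>

theorem monotone_law_limit:
  "(\<lambda>n. \<integral>x. \<beta> (real (Z (Suc n) x) / real (Suc n)) \<partial>N) \<longlonglongrightarrow> (\<integral>y. \<beta> y \<partial>\<kappa>)"
proof (rule tendstoI)
  fix e :: real assume e: "0 < e"
  define I where "I = (\<integral>y. \<beta> y \<partial>\<kappa>)"
  \<comment> \<open>For u in the window, \<open>- ln u\<close> lies between
    \<open>1 - \<eta>\<close> and \<open>1 + \<eta>\<close> with \<open>\<eta> < 1\<close>, hence
    \<open>- ln u * y\<close> stays in [0, 2].\<close>
  have "uniformly_continuous_on {0..2} \<beta>"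
    by (intro compact_uniformly_continuous continuous_on_subset[OF \<beta>_cont]) auto
  then obtain d where d0: "0 < d"
    and d': "\<And>s t. s \<in> {0..2} \<Longrightarrow> t \<in> {0..2} \<Longrightarrow> dist t s < d \<Longrightarrow> dist (\<beta> t) (\<beta> s) < e / 3"
    using e by (elim uniformly_continuous_onE[of _ _ "e / 3"]) auto
  have d: "0 < d" "\<And>s t. s \<in> {0..2} \<Longrightarrow> t \<in> {0..2} \<Longrightarrow> \<bar>s - t\<bar> < d \<Longrightarrow> \<bar>\<beta> s - \<beta> t\<bar> < e / 3"
    using d0 d' by (auto simp: dist_real_def)
  define \<eta> where "\<eta> = min d 1 / 2"
  have \<eta>: "0 < \<eta>" "\<eta> < 1" "\<eta> < d" using d(1) by (auto simp: \<eta>_def)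
  have close: "\<bar>\<beta> (- ln u * y) - \<beta> y\<bar> \<le> e / 3"
    if u: "exp (- (1 + \<eta>)) < u" "u < exp (- (1 - \<eta>))" and y: "0 \<le> y" "y \<le> 1" for u y
  proof -
    have u0: "0 < u" using u(1) exp_gt_zero by (rule less_trans[rotated])
    have "- (1 + \<eta>) < ln u" "ln u < - (1 - \<eta>)"
      using u u0 ln_less_cancel_iff[of "exp (- (1 + \<eta>))" u] ln_less_cancel_iff[of u "exp (- (1 - \<eta>))"] by auto
    then have t: "\<bar>- ln u - 1\<bar> < \<eta>" "0 \<le> - ln u" "- ln u \<le> 2" using \<eta> by auto
    have "\<bar>- ln u * y - y\<bar> = \<bar>- ln u - 1\<bar> * y" using y abs_mult[of "- ln u - 1" y] by (simp add: left_diff_distrib)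
    also have "\<dots> \<le> \<bar>- ln u - 1\<bar> * 1" using y by (intro mult_left_mono) auto
    also have "\<dots> < d" using t \<eta> by simp
    finally have "\<bar>- ln u * y - y\<bar> < d" .
    moreover have "0 \<le> - ln u * y" using t y by (intro mult_nonneg_nonneg) auto
    moreover have "- ln u * y \<le> 2 * 1" using t y by (intro mult_mono) auto
    ultimately show ?thesis using d(2)[of "- ln u * y" y] y by auto
  qed
  define A where "A l r = K (\<lambda>z. tent l r (fst z))" for l r
  define X where "X l r = K (\<lambda>z. tent l r (fst z) * b (snd z))" for l r
  have main: "0 < A l r \<and> (\<lambda>n. L n (\<lambda>z. tent l r (fst z))) \<longlonglongrightarrow> A l r \<and> \<bar>X l r / A l r - I\<bar> \<le> e / 3 \<and>
      (\<lambda>n. L n (\<lambda>z. tent l r (fst z) * b (snd z)) / L n (\<lambda>z. tent l r (fst z))) \<longlonglongrightarrow> X l r / A l r"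
    if lr: "exp (- (1 + \<eta>)) \<le> l" "l < r" "r \<le> exp (- (1 - \<eta>))" for l r
  proof -
    have l0: "0 < l" using lr(1) exp_gt_zero by (rule less_le_trans[rotated])
    have r1: "r \<le> 1" by (rule order_trans[OF lr(3)]) (use \<eta> in simp)
    have A: "0 < A l r" unfolding A_def K_tent using l0 lr r1 by (intro integral_unit_law_tent_pos) auto
    have lim: "(\<lambda>n. L n (\<lambda>z. tent l r (fst z))) \<longlonglongrightarrow> A l r" unfolding A_def by (rule L_limit[OF tent_cont])
    have "(\<lambda>n. L n (\<lambda>z. tent l r (fst z) * b (snd z))) \<longlonglongrightarrow> X l r" unfolding X_def by (rule L_limit[OF tent_b_cont])
    then have lim2: "(\<lambda>n. L n (\<lambda>z. tent l r (fst z) * b (snd z)) / L n (\<lambda>z. tent l r (fst z))) \<longlonglongrightarrow> X l r / A l r"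
      using lim A by (intro tendsto_divide) auto
    have "\<bar>X l r - A l r * I\<bar> \<le> e / 3 * A l r"
      unfolding X_def A_def I_def using l0 lr r1 by (intro K_tent_b close) auto
    then have "\<bar>X l r - A l r * I\<bar> / A l r \<le> e / 3" using A by (simp add: pos_divide_le_eq)
    moreover have "X l r / A l r - I = (X l r - A l r * I) / A l r" using A by (simp add: diff_divide_distrib)
    ultimately show ?thesis using A lim lim2 by (simp add: abs_divide)
  qed
  let ?l = "exp (- (1 + \<eta>))" and ?r = "exp (- (1 - \<eta>))" and ?c = "exp (- 1 :: real)"
  have lower: "eventually (\<lambda>n. I - e < E n (Suc n)) sequentially"
  proof -
    from main[of ?l ?c] \<eta> have m: "0 < A ?l ?c" "(\<lambda>n. L n (\<lambda>z. tent ?l ?c (fst z))) \<longlonglongrightarrow> A ?l ?c" "\<bar>X ?l ?c / A ?l ?c - I\<bar> \<le> e / 3"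
      "(\<lambda>n. L n (\<lambda>z. tent ?l ?c (fst z) * b (snd z)) / L n (\<lambda>z. tent ?l ?c (fst z))) \<longlonglongrightarrow> X ?l ?c / A ?l ?c"
      by auto
    have "I - e < X ?l ?c / A ?l ?c" using m(3) e by linarith
    from order_tendstoD(1)[OF m(4) this] order_tendstoD(1)[OF m(2) m(1)] show ?thesis
    proof eventually_elim
      case (elim n)
      have "L n (\<lambda>z. tent ?l ?c (fst z) * b (snd z)) / L n (\<lambda>z. tent ?l ?c (fst z)) \<le> E n (Suc n)"
        using L_tent_b_le[of ?c n ?l] elim by (simp add: pos_divide_le_eq)
      then show ?case using elim by linarith
    qed
  qed
  have upper: "eventually (\<lambda>n. E n (Suc n) < I + e) sequentially"
  proof -
    from main[of ?c ?r] \<eta> have m: "0 < A ?c ?r" "(\<lambda>n. L n (\<lambda>z. tent ?c ?r (fst z))) \<longlonglongrightarrow> A ?c ?r" "\<bar>X ?c ?r / A ?c ?r - I\<bar> \<le> e / 3"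
      "(\<lambda>n. L n (\<lambda>z. tent ?c ?r (fst z) * b (snd z)) / L n (\<lambda>z. tent ?c ?r (fst z))) \<longlonglongrightarrow> X ?c ?r / A ?c ?r"
      by auto
    have "X ?c ?r / A ?c ?r < I + e" using m(3) e by linarith
    from order_tendstoD(2)[OF m(4) this] order_tendstoD(1)[OF m(2) m(1)] show ?thesis
    proof eventually_elim
      case (elim n)
      have "E n (Suc n) \<le> L n (\<lambda>z. tent ?c ?r (fst z) * b (snd z)) / L n (\<lambda>z. tent ?c ?r (fst z))"
        using L_tent_b_ge[of ?c n ?r] elim by (simp add: pos_le_divide_eq)
      then show ?case using elim by linarith
    qed
  qed
  from lower upper show "eventually (\<lambda>n. dist (\<integral>x. \<beta> (real (Z (Suc n) x) / real (Suc n)) \<partial>N) (\<integral>y. \<beta> y \<partial>\<kappa>) < e) sequentially"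
    by eventually_elim (auto simp: dist_real_def E_def I_def simp del: of_nat_Suc)
qed

end

end

section \<open>The arcsine law\<close>

text \<open>The Beta density with parameters \<alpha> and 1 - \<alpha>; the reflection formula
  supplies the normalising constant.\<close>

definition arcsine_density :: "real \<Rightarrow> real \<Rightarrow> real" where
  "arcsine_density \<alpha> y = sin (pi * \<alpha>) / pi * (y powr (\<alpha> - 1) * (1 - y) powr (- \<alpha>))"

text \<open>The degenerate values are the weak limits at the ends of the parameter range, and they
  obey the same formula for the Stieltjes transform.\<close>

definition arcsine_law :: "real \<Rightarrow> real measure" where
  "arcsine_law \<alpha> =
     (if \<alpha> = 0 then return borel 0
      else if \<alpha> = 1 then return borel 1
      else density lborel (\<lambda>y. ennreal (arcsine_density \<alpha> y) * indicator {0<..<1} y))"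

text \<open>Nonnegativity and \<open>fin\<close> give absolute integrability, under which the change
  of variables holds. The absolute value of the derivative admits decreasing maps, which the limit
  law of the spent time process requires.\<close>

lemma nn_integral_substitution_unit:
  fixes f g g' :: "real \<Rightarrow> real"
  assumes f [measurable]: "f \<in> borel_measurable borel" and nn: "\<And>y. 0 < y \<Longrightarrow> y < 1 \<Longrightarrow> 0 \<le> f y"
    and fin: "(\<integral>\<^sup>+y. ennreal (f y) * indicator {0<..<1} y \<partial>lborel) < \<infinity>"
    and deriv: "\<And>x. 0 < x \<Longrightarrow> x < 1 \<Longrightarrow> (g has_real_derivative g' x) (at x)"
    and bij: "bij_betw g {0<..<1} {0<..<1}"
  shows "(\<integral>\<^sup>+x. ennreal (\<bar>g' x\<bar> * f (g x)) * indicator {0<..<1} x \<partial>lborel)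
    = (\<integral>\<^sup>+y. ennreal (f y) * indicator {0<..<1} y \<partial>lborel)"
proof -
  define F where "F y = f y * indicator {0<..<1} y" for y
  have F: "ennreal (F y) = ennreal (f y) * indicator {0<..<1} y" for y
    by (auto simp: F_def indicator_def)
  have "F integrable_on UNIV"
  proof (rule nn_integral_integrable_on)
    show "F \<in> borel_measurable borel" unfolding F_def[abs_def] by measurable
    show "0 \<le> F x" for x by (simp add: F_def indicator_def nn)
    show "(\<integral>\<^sup>+x. ennreal (F x) \<partial>lborel) < \<infinity>" using fin by (simp only: F)
  qed
  then have "(\<lambda>y. if y \<in> {0<..<1} then f y else 0) integrable_on UNIV"
    by (rule integrable_eq) (auto simp: F_def)
  then have int: "f integrable_on {0<..<1}" by (simp only: integrable_restrict_UNIV)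
  then have ai: "f absolutely_integrable_on {0<..<1}" using nn by (intro nonnegative_absolutely_integrable_1) auto
  define b where "b = integral {0<..<1} f"
  have fb: "(f has_integral b) {0<..<1}" using int by (simp add: b_def has_integral_iff)
  have img: "g ` {0<..<1} = {0<..<1}" and inj: "inj_on g {0<..<1}"
    using bij by (auto simp: bij_betw_def)
  have "(\<lambda>x. \<bar>g' x\<bar> * f (g x)) absolutely_integrable_on {0<..<1} \<and>
      integral {0<..<1} (\<lambda>x. \<bar>g' x\<bar> * f (g x)) = b"
    using has_absolute_integral_change_of_variables_1'[of "{0<..<1}" g g' f b] ai inj deriv
    by (auto simp: img b_def intro: has_field_derivative_at_within)
  then have gb: "((\<lambda>x. \<bar>g' x\<bar> * f (g x)) has_integral b) {0<..<1}"
    by (auto simp: has_integral_iff set_lebesgue_integral_eq_integral(1))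
  have "0 \<le> f (g x)" if "x \<in> {0<..<1}" for x
    using nn[of "g x"] img that by (metis greaterThanLessThan_iff imageI)
  then have "(\<integral>\<^sup>+x. ennreal (\<bar>g' x\<bar> * f (g x)) * indicator {0<..<1} x \<partial>lborel) = ennreal b"
    by (intro nn_integral_has_integral_lebesgue'[OF _ gb]) auto
  moreover have "(\<integral>\<^sup>+y. ennreal (f y) * indicator {0<..<1} y \<partial>lborel) = ennreal b"
    using nn by (intro nn_integral_has_integral_lebesgue'[OF _ fb]) auto
  ultimately show ?thesis by simp
qed

lemma arcsine_density_measurable [measurable]: "arcsine_density \<alpha> \<in> borel_measurable borel"
  unfolding arcsine_density_def by measurable

lemma arcsine_density_nonneg: "0 < \<alpha> \<Longrightarrow> \<alpha> < 1 \<Longrightarrow> 0 \<le> arcsine_density \<alpha> y"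
  unfolding arcsine_density_def
  by (intro mult_nonneg_nonneg divide_nonneg_pos sin_ge_zero) (auto simp: mult_le_cancel_left1)

lemma Beta_reflection_real:
  fixes \<alpha> :: real
  assumes "0 < \<alpha>" "\<alpha> < 1"
  shows "Beta \<alpha> (1 - \<alpha>) = pi / sin (pi * \<alpha>)"
proof -
  have "complex_of_real (Gamma \<alpha> * Gamma (1 - \<alpha>)) = of_real (pi / sin (pi * \<alpha>))"
    using Gamma_reflection_complex[of "of_real \<alpha>"]
    by (simp only: of_real_mult of_real_divide of_real_diff of_real_1 Gamma_complex_of_real[symmetric] sin_of_real[symmetric])
  then have "Gamma \<alpha> * Gamma (1 - \<alpha>) = pi / sin (pi * \<alpha>)" by (simp only: of_real_eq_iff)
  then show ?thesis by (simp add: Beta_def)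
qed

lemma nn_integral_arcsine_density:
  assumes "0 < \<alpha>" "\<alpha> < 1"
  shows "(\<integral>\<^sup>+y. ennreal (arcsine_density \<alpha> y) * indicator {0<..<1} y \<partial>lborel) = 1"
proof -
  have s: "0 < sin (pi * \<alpha>)" using assms by (intro sin_gt_zero) auto
  have "((\<lambda>y. y powr (\<alpha> - 1) * (1 - y) powr (- \<alpha>)) has_integral pi / sin (pi * \<alpha>)) {0<..<1}"
    using has_integral_Beta_real[of \<alpha> "1 - \<alpha>"] assms
    by (simp add: Beta_reflection_real has_integral_Icc_iff_Ioo)
  then have "(arcsine_density \<alpha> has_integral sin (pi * \<alpha>) / pi * (pi / sin (pi * \<alpha>))) {0<..<1}"
    unfolding arcsine_density_def[abs_def] by (rule has_integral_mult_right)
  then have "(arcsine_density \<alpha> has_integral 1) {0<..<1}" using s by simp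
  then show ?thesis
    using nn_integral_has_integral_lebesgue'[of "{0<..<1}" "arcsine_density \<alpha>" 1] arcsine_density_nonneg[OF assms]
    by simp
qed

lemma real_distribution_arcsine:
  assumes "0 \<le> \<alpha>" "\<alpha> \<le> 1"
  shows "real_distribution (arcsine_law \<alpha>)"
proof -
  have "prob_space (arcsine_law \<alpha>)"
  proof (cases "\<alpha> = 0 \<or> \<alpha> = 1")
    case True
    then show ?thesis by (auto simp: arcsine_law_def intro!: prob_space_return)
  next
    case False
    then show ?thesis using assms nn_integral_arcsine_density[of \<alpha>]
      by (intro prob_spaceI) (simp add: arcsine_law_def emeasure_density)
  qed
  then show ?thesis
    by (auto simp: real_distribution_def real_distribution_axioms_def arcsine_law_def)
qed

lemma AE_arcsine_law: "AE y in arcsine_law \<alpha>. 0 \<le> y \<and> y \<le> 1"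
proof -
  have "AE y in density lborel (\<lambda>y. ennreal (arcsine_density \<alpha> y) * indicator {0<..<1} y). 0 \<le> y \<and> y \<le> 1"
    by (subst AE_density) (auto simp: indicator_def)
  moreover have "AE y in return borel c. 0 \<le> y \<and> y \<le> 1" if "0 \<le> c" "c \<le> 1" for c :: real
    using that by (subst AE_return) auto
  ultimately show ?thesis unfolding arcsine_law_def by (simp del: AE_conj_iff)
qed

text \<open>The Moebius map \<open>g\<close>, which fixes 0 and 1, pulls the arcsine density back to
  itself times \<open>c / (a + b * y)\<close> with
  \<open>c = a powr (1 - \<alpha>) * (a + b) powr \<alpha>\<close>. Comparing total masses gives the
  integral.\<close>

lemma arcsine_stieltjes_transform:
  fixes a b \<alpha> :: real
  assumes \<alpha>: "0 \<le> \<alpha>" "\<alpha> \<le> 1" and a: "0 < a" and b: "0 \<le> b"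
  shows "(\<integral>y. 1 / (a + b * y) \<partial>arcsine_law \<alpha>) = a powr (\<alpha> - 1) * (a + b) powr (- \<alpha>)"
proof (cases "\<alpha> = 0 \<or> \<alpha> = 1")
  case True
  then show ?thesis using a b by (auto simp: arcsine_law_def integral_return powr_minus divide_inverse)
next
  case False
  then have \<alpha>': "0 < \<alpha>" "\<alpha> < 1" using \<alpha> by auto
  define g where "g y = (a + b) * y / (a + b * y)" for y
  define g' where "g' y = a * (a + b) / (a + b * y)^2" for y
  have pos: "0 < a + b * y" if "0 < y" for y using a b that by (simp add: add_pos_nonneg)
  have deriv: "(g has_real_derivative g' x) (at x)" if "0 < x" "x < 1" for x
    unfolding g_def[abs_def] g'_def using pos[OF that(1)]
    by (auto intro!: derivative_eq_intros simp: field_simps power2_eq_square)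
  have g01: "0 < g y" "g y < 1" if "0 < y" "y < 1" for y
  proof -
    show "0 < g y" using that a b pos[of y] by (simp add: g_def)
    have "0 < a * (1 - y)" using that a by simp
    then show "g y < 1" using pos[of y] that by (simp add: g_def algebra_simps)
  qed
  have bij: "bij_betw g {0<..<1} {0<..<1}"
  proof (rule bij_betwI[where g = "\<lambda>z. a * z / (a + b - b * z)"])
    show "(\<lambda>z. a * z / (a + b - b * z)) \<in> {0<..<1} \<rightarrow> {0<..<1}"
    proof
      fix z :: real assume z: "z \<in> {0<..<1}"
      then have "b * z \<le> b" using b by (simp add: mult_left_le)
      then have "0 < a + b - b * z" using a by simp
      moreover have "0 < (a + b) * (1 - z)" using a b z by simp
      ultimately show "a * z / (a + b - b * z) \<in> {0<..<1}" using z a by (auto simp: field_simps)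
    qed
    fix z :: real assume z: "z \<in> {0<..<1}"
    have bz: "b * z \<le> b" using b z by (simp add: mult_left_le)
    then have d: "0 < a + b - b * z" using a by simp
    have "a + b * (a * z / (a + b - b * z)) = a * (a + b) / (a + b - b * z)" using d by (simp add: field_simps)
    then show "g (a * z / (a + b - b * z)) = z"
      unfolding g_def using d a b by simp
    have "a + b - b * g z = a * (a + b) / (a + b * z)" unfolding g_def using pos[of z] z by (simp add: field_simps)
    then show "a * g z / (a + b - b * g z) = z"
      unfolding g_def using pos[of z] z a b by simp
  qed (use g01 in auto)
  have eq: "\<bar>g' y\<bar> * arcsine_density \<alpha> (g y)
      = a powr (1 - \<alpha>) * (a + b) powr \<alpha> * (arcsine_density \<alpha> y * (1 / (a + b * y)))"
    if y: "0 < y" "y < 1" for y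
  proof -
    define s where "s = a + b * y"
    have s: "0 < s" "0 < a + b" using pos[OF y(1)] a b by (auto simp: s_def)
    have g: "g y = (a + b) * y / s" by (simp add: g_def s_def)
    have g1: "1 - g y = a * (1 - y) / s" unfolding g using s by (simp add: s_def field_simps)
    have "\<bar>g' y\<bar> * (g y powr (\<alpha> - 1) * (1 - g y) powr (- \<alpha>))
      = a powr 1 * (a + b) powr 1 * s powr (- 2) * (((a + b) powr (\<alpha> - 1) * y powr (\<alpha> - 1) * s powr (1 - \<alpha>))
        * (a powr (- \<alpha>) * (1 - y) powr (- \<alpha>) * s powr \<alpha>))"
    proof -
      have "\<bar>g' y\<bar> = a powr 1 * (a + b) powr 1 * s powr (- 2)"
        using s a by (simp add: g'_def s_def[symmetric] powr_minus_divide powr_numeral)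
      moreover have "g y powr (\<alpha> - 1) = (a + b) powr (\<alpha> - 1) * y powr (\<alpha> - 1) * s powr (1 - \<alpha>)"
        unfolding g using s y powr_minus_divide[of s "\<alpha> - 1"] by (simp add: powr_divide powr_mult)
      moreover have "(1 - g y) powr (- \<alpha>) = a powr (- \<alpha>) * (1 - y) powr (- \<alpha>) * s powr \<alpha>"
        unfolding g1 using s y a powr_minus_divide[of s "- \<alpha>"] by (simp add: powr_divide powr_mult)
      ultimately show ?thesis by simp
    qed
    also have "\<dots> = (a powr 1 * a powr (- \<alpha>)) * ((a + b) powr 1 * (a + b) powr (\<alpha> - 1))
        * (s powr (- 2) * s powr (1 - \<alpha>) * s powr \<alpha>) * (y powr (\<alpha> - 1) * (1 - y) powr (- \<alpha>))"
      by (simp only: mult_ac)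
    also have "\<dots> = a powr (1 - \<alpha>) * (a + b) powr \<alpha> * s powr (- 1) * (y powr (\<alpha> - 1) * (1 - y) powr (- \<alpha>))"
      by (simp only: powr_add[symmetric]) simp
    finally have "sin (pi * \<alpha>) / pi * (\<bar>g' y\<bar> * (g y powr (\<alpha> - 1) * (1 - g y) powr (- \<alpha>)))
      = sin (pi * \<alpha>) / pi * (a powr (1 - \<alpha>) * (a + b) powr \<alpha> * s powr (- 1) * (y powr (\<alpha> - 1) * (1 - y) powr (- \<alpha>)))"
      by (simp only:)
    moreover have "1 / (a + b * y) = s powr (- 1)" using s by (simp add: s_def powr_minus_divide)
    ultimately show ?thesis unfolding arcsine_density_def by (simp only: mult_ac)
  qed
  have *: "(\<integral>\<^sup>+x. ennreal (\<bar>g' x\<bar> * arcsine_density \<alpha> (g x)) * indicator {0<..<1} x \<partial>lborel) = 1"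
    using nn_integral_substitution_unit[OF arcsine_density_measurable _ _ deriv bij, of \<alpha>]
      nn_integral_arcsine_density[OF \<alpha>'] arcsine_density_nonneg[OF \<alpha>'] by simp
  define c where "c = a powr (1 - \<alpha>) * (a + b) powr \<alpha>"
  have c: "0 < c" using a b by (simp add: c_def)
  have "integral\<^sup>L (arcsine_law \<alpha>) (\<lambda>y. 1 / (a + b * y)) = enn2real (\<integral>\<^sup>+y. ennreal (1 / (a + b * y)) \<partial>arcsine_law \<alpha>)"
    using AE_arcsine_law[of \<alpha>] a b by (intro integral_eq_nn_integral) (auto simp: arcsine_law_def)
  also have "(\<integral>\<^sup>+y. ennreal (1 / (a + b * y)) \<partial>arcsine_law \<alpha>)
     = (\<integral>\<^sup>+y. ennreal (1 / c) * (ennreal (\<bar>g' y\<bar> * arcsine_density \<alpha> (g y)) * indicator {0<..<1} y) \<partial>lborel)"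
  proof -
    have pt: "ennreal (arcsine_density \<alpha> x) * ennreal (1 / (a + b * x))
        = ennreal (1 / c) * ennreal (\<bar>g' x\<bar> * arcsine_density \<alpha> (g x))" if x: "0 < x" "x < 1" for x
    proof -
      have "ennreal (arcsine_density \<alpha> x) * ennreal (1 / (a + b * x)) = ennreal (arcsine_density \<alpha> x * (1 / (a + b * x)))"
        using arcsine_density_nonneg[OF \<alpha>'] pos[OF x(1)] by (subst ennreal_mult) auto
      also have "arcsine_density \<alpha> x * (1 / (a + b * x)) = 1 / c * (\<bar>g' x\<bar> * arcsine_density \<alpha> (g x))"
        using c unfolding eq[OF x] c_def[symmetric] by simp
      also have "ennreal \<dots> = ennreal (1 / c) * ennreal (\<bar>g' x\<bar> * arcsine_density \<alpha> (g x))"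
        using c arcsine_density_nonneg[OF \<alpha>'] by (intro ennreal_mult) auto
      finally show ?thesis .
    qed
    show ?thesis
      using False by (auto simp: arcsine_law_def nn_integral_density indicator_def intro!: nn_integral_cong pt)
  qed
  also have "\<dots> = ennreal (1 / c)"
  proof -
    have [measurable]: "g \<in> borel_measurable borel" "g' \<in> borel_measurable borel"
      unfolding g_def[abs_def] g'_def[abs_def] by measurable
    show ?thesis using * by (subst nn_integral_cmult) auto
  qed
  also have "enn2real \<dots> = 1 / c" using c by simp
  finally show ?thesis using a b
    by (simp add: c_def powr_minus_divide powr_diff divide_simps)
qed

section \<open>Images of the arcsine law under the limit maps\<close>

lemma distr_arcsine_density:
  fixes g g' h D :: "real \<Rightarrow> real"
  assumes \<alpha>: "0 < \<alpha>" "\<alpha> < 1"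
    and deriv: "\<And>x. 0 < x \<Longrightarrow> x < 1 \<Longrightarrow> (g has_real_derivative g' x) (at x)"
    and g: "\<And>x. 0 < x \<Longrightarrow> x < 1 \<Longrightarrow> 0 < g x \<and> g x < 1 \<and> h (g x) = x"
    and h: "\<And>y. 0 < y \<Longrightarrow> y < 1 \<Longrightarrow> 0 < h y \<and> h y < 1 \<and> g (h y) = y"
    and [measurable]: "h \<in> borel_measurable borel" "D \<in> borel_measurable borel"
    and D: "\<And>x. 0 < x \<Longrightarrow> x < 1 \<Longrightarrow> D x = \<bar>g' x\<bar> * arcsine_density \<alpha> (g x)"
  shows "distr (arcsine_law \<alpha>) borel h = density lborel (\<lambda>x. ennreal (D x) * indicator {0<..<1} x)"
proof (rule measure_eqI)
  fix B assume "B \<in> sets (distr (arcsine_law \<alpha>) borel h)"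
  then have B [measurable]: "B \<in> sets borel" by simp
  have bij: "bij_betw g {0<..<1} {0<..<1}"
    by (rule bij_betwI[where g = h]) (use g h in auto)
  \<comment> \<open>The factor \<open>indicator B (h y)\<close> becomes \<open>indicator B x\<close>
    under the substitution \<open>y = g x\<close>.\<close>
  let ?f = "\<lambda>y. arcsine_density \<alpha> y * indicator B (h y)"
  have le: "(\<integral>\<^sup>+y. ennreal (?f y) * indicator {0<..<1} y \<partial>lborel)
      \<le> (\<integral>\<^sup>+y. ennreal (arcsine_density \<alpha> y) * indicator {0<..<1} y \<partial>lborel)"
    by (intro nn_integral_mono) (auto simp: indicator_def)
  also have "\<dots> < \<infinity>" using nn_integral_arcsine_density[OF \<alpha>] by simp
  finally have fin: "(\<integral>\<^sup>+y. ennreal (?f y) * indicator {0<..<1} y \<partial>lborel) < \<infinity>" .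
  have "emeasure (distr (arcsine_law \<alpha>) borel h) B = (\<integral>\<^sup>+y. ennreal (?f y) * indicator {0<..<1} y \<partial>lborel)"
  proof -
    have "h -` B \<in> sets borel" using measurable_sets[of h borel borel B] by simp
    then show ?thesis
      using \<alpha> by (subst emeasure_distr) (auto simp: arcsine_law_def emeasure_density intro!: nn_integral_cong split: split_indicator)
  qed
  also have "\<dots> = (\<integral>\<^sup>+x. ennreal (\<bar>g' x\<bar> * ?f (g x)) * indicator {0<..<1} x \<partial>lborel)"
    using arcsine_density_nonneg[OF \<alpha>] by (intro nn_integral_substitution_unit[OF _ _ fin deriv bij, symmetric]) auto
  also have "\<dots> = emeasure (density lborel (\<lambda>x. ennreal (D x) * indicator {0<..<1} x)) B"
    using g by (simp add: emeasure_density) (auto intro!: nn_integral_cong simp: D split: split_indicator)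
  finally show "emeasure (distr (arcsine_law \<alpha>) borel h) B
    = emeasure (density lborel (\<lambda>x. ennreal (D x) * indicator {0<..<1} x)) B" .
qed simp

text \<open>Regular variation of W with exponent 1 - \<alpha> sends a last visit at the fraction y
  of the time to the value y powr (1 - \<alpha>). At \<alpha> = 0 and \<alpha> = 1 point masses go
  to point masses.\<close>

lemma X_law_eq_distr:
  assumes "0 \<le> \<alpha>" "\<alpha> \<le> 1"
  shows "X_law \<alpha> = distr (arcsine_law \<alpha>) borel (\<lambda>y. y powr (1 - \<alpha>))"
proof (cases "\<alpha> = 0 \<or> \<alpha> = 1")
  case True
  then show ?thesis by (auto simp: X_law_def arcsine_law_def distr_return)
next
  case False
  then have \<alpha>: "0 < \<alpha>" "\<alpha> < 1" using assms by auto
  have "distr (arcsine_law \<alpha>) borel (\<lambda>y. y powr (1 - \<alpha>))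
      = density lborel (\<lambda>x. ennreal (X_density \<alpha> x) * indicator {0<..<1} x)"
  proof (rule distr_arcsine_density[OF \<alpha>, where g = "\<lambda>x. x powr (1 / (1 - \<alpha>))"
        and g' = "\<lambda>x. 1 / (1 - \<alpha>) * x powr (1 / (1 - \<alpha>) - 1)"])
    fix x :: real assume x: "0 < x" "x < 1"
    show "((\<lambda>x. x powr (1 / (1 - \<alpha>))) has_real_derivative 1 / (1 - \<alpha>) * x powr (1 / (1 - \<alpha>) - 1)) (at x)"
      using has_real_derivative_powr[OF x(1), of "1 / (1 - \<alpha>)"] by simp
    show "0 < x powr (1 / (1 - \<alpha>)) \<and> x powr (1 / (1 - \<alpha>)) < 1 \<and> (x powr (1 / (1 - \<alpha>))) powr (1 - \<alpha>) = x"
      using x \<alpha> by (auto simp: powr_powr powr01_less_one)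
    show "0 < x powr (1 - \<alpha>) \<and> x powr (1 - \<alpha>) < 1 \<and> (x powr (1 - \<alpha>)) powr (1 / (1 - \<alpha>)) = x"
      using x \<alpha> by (auto simp: powr_powr powr01_less_one)
    have "1 / \<beta> - 1 + (1 / \<beta>) * - \<beta> = - ((1 - 2 * (1 - \<beta>)) / \<beta>)" if "\<beta> \<noteq> 0" for \<beta> :: real
      using that by (simp add: field_simps)
    from this[of "1 - \<alpha>"] have e: "1 / (1 - \<alpha>) - 1 + (1 / (1 - \<alpha>)) * (\<alpha> - 1) = - ((1 - 2 * \<alpha>) / (1 - \<alpha>))"
      using \<alpha> by simp
    have "x powr (1 / (1 - \<alpha>) - 1) * (x powr (1 / (1 - \<alpha>))) powr (\<alpha> - 1) = x powr (- ((1 - 2 * \<alpha>) / (1 - \<alpha>)))"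
      by (simp only: powr_powr powr_add[symmetric] e)
    then have "x powr (1 / (1 - \<alpha>) - 1) * (x powr (1 / (1 - \<alpha>))) powr (\<alpha> - 1) = 1 / x powr ((1 - 2 * \<alpha>) / (1 - \<alpha>))"
      by (simp only: powr_minus_divide)
    then have "1 / (1 - \<alpha>) * (sin (pi * \<alpha>) / pi) * (1 / x powr ((1 - 2 * \<alpha>) / (1 - \<alpha>))) * (1 - x powr (1 / (1 - \<alpha>))) powr - \<alpha>
      = 1 / (1 - \<alpha>) * (sin (pi * \<alpha>) / pi) * (x powr (1 / (1 - \<alpha>) - 1) * (x powr (1 / (1 - \<alpha>))) powr (\<alpha> - 1))
        * (1 - x powr (1 / (1 - \<alpha>))) powr - \<alpha>"
      by (simp only:)
    also have "\<dots> = (1 / (1 - \<alpha>) * x powr (1 / (1 - \<alpha>) - 1)) * arcsine_density \<alpha> (x powr (1 / (1 - \<alpha>)))"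
      unfolding arcsine_density_def by (simp only: mult_ac)
    finally have "1 / (1 - \<alpha>) * (sin (pi * \<alpha>) / pi) * (1 / x powr ((1 - 2 * \<alpha>) / (1 - \<alpha>))) * (1 - x powr (1 / (1 - \<alpha>))) powr - \<alpha>
      = (1 / (1 - \<alpha>) * x powr (1 / (1 - \<alpha>) - 1)) * arcsine_density \<alpha> (x powr (1 / (1 - \<alpha>)))" .
    then show "X_density \<alpha> x = \<bar>1 / (1 - \<alpha>) * x powr (1 / (1 - \<alpha>) - 1)\<bar> * arcsine_density \<alpha> (x powr (1 / (1 - \<alpha>)))"
      using \<alpha> by (simp add: X_density_def powr_minus_divide abs_mult)
  qed (auto simp: X_density_def[abs_def])
  then show ?thesis using False by (simp add: X_law_def)
qed

text \<open>The spent time is the fraction 1 - y. Here the power of x from the derivative cancels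
  the one from the arcsine density, which is why the density has a single x-dependent
  factor.\<close>

lemma Y_law_eq_distr:
  assumes "0 \<le> \<alpha>" "\<alpha> < 1"
  shows "Y_law \<alpha> = distr (arcsine_law \<alpha>) borel (\<lambda>y. (1 - y) powr (1 - \<alpha>))"
proof (cases "\<alpha> = 0")
  case True
  then show ?thesis by (auto simp: Y_law_def arcsine_law_def distr_return)
next
  case False
  then have \<alpha>: "0 < \<alpha>" "\<alpha> < 1" using assms by auto
  have "distr (arcsine_law \<alpha>) borel (\<lambda>y. (1 - y) powr (1 - \<alpha>))
      = density lborel (\<lambda>x. ennreal (Y_density \<alpha> x) * indicator {0<..<1} x)"
  proof (rule distr_arcsine_density[OF \<alpha>, where g = "\<lambda>x. 1 - x powr (1 / (1 - \<alpha>))"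
        and g' = "\<lambda>x. - (1 / (1 - \<alpha>) * x powr (1 / (1 - \<alpha>) - 1))"])
    fix x :: real assume x: "0 < x" "x < 1"
    show "((\<lambda>x. 1 - x powr (1 / (1 - \<alpha>))) has_real_derivative - (1 / (1 - \<alpha>) * x powr (1 / (1 - \<alpha>) - 1))) (at x)"
      using DERIV_diff[OF DERIV_const has_real_derivative_powr[OF x(1), of "1 / (1 - \<alpha>)"]] by simp
    show "0 < 1 - x powr (1 / (1 - \<alpha>)) \<and> 1 - x powr (1 / (1 - \<alpha>)) < 1 \<and> (1 - (1 - x powr (1 / (1 - \<alpha>)))) powr (1 - \<alpha>) = x"
      using x \<alpha> by (auto simp: powr_powr powr01_less_one)
    show "0 < (1 - x) powr (1 - \<alpha>) \<and> (1 - x) powr (1 - \<alpha>) < 1 \<and> 1 - ((1 - x) powr (1 - \<alpha>)) powr (1 / (1 - \<alpha>)) = x"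
      using x \<alpha> by (auto simp: powr_powr powr01_less_one)
    have e: "1 / (1 - \<alpha>) - 1 + (1 / (1 - \<alpha>)) * (- \<alpha>) = 0"
      using \<alpha> by (simp add: field_simps)
    have "x powr (1 / (1 - \<alpha>) - 1) * (x powr (1 / (1 - \<alpha>))) powr (- \<alpha>) = 1"
      using x by (simp only: powr_powr powr_add[symmetric] e) simp
    then have "1 / (1 - \<alpha>) * (sin (pi * \<alpha>) / pi) * (1 - x powr (1 / (1 - \<alpha>))) powr (\<alpha> - 1) * 1
      = 1 / (1 - \<alpha>) * (sin (pi * \<alpha>) / pi) * (1 - x powr (1 / (1 - \<alpha>))) powr (\<alpha> - 1)
        * (x powr (1 / (1 - \<alpha>) - 1) * (x powr (1 / (1 - \<alpha>))) powr (- \<alpha>))"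
      by (simp only:)
    also have "\<dots> = (1 / (1 - \<alpha>) * x powr (1 / (1 - \<alpha>) - 1)) * arcsine_density \<alpha> (1 - x powr (1 / (1 - \<alpha>)))"
    proof -
      have "1 - (1 - z) = z" for z :: real by simp
      then show ?thesis unfolding arcsine_density_def by (simp only: mult_ac)
    qed
    finally have "1 / (1 - \<alpha>) * (sin (pi * \<alpha>) / pi) * (1 - x powr (1 / (1 - \<alpha>))) powr (\<alpha> - 1) * 1
      = (1 / (1 - \<alpha>) * x powr (1 / (1 - \<alpha>) - 1)) * arcsine_density \<alpha> (1 - x powr (1 / (1 - \<alpha>)))" .
    moreover have "(1 - x powr (1 / (1 - \<alpha>))) powr (\<alpha> - 1) = 1 / (1 - x powr (1 / (1 - \<alpha>))) powr (1 - \<alpha>)"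
      using powr_minus_divide[of "1 - x powr (1 / (1 - \<alpha>))" "1 - \<alpha>"] by simp
    ultimately show "Y_density \<alpha> x = \<bar>- (1 / (1 - \<alpha>) * x powr (1 / (1 - \<alpha>) - 1))\<bar> * arcsine_density \<alpha> (1 - x powr (1 / (1 - \<alpha>)))"
      using \<alpha> by (simp add: Y_density_def abs_mult)
  qed (auto simp: Y_density_def[abs_def])
  then show ?thesis using False by (simp add: Y_law_def)
qed

section \<open>Independence of the initial law\<close>

text \<open>Tychonoff's theorem gives a cluster point of the image filter in a product of intervals;
  pulling its neighbourhoods back produces a finer filter on the index set along which all
  coordinates converge together.\<close>

lemma bounded_family_cluster:
  fixes X :: "nat \<Rightarrow> 'i \<Rightarrow> real"
  assumes X: "\<And>n i. \<bar>X n i\<bar> \<le> C i" and F: "F \<noteq> bot"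
  obtains G Y where "G \<noteq> bot" "G \<le> F" "\<And>i. ((\<lambda>n. X n i) \<longlongrightarrow> Y i) G"
proof -
  let ?K = "PiE UNIV (\<lambda>i. {- C i..C i})"
  have "compactin (product_topology (\<lambda>i. euclidean) UNIV) ?K" by (simp add: compactin_PiE)
  then have "compact ?K" by (simp add: euclidean_product_topology)
  moreover have "filtermap X F \<noteq> bot" using F by (simp add: filtermap_bot_iff)
  moreover have "eventually (\<lambda>x. x \<in> ?K) (filtermap X F)"
    unfolding eventually_filtermap using X by (intro always_eventually) (auto simp: abs_le_iff minus_le_iff)
  ultimately obtain Y where Y: "inf (nhds Y) (filtermap X F) \<noteq> bot"
    unfolding compact_filter by blast
  define G where "G = inf (filtercomap X (nhds Y)) F"
  have "G \<noteq> bot"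
  proof
    assume "G = bot"
    then have "eventually (\<lambda>_. False) G" by simp
    then obtain Q R where QR: "eventually Q (filtercomap X (nhds Y))" "eventually R F" "\<And>n. Q n \<Longrightarrow> R n \<Longrightarrow> False"
      unfolding G_def eventually_inf by blast
    obtain Q' where Q': "eventually Q' (nhds Y)" "\<And>n. Q' (X n) \<Longrightarrow> Q n"
      using QR(1) unfolding eventually_filtercomap by blast
    have "eventually (\<lambda>z. \<exists>n. z = X n \<and> R n) (filtermap X F)"
      unfolding eventually_filtermap using QR(2) by eventually_elim auto
    with Q'(1) have "eventually (\<lambda>_. False) (inf (nhds Y) (filtermap X F))"
      unfolding eventually_inf using Q'(2) QR(3) by blast
    then show False using Y by (simp add: trivial_limit_def)
  qed
  moreover have "G \<le> F" by (simp add: G_def)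
  moreover have "((\<lambda>n. X n i) \<longlongrightarrow> Y i) G" for i
  proof -
    have "filterlim X (nhds Y) G"
      unfolding G_def by (rule filterlim_mono[OF filterlim_filtercomap order_refl]) simp
    then show ?thesis
      using continuous_on_tendsto_compose[OF continuous_on_product_coordinates, of X Y G i] by simp
  qed
  ultimately show ?thesis by (rule that)
qed

text \<open>Banach-Alaoglu for \<open>L\<^sub>1\<close> by way of Tychonoff's theorem; the cluster point is taken along a filter because
  \<open>L\<^sub>1\<close> need not be separable.\<close>

lemma (in finite_measure) weak_star_cluster:
  fixes h :: "nat \<Rightarrow> 'a \<Rightarrow> real"
  assumes h [measurable]: "\<And>n. h n \<in> borel_measurable M"
    and h01: "\<And>n x. x \<in> space M \<Longrightarrow> 0 \<le> h n x \<and> h n x \<le> 1" and F: "F \<noteq> bot"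
  obtains G H where "G \<noteq> bot" "G \<le> F" "H \<in> borel_measurable M" "\<And>x. 0 \<le> H x" "\<And>x. H x \<le> 1"
    "\<And>u. integrable M u \<Longrightarrow> ((\<lambda>n. \<integral>x. u x * h n x \<partial>M) \<longlongrightarrow> (\<integral>x. u x * H x \<partial>M)) G"
proof -
  \<comment> \<open>The coordinates are indexed by all functions, with value 0 at those that are not
    integrable, so that one full product is compactified.\<close>
  define X where "X n u = (if integrable M u then \<integral>x. u x * h n x \<partial>M else 0)" for n u
  have uh: "integrable M (\<lambda>x. u x * h n x)" if "integrable M u" for u n
  proof (rule Bochner_Integration.integrable_bound[OF that])
    show "AE x in M. norm (u x * h n x) \<le> norm (u x)"
      using h01 by (intro AE_I2) (simp add: abs_mult mult_left_le)
  qed (use that in auto)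
  have Xle: "\<bar>X n u\<bar> \<le> (\<integral>x. \<bar>u x\<bar> \<partial>M)" for n u
  proof (cases "integrable M u")
    case True
    have "\<bar>X n u\<bar> \<le> (\<integral>x. \<bar>u x * h n x\<bar> \<partial>M)" using True by (simp add: X_def integral_abs_bound)
    also have "\<dots> \<le> (\<integral>x. \<bar>u x\<bar> \<partial>M)"
      using True uh[OF True] h01 by (intro integral_mono integrable_abs) (auto simp: abs_mult mult_left_le)
    finally show ?thesis .
  qed (simp add: X_def)
  from bounded_family_cluster[of X, OF Xle F] obtain G \<Lambda> where G: "G \<noteq> bot" "G \<le> F"
    and lim: "\<And>u. ((\<lambda>n. X n u) \<longlongrightarrow> \<Lambda> u) G" by blast
  have lim': "((\<lambda>n. \<integral>x. u x * h n x \<partial>M) \<longlongrightarrow> \<Lambda> u) G" if "integrable M u" for u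
    using lim[of u] that by (simp add: X_def)
  note uniq = tendsto_unique[OF G(1)]
  have \<Lambda>_le: "\<bar>\<Lambda> u\<bar> \<le> (\<integral>x. \<bar>u x\<bar> \<partial>M)" for u
    using Xle by (intro tendsto_upperbound[OF tendsto_rabs[OF lim[of u]] _ G(1)]) auto
  have \<Lambda>_nonneg: "0 \<le> \<Lambda> u" if "integrable M u" "\<And>x. x \<in> space M \<Longrightarrow> 0 \<le> u x" for u
    using that h01 by (intro tendsto_lowerbound[OF lim'[OF that(1)] _ G(1)] always_eventually allI integral_nonneg) auto
  have \<Lambda>_add: "\<Lambda> (\<lambda>x. u x + w x) = \<Lambda> u + \<Lambda> w" if "integrable M u" "integrable M w" for u w
  proof (rule uniq[OF lim'])
    show "integrable M (\<lambda>x. u x + w x)" using that by simp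
    have "(\<integral>x. (u x + w x) * h n x \<partial>M) = (\<integral>x. u x * h n x \<partial>M) + (\<integral>x. w x * h n x \<partial>M)" for n
      using uh that by (simp add: distrib_right)
    then show "((\<lambda>n. \<integral>x. (u x + w x) * h n x \<partial>M) \<longlongrightarrow> \<Lambda> u + \<Lambda> w) G"
      using tendsto_add[OF lim'[OF that(1)] lim'[OF that(2)]] by simp
  qed
  have \<Lambda>_scale: "\<Lambda> (\<lambda>x. u x * c) = \<Lambda> u * c" if "integrable M u" for u c
  proof (rule uniq[OF lim'])
    show "integrable M (\<lambda>x. u x * c)" using that by simp
    have "(\<integral>x. (u x * c) * h n x \<partial>M) = (\<integral>x. u x * h n x \<partial>M) * c" for n
      by (subst integral_mult_left_zero[symmetric]) (simp add: mult_ac)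
    then show "((\<lambda>n. \<integral>x. (u x * c) * h n x \<partial>M) \<longlongrightarrow> \<Lambda> u * c) G"
      using tendsto_mult_right[OF lim'[OF that]] by simp
  qed
  have \<Lambda>_diff: "\<bar>\<Lambda> u - \<Lambda> w\<bar> \<le> (\<integral>x. \<bar>u x - w x\<bar> \<partial>M)" if "integrable M u" "integrable M w" for u w
    using \<Lambda>_add[of "\<lambda>x. u x - w x" w] \<Lambda>_le[of "\<lambda>x. u x - w x"] that by simp
  have \<Lambda>_0: "\<Lambda> (\<lambda>x. 0) = 0" using \<Lambda>_le[of "\<lambda>x. 0"] by simp
  have empty: "(indicator {} :: 'a \<Rightarrow> real) = (\<lambda>x. 0)" by (simp add: fun_eq_iff)
  have ind: "integrable M (indicator B :: 'a \<Rightarrow> real)" if "B \<in> sets M" for B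
    using that by (simp add: emeasure_eq_measure)
  \<comment> \<open>The limit functional on indicators becomes a measure: its continuity in the L1
    norm turns finite into countable additivity, and Radon-Nikodym then represents it by a
    density.\<close>
  define m where "m B = ennreal (\<Lambda> (indicator B))" for B
  have ca: "countably_additive (sets M) m"
  proof (rule countably_additiveI)
    fix B :: "nat \<Rightarrow> 'a set" assume B: "range B \<subseteq> sets M" "disjoint_family B" "(\<Union>i. B i) \<in> sets M"
    have Bi: "B i \<in> sets M" for i using B(1) by auto
    have part: "\<Lambda> (indicator (\<Union>i<n. B i)) = (\<Sum>i<n. \<Lambda> (indicator (B i)))" for n
    proof (induction n)
      case 0
      show ?case using \<Lambda>_0 by simp
    next
      case (Suc n)
      have "B i \<inter> B n = {}" if "i < n" for i using that by (intro disjoint_family_onD[OF B(2)]) auto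
      then have dis: "(\<Union>i<n. B i) \<inter> B n = {}" by blast
      have "(indicator (\<Union>i<Suc n. B i) :: 'a \<Rightarrow> real) = (\<lambda>x. indicator (\<Union>i<n. B i) x + indicator (B n) x)"
        using dis by (auto simp: fun_eq_iff indicator_def less_Suc_eq)
      then show ?case using Suc \<Lambda>_add[OF ind ind, of "\<Union>i<n. B i" "B n"] Bi by auto
    qed
    have "(\<lambda>n. measure M (\<Union>i<n. B i)) \<longlonglongrightarrow> measure M (\<Union>n. \<Union>i<n. B i)"
      using Bi by (intro finite_Lim_measure_incseq) (auto simp: incseq_def intro: less_le_trans)
    also have "(\<Union>n. \<Union>i<n. B i) = (\<Union>i. B i)" by auto
    finally have mlim: "(\<lambda>n. measure M (\<Union>i. B i) - measure M (\<Union>i<n. B i)) \<longlonglongrightarrow> 0"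
      using tendsto_diff[OF tendsto_const, of _ _ sequentially "measure M (\<Union>i. B i)"] by fastforce
    have "(\<lambda>n. \<Lambda> (indicator (\<Union>i<n. B i)) - \<Lambda> (indicator (\<Union>i. B i))) \<longlonglongrightarrow> 0"
    proof (rule Lim_null_comparison[OF _ mlim], rule always_eventually, rule allI)
      fix n
      have s: "(\<Union>i<n. B i) \<subseteq> (\<Union>i. B i)" by auto
      have "norm (\<Lambda> (indicator (\<Union>i<n. B i)) - \<Lambda> (indicator (\<Union>i. B i)))
          \<le> (\<integral>x. \<bar>indicator (\<Union>i<n. B i) x - indicator (\<Union>i. B i) x\<bar> \<partial>M)"
        using \<Lambda>_diff[OF ind ind, of "\<Union>i<n. B i" "\<Union>i. B i"] Bi B(3) by auto
      also have "(\<lambda>x. \<bar>indicator (\<Union>i<n. B i) x - indicator (\<Union>i. B i) x\<bar> :: real) = indicator ((\<Union>i. B i) - (\<Union>i<n. B i))"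
        using s by (auto simp: fun_eq_iff indicator_def)
      also have "(\<integral>x. indicator ((\<Union>i. B i) - (\<Union>i<n. B i)) x \<partial>M) = measure M ((\<Union>i. B i) - (\<Union>i<n. B i))"
        using Bi B(3) sets.sets_into_space[OF B(3)] by (simp add: Int_absorb2 sets.Diff Diff_subset_conv le_supI2)
      also have "\<dots> = measure M (\<Union>i. B i) - measure M (\<Union>i<n. B i)"
        using Bi B(3) s by (intro finite_measure_Diff) auto
      finally show "norm (\<Lambda> (indicator (\<Union>i<n. B i)) - \<Lambda> (indicator (\<Union>i. B i)))
          \<le> measure M (\<Union>i. B i) - measure M (\<Union>i<n. B i)" .
    qed
    then have "(\<lambda>i. \<Lambda> (indicator (B i))) sums \<Lambda> (indicator (\<Union>i. B i))"
      unfolding sums_def part by (rule LIM_zero_cancel)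
    then show "(\<Sum>i. m (B i)) = m (\<Union>i. B i)"
      unfolding m_def using \<Lambda>_nonneg ind Bi
      by (intro suminf_ennreal_eq) auto
  qed
  define N where "N = measure_of (space M) (sets M) m"
  have sN: "sets N = sets M" by (simp add: N_def)
  have "positive (sets M) m" using \<Lambda>_0 empty by (simp add: positive_def m_def)
  then have eN: "emeasure N B = ennreal (\<Lambda> (indicator B))" if "B \<in> sets M" for B
    unfolding N_def using emeasure_measure_of_sigma[OF sets.sigma_algebra_axioms _ ca that] by (simp add: m_def)
  have le: "\<Lambda> (indicator B) \<le> measure M B" if "B \<in> sets M" for B
    using \<Lambda>_le[of "indicator B"] that by (simp add: sets.Int_space_eq2 abs_le_iff)
  have fN: "finite_measure N"
    by (rule finite_measureI) (simp add: sets_eq_imp_space_eq[OF sN] eN)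
  have ac: "absolutely_continuous M N"
  proof (unfold absolutely_continuous_def, rule subsetI)
    fix B assume B: "B \<in> null_sets M"
    then have "measure M B = 0" by (simp add: measure_def null_setsD1)
    then have "\<Lambda> (indicator B) \<le> 0" using le[of B] B by auto
    then show "B \<in> null_sets N" using B sN by (auto simp: eN ennreal_neg intro!: null_setsI)
  qed
  obtain D where D [measurable]: "D \<in> borel_measurable M" and RN: "AE x in M. RN_deriv M N x = ennreal (D x)"
    and D0: "\<And>x. 0 \<le> D x" using real_RN_deriv[OF fN ac sN] by blast
  have "density M D = density M (RN_deriv M N)" using RN by (intro density_cong) auto
  then have dens: "density M D = N" using density_RN_deriv[OF ac sN] by simp
  \<comment> \<open>Truncation gives the bound by 1 everywhere; it changes \<open>D\<close> only on
    a null set, as shown below.\<close>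
  define H where "H x = min 1 (D x)" for x
  have [measurable]: "H \<in> borel_measurable M" unfolding H_def by measurable
  have eD: "(\<integral>\<^sup>+x. ennreal (D x) * indicator B x \<partial>M) = ennreal (\<Lambda> (indicator B))" if [measurable]: "B \<in> sets M" for B
    using that by (simp add: eN[symmetric] dens[symmetric] emeasure_density)
  have "AE x in M. D x \<le> 1"
  proof -
    \<comment> \<open>If \<open>B\<close> had positive measure, the limit measure would give it more
      mass than \<open>M\<close> does, against \<open>le\<close>.\<close>
    define B where "B = {x \<in> space M. 1 < D x}"
    have [measurable]: "B \<in> sets M" unfolding B_def by measurable
    have "(\<integral>\<^sup>+x. ennreal (D x - 1) * indicator B x \<partial>M) + emeasure M B = (\<integral>\<^sup>+x. ennreal (D x - 1) * indicator B x + indicator B x \<partial>M)"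
      by (subst nn_integral_add) auto
    also have "\<dots> = (\<integral>\<^sup>+x. ennreal (D x) * indicator B x \<partial>M)"
    proof (rule nn_integral_cong)
      have "ennreal (D x - 1) + 1 = ennreal (D x)" if "1 < D x" for x
        using ennreal_plus[of "D x - 1" 1] that by simp
      then show "ennreal (D x - 1) * indicator B x + indicator B x = ennreal (D x) * indicator B x" for x
        by (simp add: B_def indicator_def)
    qed
    also have "\<dots> \<le> emeasure M B" using le[of B] by (simp add: eD emeasure_eq_measure)
    finally have "(\<integral>\<^sup>+x. ennreal (D x - 1) * indicator B x \<partial>M) + emeasure M B \<le> 0 + emeasure M B" by simp
    then have "(\<integral>\<^sup>+x. ennreal (D x - 1) * indicator B x \<partial>M) = 0"
      by (simp add: emeasure_eq_measure ennreal_add_left_cancel_le add.commute)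
    then have "AE x in M. ennreal (D x - 1) * indicator B x = 0" by (subst (asm) nn_integral_0_iff_AE) auto
    then show ?thesis using AE_space by eventually_elim (auto simp: B_def indicator_def ennreal_eq_0_iff split: if_splits)
  qed
  then have HD: "AE x in M. H x = D x" by eventually_elim (simp add: H_def)
  have H01: "0 \<le> H x" "H x \<le> 1" for x using D0[of x] by (auto simp: H_def)
  have uH: "integrable M (\<lambda>x. u x * H x)" if "integrable M u" for u
  proof (rule Bochner_Integration.integrable_bound[OF that])
    show "AE x in M. norm (u x * H x) \<le> norm (u x)"
      using H01 by (intro AE_I2) (simp add: abs_mult mult_left_le)
  qed (use that in auto)
  have "\<Lambda> u = (\<integral>x. u x * H x \<partial>M)" if "integrable M u" for u
    using that
  proof (induction u rule: integrable_induct)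
    case (base B c)
    note [measurable] = base(1)
    have "ennreal (\<Lambda> (indicator B)) = (\<integral>\<^sup>+x. ennreal (indicator B x * H x) \<partial>M)"
      unfolding eD[OF base(1), symmetric]
      by (rule nn_integral_cong_AE) (use HD in \<open>eventually_elim, auto simp: indicator_def\<close>)
    also have "\<dots> = ennreal (\<integral>x. indicator B x * H x \<partial>M)"
      using uH[OF ind[OF base(1)]] H01 by (intro nn_integral_eq_integral) auto
    finally have "\<Lambda> (indicator B) = (\<integral>x. indicator B x * H x \<partial>M)"
      using \<Lambda>_nonneg[OF ind[OF base(1)]] H01 by (subst (asm) ennreal_inj) (auto intro!: integral_nonneg)
    moreover have "(\<integral>x. indicator B x * c * H x \<partial>M) = (\<integral>x. indicator B x * H x \<partial>M) * c"
      by (subst integral_mult_left_zero[symmetric]) (simp add: mult_ac)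
    ultimately show ?case using \<Lambda>_scale[OF ind[OF base(1)], of c] by simp
  next
    case (add u w)
    then show ?case using uH[OF add.hyps(1)] uH[OF add.hyps(2)] by (simp add: \<Lambda>_add distrib_right)
  next
    case (lim u s)
    have i0: "(\<lambda>i. \<integral>x. \<bar>s i x - u x\<bar> \<partial>M) \<longlonglongrightarrow> (\<integral>x. 0 \<partial>M)"
    proof (rule integral_dominated_convergence[where w = "\<lambda>x. 3 * \<bar>u x\<bar>"])
      show "AE x in M. (\<lambda>i. \<bar>s i x - u x\<bar>) \<longlonglongrightarrow> 0"
        using lim.hyps(2) by (intro AE_I2 tendsto_rabs_zero LIM_zero)
      show "AE x in M. norm \<bar>s i x - u x\<bar> \<le> 3 * \<bar>u x\<bar>" for i
      proof (rule AE_I2)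
        fix x assume "x \<in> space M"
        then have "\<bar>s i x\<bar> \<le> 2 * \<bar>u x\<bar>" using lim.hyps(3)[of x i] by simp
        then show "norm \<bar>s i x - u x\<bar> \<le> 3 * \<bar>u x\<bar>" by simp
      qed
    qed (use lim.hyps in auto)
    then have i1: "(\<lambda>i. \<integral>x. \<bar>s i x - u x\<bar> \<partial>M) \<longlonglongrightarrow> 0" by simp
    have "(\<lambda>i. \<Lambda> (s i) - \<Lambda> u) \<longlonglongrightarrow> 0"
      by (rule Lim_null_comparison[OF _ i1]) (auto intro!: always_eventually \<Lambda>_diff lim.hyps)
    then have a: "(\<lambda>i. \<Lambda> (s i)) \<longlonglongrightarrow> \<Lambda> u" by (rule LIM_zero_cancel)
    have "norm ((\<integral>x. s i x * H x \<partial>M) - (\<integral>x. u x * H x \<partial>M)) \<le> (\<integral>x. \<bar>s i x - u x\<bar> \<partial>M)" for i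
    proof -
      have "(\<integral>x. s i x * H x \<partial>M) - (\<integral>x. u x * H x \<partial>M) = (\<integral>x. (s i x - u x) * H x \<partial>M)"
        using uH[OF lim.hyps(1)] uH[OF lim.hyps(4)] by (simp add: left_diff_distrib)
      then have "norm ((\<integral>x. s i x * H x \<partial>M) - (\<integral>x. u x * H x \<partial>M)) \<le> (\<integral>x. \<bar>(s i x - u x) * H x\<bar> \<partial>M)"
        by (simp only: real_norm_def integral_abs_bound)
      also have "\<dots> \<le> (\<integral>x. \<bar>s i x - u x\<bar> \<partial>M)"
        using H01 uH[of "\<lambda>x. s i x - u x"] lim.hyps(1,4) by (intro integral_mono integrable_abs) (auto simp: abs_mult mult_left_le)
      finally show ?thesis .
    qed
    then have "(\<lambda>i. (\<integral>x. s i x * H x \<partial>M) - (\<integral>x. u x * H x \<partial>M)) \<longlonglongrightarrow> 0"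
      by (intro Lim_null_comparison[OF _ i1] always_eventually allI)
    then have "(\<lambda>i. \<Lambda> (s i)) \<longlonglongrightarrow> (\<integral>x. u x * H x \<partial>M)" unfolding lim.IH by (rule LIM_zero_cancel)
    then show ?case using a by (rule LIMSEQ_unique[rotated])
  qed
  with lim' have "((\<lambda>n. \<integral>x. u x * h n x \<partial>M) \<longlongrightarrow> (\<integral>x. u x * H x \<partial>M)) G" if "integrable M u" for u
    using that by metis
  then show ?thesis using that[OF G, of H] H01 by auto
qed

section \<open>Iterates and subinvariant sets\<close>

context measure_preserving_system
begin

lemma funpow_measurable [measurable]: "(T ^^ n) \<in> measurable M M"
  by (induction n) (auto simp: measurable_comp[OF _ T_measurable] id_def)

lemma funpow_space: "x \<in> space M \<Longrightarrow> (T ^^ n) x \<in> space M"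
  using measurable_space[OF funpow_measurable] .

lemma AE_T: "AE x in M. P x \<Longrightarrow> AE x in M. P (T x)"
  using AE_distrD[OF T_measurable] T_preserves by metis

lemma AE_funpow: "AE x in M. P x \<Longrightarrow> AE x in M. P ((T ^^ n) x)"
proof (induction n)
  case (Suc n)
  from AE_T[OF Suc.IH[OF Suc.prems]] show ?case by (simp add: funpow_swap1)
qed simp

lemma emeasure_vimage_funpow:
  assumes B: "B \<in> sets M"
  shows "emeasure M ((T ^^ n) -` B \<inter> space M) = emeasure M B"
proof (induction n)
  case 0
  then show ?case using sets.sets_into_space[OF B] by (simp add: Int_absorb2)
next
  case (Suc n)
  have "(T ^^ Suc n) -` B \<inter> space M = T -` ((T ^^ n) -` B \<inter> space M) \<inter> space M"
    using measurable_space[OF T_measurable] by (auto simp: funpow_swap1)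
  moreover have "emeasure (distr M M T) ((T ^^ n) -` B \<inter> space M) = emeasure M (T -` ((T ^^ n) -` B \<inter> space M) \<inter> space M)"
    using B by (intro emeasure_distr T_measurable measurable_sets[OF funpow_measurable])
  ultimately show ?case using Suc by (simp only: T_preserves)
qed

end

context conservative_ergodic_system
begin

text \<open>An orbit that leaves \<open>B\<close> never comes back. Hence the points of
  \<open>B\<close> about to leave form a wandering set \<open>D\<close>, null by conservativity. Up
  to the preimages of \<open>D\<close>, the set \<open>B\<close> equals the strictly invariant set
  \<open>C\<close> of points whose orbit stays in \<open>B\<close>, and ergodicity applies to
  \<open>C\<close>.\<close>

lemma subinvariant_trivial:
  assumes B [measurable]: "B \<in> sets M" and sub: "\<And>x. x \<in> space M \<Longrightarrow> T x \<in> B \<Longrightarrow> x \<in> B"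
  shows "emeasure M B = 0 \<or> emeasure M (space M - B) = 0"
proof -
  have Bs: "B \<subseteq> space M" using B by (rule sets.sets_into_space)
  have orbit: "(T ^^ k) x \<in> B" if "x \<in> space M" "(T ^^ (k + i)) x \<in> B" for x k i
    using that
  proof (induction i)
    case (Suc i)
    then show ?case using sub[OF funpow_space[OF Suc.prems(1), of "k + i"]] by simp
  qed simp
  define D where "D = B - (T -` B \<inter> space M)"
  have [measurable]: "D \<in> sets M" unfolding D_def by measurable
  have "disjoint_family (\<lambda>n::nat. (T ^^ n) -` D \<inter> space M)"
  proof -
    have "False" if nm: "n < m" and x: "x \<in> space M" "(T ^^ n) x \<in> D" "(T ^^ m) x \<in> D" for n m x
    proof -
      obtain i where m: "m = Suc n + i" using nm less_imp_Suc_add[of n m] by auto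
      have "(T ^^ Suc n) x \<in> B" using orbit[OF x(1), of "Suc n" i] x(3) m by (simp add: D_def)
      then show False using x(2) Bs by (auto simp: D_def)
    qed
    then show ?thesis unfolding disjoint_family_on_def by (force simp: neq_iff)
  qed
  then have D0: "emeasure M D = 0" using conservative[OF \<open>D \<in> sets M\<close>] by simp
  define C where "C = {x \<in> space M. \<forall>n. (T ^^ n) x \<in> B}"
  have [measurable]: "C \<in> sets M" unfolding C_def by measurable
  have inv: "T -` C \<inter> space M = C"
  proof (intro equalityI subsetI)
    fix x assume x: "x \<in> T -` C \<inter> space M"
    have "(T ^^ n) x \<in> B" for n
    proof (cases n)
      case 0
      have "(T ^^ 0) (T x) \<in> B" using x unfolding C_def by blast
      then show ?thesis using 0 sub x by auto
    next
      case (Suc m)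
      then show ?thesis using x by (auto simp: C_def funpow_swap1)
    qed
    then show "x \<in> C" using x by (simp add: C_def)
  next
    fix x assume x: "x \<in> C"
    have "(T ^^ n) (T x) \<in> B" for n
      using x unfolding C_def by (metis (no_types, lifting) funpow_simps_right(2) comp_apply mem_Collect_eq)
    then show "x \<in> T -` C \<inter> space M"
      using x measurable_space[OF T_measurable] by (auto simp: C_def)
  qed
  have BC: "B - C \<subseteq> (\<Union>n. (T ^^ n) -` D \<inter> space M)"
  proof
    fix x assume x: "x \<in> B - C"
    then have xs: "x \<in> space M" using Bs by auto
    define n where "n = (LEAST n. (T ^^ n) x \<notin> B)"
    have ex: "\<exists>n. (T ^^ n) x \<notin> B" using x xs by (auto simp: C_def)
    have n: "(T ^^ n) x \<notin> B" unfolding n_def using ex by (rule LeastI_ex)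
    then have "n \<noteq> 0" using x by (metis DiffD1 funpow_0)
    then obtain m where m: "n = Suc m" by (cases n) auto
    have "(T ^^ m) x \<in> B" using not_less_Least[of m "\<lambda>n. (T ^^ n) x \<notin> B"] m unfolding n_def by auto
    then have "(T ^^ m) x \<in> D" using n m by (auto simp: D_def)
    then show "x \<in> (\<Union>n. (T ^^ n) -` D \<inter> space M)" using xs by auto
  qed
  have "emeasure M (\<Union>n. (T ^^ n) -` D \<inter> space M) = 0"
    using D0 by (intro emeasure_UN_eq_0) (auto simp: emeasure_vimage_funpow)
  moreover have "emeasure M (B - C) \<le> emeasure M (\<Union>n. (T ^^ n) -` D \<inter> space M)"
    by (rule emeasure_mono[OF BC]) measurable
  ultimately have BC0: "emeasure M (B - C) = 0" by simp
  from ergodic[OF \<open>C \<in> sets M\<close> inv] show ?thesis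
  proof
    assume "emeasure M C = 0"
    moreover have "emeasure M B \<le> emeasure M ((B - C) \<union> C)" by (intro emeasure_mono) auto
    moreover have "emeasure M ((B - C) \<union> C) \<le> emeasure M (B - C) + emeasure M C" by (intro emeasure_subadditive) auto
    ultimately show ?thesis using BC0 by simp
  next
    assume "emeasure M (space M - C) = 0"
    moreover have "C \<subseteq> B" unfolding C_def by (auto dest: spec[of _ 0])
    then have "emeasure M (space M - B) \<le> emeasure M (space M - C)" by (intro emeasure_mono) auto
    ultimately show ?thesis by simp
  qed
qed

text \<open>Adding all points whose orbit ever meets \<open>B\<close> makes the set subinvariant
  everywhere and changes it only by a null set.\<close>

lemma AE_subinvariant_trivial:
  assumes B [measurable]: "B \<in> sets M" and sub: "AE x in M. T x \<in> B \<longrightarrow> x \<in> B"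
  shows "(AE x in M. x \<notin> B) \<or> (AE x in M. x \<in> B)"
proof -
  define C where "C = {x \<in> space M. \<exists>n. (T ^^ n) x \<in> B}"
  have [measurable]: "C \<in> sets M" unfolding C_def by measurable
  have "(T ^^ Suc n) x \<in> B" if "(T ^^ n) (T x) \<in> B" for n x using that by (simp add: funpow_swap1)
  then have "x \<in> C" if "x \<in> space M" "T x \<in> C" for x using that unfolding C_def by blast
  from subinvariant_trivial[OF \<open>C \<in> sets M\<close> this] have triv: "emeasure M C = 0 \<or> emeasure M (space M - C) = 0" .
  have "AE x in M. (T ^^ n) x \<in> B \<longrightarrow> x \<in> B" for n
  proof (induction n)
    case (Suc n)
    have "AE x in M. T ((T ^^ n) x) \<in> B \<longrightarrow> (T ^^ n) x \<in> B" using AE_funpow[OF sub] .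
    with Suc show ?case by eventually_elim simp
  qed simp
  then have "AE x in M. \<forall>n. (T ^^ n) x \<in> B \<longrightarrow> x \<in> B" by (subst AE_all_countable) blast
  then have CB: "AE x in M. x \<in> C \<longrightarrow> x \<in> B" by eventually_elim (auto simp: C_def)
  have BC: "x \<in> C" if "x \<in> space M" "x \<in> B" for x using that funpow_0[of T x] unfolding C_def by (metis (mono_tags, lifting) mem_Collect_eq)
  from triv show ?thesis
  proof
    assume "emeasure M C = 0"
    then have "AE x in M. x \<notin> C" by (intro AE_not_in) auto
    then have "AE x in M. x \<notin> B" using AE_space by eventually_elim (use BC in auto)
    then show ?thesis ..
  next
    assume "emeasure M (space M - C) = 0"
    then have "AE x in M. x \<notin> space M - C" by (intro AE_not_in) auto
    with CB have "AE x in M. x \<in> B" using AE_space by eventually_elim auto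
    then show ?thesis ..
  qed
qed

text \<open>The set where \<open>H\<close> exceeds its own mean is trivial, so \<open>H\<close> lies
  on one side of its mean almost everywhere, and a function on one side of its mean equals
  it.\<close>

lemma subinvariant_function_const:
  fixes H :: "'a \<Rightarrow> real"
  assumes D: "prob_space D" "sets D = sets M" "absolutely_continuous M D"
    and H: "integrable D H" and sub: "AE x in M. H (T x) \<le> H x"
  shows "AE x in D. H x = integral\<^sup>L D H"
proof -
  interpret D: prob_space D by fact
  have sp: "space D = space M" using D(2) by (rule sets_eq_imp_space_eq)
  have [measurable]: "H \<in> borel_measurable M" using H D(2) measurable_cong_sets[OF D(2) refl] by auto
  define c where "c = integral\<^sup>L D H"
  define B where "B = {x \<in> space M. c < H x}"
  have [measurable]: "B \<in> sets M" unfolding B_def by measurable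
  have "AE x in M. T x \<in> B \<longrightarrow> x \<in> B" using sub AE_space by eventually_elim (auto simp: B_def)
  from AE_subinvariant_trivial[OF \<open>B \<in> sets M\<close> this]
  have "(AE x in M. H x \<le> c) \<or> (AE x in M. c \<le> H x)"
  proof
    assume "AE x in M. x \<notin> B"
    then have "AE x in M. H x \<le> c" using AE_space by eventually_elim (auto simp: B_def)
    then show ?thesis ..
  next
    assume "AE x in M. x \<in> B"
    then have "AE x in M. c \<le> H x" by eventually_elim (auto simp: B_def)
    then show ?thesis ..
  qed
  then have "(AE x in D. H x \<le> c) \<or> (AE x in D. c \<le> H x)"
    using absolutely_continuous_AE[OF D(2,3)] by blast
  then show ?thesis
  proof
    assume le: "AE x in D. H x \<le> c"
    have "(\<integral>x. c - H x \<partial>D) = 0" using H by (simp add: c_def D.prob_space)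
    then have "AE x in D. c - H x = 0"
      using H le by (subst (asm) integral_nonneg_eq_0_iff_AE) auto
    then show ?thesis by eventually_elim (simp add: c_def)
  next
    assume le: "AE x in D. c \<le> H x"
    have "(\<integral>x. H x - c \<partial>D) = 0" using H by (simp add: c_def D.prob_space)
    then have "AE x in D. H x - c = 0"
      using H le by (subst (asm) integral_nonneg_eq_0_iff_AE) auto
    then show ?thesis by eventually_elim (simp add: c_def)
  qed
qed

end

section \<open>Dominated measures and an equivalent probability\<close>

lemma (in sigma_finite_measure) finite_ac_density:
  assumes N: "finite_measure N" "absolutely_continuous M N" "sets N = sets M"
  obtains g where "g \<in> borel_measurable M" "\<And>x. 0 \<le> g x" "integrable M g" "density M (\<lambda>x. ennreal (g x)) = N"
proof -
  obtain g where g [measurable]: "g \<in> borel_measurable M" and RN: "AE x in M. RN_deriv M N x = ennreal (g x)"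
    and g0: "\<And>x. 0 \<le> g x" using real_RN_deriv[OF N] by blast
  have "density M g = density M (RN_deriv M N)" using RN by (intro density_cong) auto
  then have dens: "density M g = N" using density_RN_deriv[OF N(2,3)] by simp
  have "(\<integral>\<^sup>+x. ennreal (g x) \<partial>M) = emeasure N (space N)"
    using sets_eq_imp_space_eq[OF N(3)] by (subst dens[symmetric]) (simp add: emeasure_density cong: nn_integral_cong)
  also have "\<dots> < \<infinity>" using finite_measure.emeasure_finite[OF N(1), of "space N"] by (simp add: less_top)
  finally have "integrable M g" using g0 by (intro integrableI_nonneg) auto
  with that g g0 dens show ?thesis by blast
qed

text \<open>The weak-star cluster points were obtained over a finite measure. An equivalent
  probability has the same null sets, hence the same bounded functions modulo null sets and the same
  dominated measures.\<close>

lemma (in sigma_finite_measure) ex_equivalent_prob_space: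
  assumes "emeasure M (space M) \<noteq> 0"
  obtains D where "prob_space D" "sets D = sets M" "absolutely_continuous M D" "absolutely_continuous D M"
proof -
  obtain p :: "'a \<Rightarrow> real" where p [measurable]: "p \<in> borel_measurable M" and p0: "\<And>x. 0 < p x" and int: "integrable M p"
    using obtain_positive_integrable_function by blast
  define c where "c = (\<integral>x. p x \<partial>M)"
  have "c \<noteq> 0"
  proof
    assume "c = 0"
    then have "AE x in M. p x = 0"
      unfolding c_def using int p0 by (subst (asm) integral_nonneg_eq_0_iff_AE) (auto intro: less_imp_le)
    then have "AE x in M. False" by eventually_elim (use p0 in \<open>metis less_irrefl\<close>)
    then show False using assms by (simp add: AE_iff_null null_sets_def)
  qed
  then have c: "0 < c" unfolding c_def using p0 by (metis integral_nonneg_AE AE_I2 less_imp_le order_le_less)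
  define D where "D = density M (\<lambda>x. ennreal (p x / c))"
  have "(\<integral>\<^sup>+x. ennreal (p x / c) \<partial>M) = ennreal (\<integral>x. p x / c \<partial>M)"
    using int c p0 by (intro nn_integral_eq_integral) (auto intro!: AE_I2 divide_nonneg_pos less_imp_le)
  also have "\<dots> = 1" using c by (simp add: c_def)
  finally have "prob_space D" unfolding D_def by (intro prob_spaceI) (simp add: emeasure_density cong: nn_integral_cong)
  moreover have "absolutely_continuous M D" unfolding D_def by (rule absolutely_continuousI_density) measurable
  moreover have "absolutely_continuous D M"
  proof (unfold absolutely_continuous_def, rule subsetI)
    fix B assume B: "B \<in> null_sets D"
    then have [measurable]: "B \<in> sets M" by (auto simp: D_def)
    have "AE x in M. x \<in> B \<longrightarrow> ennreal (p x / c) = 0"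
      using B unfolding D_def by (subst (asm) null_sets_density_iff) auto
    moreover have "ennreal (p x / c) \<noteq> 0" for x using p0[of x] c by (simp add: ennreal_eq_0_iff not_le)
    ultimately have "AE x in M. x \<notin> B" by simp
    then show "B \<in> null_sets M" by (subst (asm) AE_iff_null_sets[symmetric]) auto
  qed
  ultimately show ?thesis using that[of D] by (simp add: D_def)
qed

context conservative_ergodic_system
begin

text \<open>If the difference stayed away from 0 at infinitely many times, a filter of such times
  would carry a weak-star cluster point \<open>H\<close> of \<open>h\<close>. Testing against
  dominated measures makes \<open>H\<close> subinvariant, hence constant almost everywhere, so both
  integrals would have the same limit.\<close>

theorem asymptotic_independence:
  fixes h :: "nat \<Rightarrow> 'a \<Rightarrow> real"
  assumes h [measurable]: "\<And>n. h n \<in> borel_measurable M"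
    and h01: "\<And>n x. x \<in> space M \<Longrightarrow> 0 \<le> h n x \<and> h n x \<le> 1"
    and sub: "\<And>e. 0 < e \<Longrightarrow> eventually (\<lambda>n. \<forall>x\<in>space M. h n (T x) \<le> h n x + e) sequentially"
    and N: "N1 \<in> ac_probs M" "N2 \<in> ac_probs M"
  shows "(\<lambda>n. (\<integral>x. h n x \<partial>N1) - (\<integral>x. h n x \<partial>N2)) \<longlonglongrightarrow> 0"
proof (rule ccontr)
  let ?X = "\<lambda>n. (\<integral>x. h n x \<partial>N1) - (\<integral>x. h n x \<partial>N2)"
  assume "\<not> ?X \<longlonglongrightarrow> 0"
  then obtain e where e: "0 < e" "\<not> eventually (\<lambda>n. dist (?X n) 0 < e) sequentially" unfolding tendsto_iff by blast
  define F where "F = inf sequentially (principal {n. e \<le> \<bar>?X n\<bar>})"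
  have F: "F \<noteq> bot"
  proof
    assume "F = bot"
    then have "eventually (\<lambda>_. False) F" by simp
    then have "eventually (\<lambda>n. dist (?X n) 0 < e) sequentially"
      unfolding F_def eventually_inf_principal by eventually_elim auto
    with e(2) show False ..
  qed
  have N': "prob_space K" "sets K = sets M" "absolutely_continuous M K" if "K \<in> {N1, N2}" for K
    using that N by (auto simp: ac_probs_def)
  have "emeasure M (space M) \<noteq> 0"
  proof
    assume "emeasure M (space M) = 0"
    then have "space M \<in> null_sets N1" using N'(3)[of N1] by (auto simp: absolutely_continuous_def)
    then show False
      using prob_space.emeasure_space_1[OF N'(1)[of N1]] sets_eq_imp_space_eq[OF N'(2)[of N1]] by auto
  qed
  then obtain D where D: "prob_space D" "sets D = sets M" "absolutely_continuous M D" "absolutely_continuous D M"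
    by (rule ex_equivalent_prob_space)
  interpret D: prob_space D by fact
  note [measurable_cong] = D(2)
  have spD: "space D = space M" using D(2) by (rule sets_eq_imp_space_eq)
  obtain G H where G: "G \<noteq> bot" "G \<le> F" and H [measurable]: "H \<in> borel_measurable D"
    and H01: "\<And>x. 0 \<le> H x" "\<And>x. H x \<le> 1"
    and lim: "\<And>u. integrable D u \<Longrightarrow> ((\<lambda>n. \<integral>x. u x * h n x \<partial>D) \<longlongrightarrow> (\<integral>x. u x * H x \<partial>D)) G"
    by (rule D.weak_star_cluster[of h F]) (use h01 F spD in auto)
  \<comment> \<open>A dominated finite measure has an integrable density over \<open>D\<close>, so
    it is one of the test functionals of weak-star convergence.\<close>
  have limN: "((\<lambda>n. \<integral>x. h n x \<partial>K) \<longlongrightarrow> (\<integral>x. H x \<partial>K)) G"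
    if K: "finite_measure K" "sets K = sets M" "absolutely_continuous M K" for K
  proof -
    have "absolutely_continuous D K" using D(4) K(3) by (auto simp: absolutely_continuous_def)
    then obtain g where g [measurable]: "g \<in> borel_measurable D" and g0: "\<And>x. 0 \<le> g x" and gi: "integrable D g"
      and gK: "density D (\<lambda>x. ennreal (g x)) = K"
      by (rule D.finite_ac_density[OF K(1)]) (use K(2) D(2) in auto)
    have "(\<integral>x. f x \<partial>K) = (\<integral>x. g x * f x \<partial>D)" if [measurable]: "f \<in> borel_measurable D" for f :: "'a \<Rightarrow> real"
      using g0 by (subst gK[symmetric], subst integral_density) auto
    then show ?thesis using lim[OF gi] by simp
  qed
  \<comment> \<open>The set where subinvariance of \<open>H\<close> fails. Both the restriction of
    \<open>D\<close> to it and the image of that restriction under \<open>T\<close> are dominated by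
    \<open>M\<close>, so limits can be taken on both sides of the approximate inequality for
    \<open>h\<close>.\<close>
  define B where "B = {x \<in> space M. H x < H (T x)}"
  have B [measurable]: "B \<in> sets M" unfolding B_def by measurable
  define N where "N = density D (indicator B)"
  have fN: "finite_measure N"
    unfolding N_def by (rule finite_measureI) (simp add: emeasure_density D.emeasure_eq_measure)
  have sN: "sets N = sets M" "space N = space M" by (simp_all add: N_def D(2) spD)
  note [measurable_cong] = sN(1)
  have acN: "absolutely_continuous M N"
  proof -
    have "absolutely_continuous D N" unfolding N_def by (rule absolutely_continuousI_density) measurable
    then show ?thesis using D(3) by (auto simp: absolutely_continuous_def)
  qed
  have TN [measurable]: "T \<in> measurable N M" by measurable
  have acT: "absolutely_continuous M (distr N M T)"
  proof (unfold absolutely_continuous_def, rule subsetI)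
    fix C assume C: "C \<in> null_sets M"
    then have "emeasure M (T -` C \<inter> space M) = 0"
      using emeasure_vimage_funpow[of C 1] null_setsD1[OF C] null_setsD2[OF C] by simp
    then have "T -` C \<inter> space M \<in> null_sets M" using C by (intro null_setsI) auto
    then have "T -` C \<inter> space M \<in> null_sets N" using acN by (auto simp: absolutely_continuous_def)
    then show "C \<in> null_sets (distr N M T)" using C sN by (auto simp: null_sets_distr_iff)
  qed
  interpret N: finite_measure N by fact
  have "((\<lambda>n. \<integral>x. h n x \<partial>distr N M T) \<longlongrightarrow> (\<integral>x. H x \<partial>distr N M T)) G"
    by (rule limN[OF N.finite_measure_distr[OF TN] _ acT]) simp
  then have l1: "((\<lambda>n. \<integral>x. h n (T x) \<partial>N) \<longlongrightarrow> (\<integral>x. H (T x) \<partial>N)) G" by (simp add: integral_distr)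
  have G_seq: "G \<le> sequentially" using G(2) by (rule order_trans) (simp add: F_def)
  have l2: "((\<lambda>n. (\<integral>x. h n x \<partial>N) + d * measure N (space N)) \<longlongrightarrow> (\<integral>x. H x \<partial>N) + d * measure N (space N)) G" for d
    by (intro tendsto_intros limN fN sN acN)
  have bint: "integrable N f" if "f \<in> borel_measurable M" "\<And>x. x \<in> space M \<Longrightarrow> 0 \<le> f x \<and> f x \<le> 1" for f :: "'a \<Rightarrow> real"
    by (rule N.integrable_const_bound[where B = 1]) (use that sN in auto)
  have step: "(\<integral>x. H (T x) \<partial>N) \<le> (\<integral>x. H x \<partial>N) + d * measure N (space N)" if d: "0 < d" for d
  proof (rule tendsto_le[OF G(1) l2 l1])
    show "eventually (\<lambda>n. (\<integral>x. h n (T x) \<partial>N) \<le> (\<integral>x. h n x \<partial>N) + d * measure N (space N)) G"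
      using filter_leD[OF G_seq sub[OF d]]
    proof eventually_elim
      case (elim n)
      have hT: "integrable N (\<lambda>x. h n (T x))" using h01 measurable_space[OF T_measurable] by (intro bint) auto
      have hn: "integrable N (h n)" using h01 by (intro bint) auto
      have "(\<integral>x. h n (T x) \<partial>N) \<le> (\<integral>x. h n x + d \<partial>N)"
        using elim sN(2) hT hn by (intro integral_mono Bochner_Integration.integrable_add) auto
      also have "\<dots> = (\<integral>x. h n x \<partial>N) + d * measure N (space N)" using hn by simp
      finally show ?case .
    qed
  qed
  \<comment> \<open>The slack d is removed by letting it decrease to 0.\<close>
  have "((\<lambda>d. (\<integral>x. H x \<partial>N) + d * measure N (space N)) \<longlongrightarrow> (\<integral>x. H x \<partial>N) + 0 * measure N (space N)) (at_right 0)"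
    by (intro tendsto_intros)
  from tendsto_lowerbound[OF this] have "(\<integral>x. H (T x) \<partial>N) \<le> (\<integral>x. H x \<partial>N)"
    using step by (auto simp: eventually_at_right_less eventually_at_filter)
  then have "(\<integral>x. H (T x) - H x \<partial>N) \<le> 0"
    using H01 by (subst Bochner_Integration.integral_diff) (auto intro!: bint)
  moreover have ge: "AE x in N. 0 \<le> H (T x) - H x"
    unfolding N_def by (subst AE_density) (auto simp: B_def indicator_def)
  ultimately have "(\<integral>x. H (T x) - H x \<partial>N) = 0" using integral_nonneg_AE[OF ge] by simp
  then have "AE x in N. H (T x) - H x = 0"
  proof (subst (asm) integral_nonneg_eq_0_iff_AE)
    show "integrable N (\<lambda>x. H (T x) - H x)"
      using H01 by (intro Bochner_Integration.integrable_diff bint) auto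
  qed (use ge in auto)
  then have "AE x in D. x \<in> B \<longrightarrow> H (T x) - H x = 0"
    unfolding N_def by (subst (asm) AE_density) (auto simp: indicator_def elim!: eventually_mono)
  then have "AE x in D. H (T x) \<le> H x" using AE_space[of D] by eventually_elim (auto simp: B_def spD)
  then have "AE x in M. H (T x) \<le> H x" using absolutely_continuous_AE[OF D(2)[symmetric] D(4)] by blast
  moreover have "integrable D H" by (rule D.integrable_const_bound[where B = 1]) (use H01 in auto)
  ultimately have "AE x in D. H x = integral\<^sup>L D H" by (intro subinvariant_function_const D)
  then have HM: "AE x in M. H x = integral\<^sup>L D H" using absolutely_continuous_AE[OF D(2)[symmetric] D(4)] by blast
  have HK: "(\<integral>x. H x \<partial>K) = integral\<^sup>L D H" if K: "K \<in> {N1, N2}" for K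
  proof -
    interpret K: prob_space K by (rule N'(1)[OF K])
    have "AE x in K. H x = integral\<^sup>L D H" using absolutely_continuous_AE[OF N'(2,3)[OF K] HM] .
    then have "(\<integral>x. H x \<partial>K) = (\<integral>x. integral\<^sup>L D H \<partial>K)"
      using N'(2)[OF K] by (intro integral_cong_AE) (auto simp: measurable_cong_sets[OF N'(2)[OF K] refl])
    then show ?thesis by (simp add: K.prob_space)
  qed
  have "(?X \<longlongrightarrow> (\<integral>x. H x \<partial>N1) - (\<integral>x. H x \<partial>N2)) G"
    using N' by (intro tendsto_diff limN) (auto simp: prob_space.finite_measure)
  then have "(?X \<longlongrightarrow> 0) G" using HK by simp
  then have "eventually (\<lambda>n. \<bar>?X n\<bar> < e) G" using e(1) by (auto dest: tendstoD)
  moreover have "eventually (\<lambda>n. e \<le> \<bar>?X n\<bar>) G"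
    by (rule filter_leD[OF G(2)]) (simp add: F_def eventually_inf_principal)
  ultimately have "eventually (\<lambda>n. False) G" by eventually_elim simp
  with G(1) show False by (simp add: trivial_limit_def)
qed

end

section \<open>The last visit to a uniform set\<close>

text \<open>Without a return the infimum is infinite and both sides hold; otherwise it is attained,
  because the extended naturals are well ordered.\<close>

lemma return_time_gt_iff:
  "enat j < return_time T A x \<longleftrightarrow> (\<forall>n. 1 \<le> n \<and> n \<le> j \<longrightarrow> (T ^^ n) x \<notin> A)"
proof -
  let ?S = "{enat n |n. 1 \<le> n \<and> (T ^^ n) x \<in> A}"
  have "enat j < Inf S \<longleftrightarrow> (\<forall>s\<in>S. enat j < s)" for S
  proof
    assume h: "\<forall>s\<in>S. enat j < s"
    show "enat j < Inf S"
    proof (cases "S = {}")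
      case False
      then obtain s where "s \<in> S" by blast
      then have "Inf S \<in> S" by (rule wellorder_InfI)
      then show ?thesis using h by blast
    next
      case True
      then show ?thesis by (simp add: top_enat_def)
    qed
  qed (auto intro: less_le_trans Inf_lower)
  then have "enat j < Inf ?S \<longleftrightarrow> (\<forall>s\<in>?S. enat j < s)" .
  also have "\<dots> \<longleftrightarrow> (\<forall>n. 1 \<le> n \<and> n \<le> j \<longrightarrow> (T ^^ n) x \<notin> A)"
    by (auto simp: not_le[symmetric])
  finally show ?thesis by (simp add: return_time_def)
qed

section \<open>Disintegration at the last visit\<close>

locale visited_set = conservative_ergodic_system M T
  for M :: "'a measure" and T :: "'a \<Rightarrow> 'a" +
  fixes A :: "'a set"
  assumes A [measurable]: "A \<in> sets M" and A_pos: "0 < emeasure M A" and A_fin: "emeasure M A < \<infinity>"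
begin

definition excursion :: "nat \<Rightarrow> 'a set" where
  "excursion j = A \<inter> {x \<in> space M. enat j < return_time T A x}"

text \<open>A visit at time k that is the last one up to time k + j.\<close>

definition stays :: "nat \<Rightarrow> nat \<Rightarrow> 'a set" where
  "stays k j = (T ^^ k) -` excursion j \<inter> space M"

abbreviation "hit \<equiv> hit_by M T A"
abbreviation "Z \<equiv> last_visit M T A"
abbreviation "q \<equiv> return_tail M T A"

lemma excursion_iff: "x \<in> excursion j \<longleftrightarrow> x \<in> A \<and> (\<forall>n. 1 \<le> n \<and> n \<le> j \<longrightarrow> (T ^^ n) x \<notin> A)"
  using sets.sets_into_space[OF A] by (auto simp: excursion_def return_time_gt_iff)

lemma q_eq: "q j = measure M (excursion j)" by (simp add: return_tail_def excursion_def)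

lemma excursion_measurable [measurable]: "excursion j \<in> sets M"
proof -
  have "excursion j = {x \<in> space M. x \<in> A \<and> (\<forall>n. 1 \<le> n \<and> n \<le> j \<longrightarrow> (T ^^ n) x \<notin> A)}"
    using sets.sets_into_space[OF A] by (auto simp: excursion_iff)
  also have "\<dots> \<in> sets M" by measurable
  finally show ?thesis .
qed

lemma stays_measurable [measurable]: "stays k j \<in> sets M"
  unfolding stays_def by measurable

lemma hit_measurable [measurable]: "hit m \<in> sets M"
  unfolding hit_by_def by measurable

lemma hit_subset: "hit m \<subseteq> space M" by (auto simp: hit_by_def)

lemma hit_iff: "x \<in> space M \<Longrightarrow> x \<in> hit m \<longleftrightarrow> (\<exists>k\<le>m. (T ^^ k) x \<in> A)"
  by (auto simp: hit_by_def)

text \<open>The condition \<open>x \<in> hit m\<close> separates a genuine last visit at time 0 from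
  the default value 0.\<close>

lemma stays_iff:
  assumes x: "x \<in> space M" and k: "k \<le> m"
  shows "x \<in> stays k (m - k) \<longleftrightarrow> x \<in> hit m \<and> Z m x = k"
proof -
  let ?S = "{i. i \<le> m \<and> (T ^^ i) x \<in> A}"
  have "x \<in> stays k (m - k) \<longleftrightarrow> (T ^^ k) x \<in> A \<and> (\<forall>n. 1 \<le> n \<and> n \<le> m - k \<longrightarrow> (T ^^ n) ((T ^^ k) x) \<notin> A)"
    using x by (simp add: stays_def excursion_iff)
  also have "\<dots> \<longleftrightarrow> (T ^^ k) x \<in> A \<and> (\<forall>i\<in>?S. i \<le> k)"
  proof (intro conj_cong refl iffI ballI allI impI)
    fix i assume h: "\<forall>n. 1 \<le> n \<and> n \<le> m - k \<longrightarrow> (T ^^ n) ((T ^^ k) x) \<notin> A" and i: "i \<in> ?S"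
    show "i \<le> k"
    proof (rule ccontr)
      assume "\<not> i \<le> k"
      then have "1 \<le> i - k" "i - k \<le> m - k" "i = (i - k) + k" using i by auto
      then show False using h i funpow_add[of "i - k" k T] by (metis (no_types, lifting) comp_apply mem_Collect_eq)
    qed
  next
    fix n assume h: "\<forall>i\<in>?S. i \<le> k" and n: "1 \<le> n \<and> n \<le> m - k"
    then have "n + k \<notin> ?S" by auto
    moreover have "n + k \<le> m" using n k by arith
    ultimately show "(T ^^ n) ((T ^^ k) x) \<notin> A" by (simp add: funpow_add)
  qed
  also have "\<dots> \<longleftrightarrow> ?S \<noteq> {} \<and> Max ?S = k"
  proof -
    have "finite ?S" by (rule finite_subset[of _ "{..m}"]) auto
    then have "?S \<noteq> {} \<Longrightarrow> Max ?S = k \<longleftrightarrow> k \<in> ?S \<and> (\<forall>i\<in>?S. i \<le> k)" by (rule Max_eq_iff)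
    then show ?thesis using k by blast
  qed
  also have "\<dots> \<longleftrightarrow> x \<in> hit m \<and> Z m x = k"
    using x by (auto simp: hit_iff last_visit_def)
  finally show ?thesis .
qed

lemma last_visit_le: "Z m x \<le> m"
proof (cases "x \<in> hit m")
  case True
  let ?S = "{i. i \<le> m \<and> (T ^^ i) x \<in> A}"
  have "finite ?S" by (rule finite_subset[of _ "{..m}"]) auto
  moreover have "?S \<noteq> {}" using True hit_subset by (auto simp: hit_by_def)
  ultimately have "Max ?S \<in> ?S" by (rule Max_in)
  then show ?thesis using True by (simp add: last_visit_def)
qed (simp add: last_visit_def)

lemma last_visit_in:
  assumes "x \<in> hit m"
  shows "(T ^^ Z m x) x \<in> A"
  using stays_iff[of x "Z m x" m] assms hit_subset last_visit_le by (auto simp: stays_def excursion_iff)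

lemma last_visit_ge:
  assumes x: "x \<in> space M" and "k \<le> m" "(T ^^ k) x \<in> A"
  shows "k \<le> Z m x"
proof -
  have "x \<in> hit m" using assms by (auto simp: hit_iff)
  moreover have "finite {i. i \<le> m \<and> (T ^^ i) x \<in> A}" by (rule finite_subset[of _ "{..m}"]) auto
  ultimately show ?thesis using assms by (auto simp: last_visit_def intro: Max_ge)
qed

lemma last_visit_mono:
  assumes x: "x \<in> space M" and m: "m \<le> m'"
  shows "Z m x \<le> Z m' x"
proof (cases "x \<in> hit m")
  case True
  then show ?thesis using last_visit_ge[OF x, of "Z m x" m'] last_visit_in[OF True] last_visit_le[of m x] m by simp
qed (simp add: last_visit_def)

text \<open>A visit of x at time k + 1 is a visit of \<open>T x\<close> at time k. Equality fails in
  general, because time m for \<open>T x\<close> is time m + 1 for x and may bring a new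
  visit.\<close>

lemma last_visit_T:
  assumes x: "x \<in> space M"
  shows "Z m x \<le> Suc (Z m (T x))"
proof (cases "x \<in> hit m \<and> Z m x \<noteq> 0")
  case True
  then obtain k where k: "Z m x = Suc k" by (cases "Z m x") auto
  have "(T ^^ k) (T x) \<in> A" using last_visit_in[of x m] True k by (simp add: funpow_swap1)
  then have "k \<le> Z m (T x)"
    using last_visit_ge[of "T x" k m] last_visit_le[of m x] k measurable_space[OF T_measurable x] by simp
  then show ?thesis using k by simp
qed (auto simp: last_visit_def)

lemma last_visit_measurable [measurable]: "Z m \<in> measurable M (count_space UNIV)"
proof (rule measurable_count_space_eq2_countable[THEN iffD2], intro conjI ballI)
  fix k
  have Z0: "Z m x = 0" if "x \<notin> hit m" for x using that by (simp add: last_visit_def)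
  \<comment> \<open>For k = 0 the fibre also contains the points without any visit up to time
    m.\<close>
  have "Z m -` {k} \<inter> space M = (if k \<le> m then stays k (m - k) else {}) \<union> (if k = 0 then space M - hit m else {})"
  proof (intro set_eqI)
    fix x
    show "x \<in> Z m -` {k} \<inter> space M \<longleftrightarrow> x \<in> (if k \<le> m then stays k (m - k) else {}) \<union> (if k = 0 then space M - hit m else {})"
    proof (cases "x \<in> space M")
      case True
      from stays_iff[OF True, of k m] last_visit_le[of m x] Z0[of x] True show ?thesis by (cases "x \<in> hit m") auto
    next
      case False
      then show ?thesis using sets.sets_into_space[OF stays_measurable, of k "m - k"] by auto
    qed
  qed
  then show "Z m -` {k} \<inter> space M \<in> sets M" by simp
qed auto

text \<open>The last summand belongs to the points without a visit up to time m, where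
  \<open>Z m\<close> takes its default value 0.\<close>

lemma last_visit_decomp:
  fixes g :: "nat \<Rightarrow> real"
  assumes x: "x \<in> space M"
  shows "g (Z m x) = (\<Sum>k\<le>m. g k * indicator (stays k (m - k)) x) + g 0 * indicator (space M - hit m) x"
proof -
  have "(\<Sum>k\<le>m. g k * indicator (stays k (m - k)) x) = (\<Sum>k\<le>m. if k = Z m x then (if x \<in> hit m then g k else 0) else 0)"
    using stays_iff[OF x, of _ m] by (intro sum.cong) (auto simp: indicator_def)
  also have "\<dots> = (if x \<in> hit m then g (Z m x) else 0)"
    using last_visit_le[of m x] by (subst sum.delta) auto
  finally show ?thesis using x by (auto simp: indicator_def last_visit_def)
qed

lemma integral_last_visit:
  fixes g :: "nat \<Rightarrow> real"
  assumes N: "finite_measure N" "sets N = sets M"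
  shows "(\<integral>x. g (Z m x) \<partial>N) = (\<Sum>k\<le>m. g k * measure N (stays k (m - k))) + g 0 * measure N (space M - hit m)"
proof -
  interpret N: finite_measure N by fact
  have sp: "space N = space M" using N(2) by (rule sets_eq_imp_space_eq)
  have i: "integrable N (indicator S :: 'a \<Rightarrow> real)" "(\<integral>x. indicator S x \<partial>N) = measure N S" if "S \<in> sets M" for S
    using that N(2) sets.sets_into_space[OF that] sp by (auto simp: N.emeasure_eq_measure Int_absorb2)
  have "(\<integral>x. g (Z m x) \<partial>N)
      = (\<integral>x. (\<Sum>k\<le>m. g k * indicator (stays k (m - k)) x) + g 0 * indicator (space M - hit m) x \<partial>N)"
    using last_visit_decomp[of _ g m] sp by (intro Bochner_Integration.integral_cong) auto
  also have "\<dots> = (\<integral>x. (\<Sum>k\<le>m. g k * indicator (stays k (m - k)) x) \<partial>N) + (\<integral>x. g 0 * indicator (space M - hit m) x \<partial>N)"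
    by (intro Bochner_Integration.integral_add Bochner_Integration.integrable_sum integrable_mult_right i) auto
  also have "(\<integral>x. (\<Sum>k\<le>m. g k * indicator (stays k (m - k)) x) \<partial>N) = (\<Sum>k\<le>m. \<integral>x. g k * indicator (stays k (m - k)) x \<partial>N)"
    by (intro Bochner_Integration.integral_sum integrable_mult_right i stays_measurable)
  also have "\<dots> = (\<Sum>k\<le>m. g k * measure N (stays k (m - k)))"
    by (intro sum.cong refl) (simp only: integral_mult_right_zero i(2)[OF stays_measurable])
  also have "(\<integral>x. g 0 * indicator (space M - hit m) x \<partial>N) = g 0 * measure N (space M - hit m)"
    using i(2)[of "space M - hit m"] by (simp only: integral_mult_right_zero) auto
  finally show ?thesis .
qed

section \<open>Kac's formula, recurrence and growth of the wandering rate\<close>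

lemma emeasure_excursion_le: "emeasure M (excursion j) \<le> emeasure M A"
  by (intro emeasure_mono) (auto simp: excursion_def)

lemma emeasure_excursion_finite: "emeasure M (excursion j) < \<infinity>"
  using emeasure_excursion_le A_fin by (rule le_less_trans)

lemma measure_stays: "measure M (stays k j) = q j"
  unfolding stays_def q_eq measure_def by (simp add: emeasure_vimage_funpow)

lemma hit_emeasure_finite: "emeasure M (hit m) < \<infinity>"
proof -
  have "emeasure M (hit m) \<le> (\<Sum>k\<le>m. emeasure M ((T ^^ k) -` A \<inter> space M))"
    unfolding hit_by_def by (rule emeasure_subadditive_finite) auto
  also have "\<dots> = (\<Sum>k\<le>m. emeasure M A)" by (simp add: emeasure_vimage_funpow A)
  also have "\<dots> < \<infinity>" using A_fin by (simp add: ennreal_mult_less_top of_nat_less_top)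
  finally show ?thesis .
qed

lemma kac_formula: "wandering_rate M T A m = (\<Sum>k\<le>m. q k)"
proof -
  \<comment> \<open>Weight 1 in the decomposition: a point of \<open>hit m\<close> lies in exactly
    one of the sets \<open>stays k (m - k)\<close>, any other point in none.\<close>
  have sI: "indicator (hit m) x = (\<Sum>k\<le>m. indicator (stays k (m - k)) x :: real)" if x: "x \<in> space M" for x
    using last_visit_decomp[OF x, of "\<lambda>_. 1" m] x by (auto simp: indicator_def split: if_splits)
  have i: "integrable M (indicator (stays k j) :: 'a \<Rightarrow> real)" for k j
    using emeasure_excursion_finite by (simp add: stays_def emeasure_vimage_funpow less_top)
  have "measure M (hit m) = (\<integral>x. indicator (hit m) x \<partial>M)"
    using hit_subset by (simp add: Int_absorb2)
  also have "\<dots> = (\<integral>x. (\<Sum>k\<le>m. indicator (stays k (m - k)) x) \<partial>M)"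
    using sI by (intro Bochner_Integration.integral_cong) auto
  also have "\<dots> = (\<Sum>k\<le>m. measure M (stays k (m - k)))"
    using i sets.sets_into_space[OF stays_measurable] by (subst Bochner_Integration.integral_sum) (auto simp: Int_absorb2)
  \<comment> \<open>Since \<open>T\<close> preserves the measure, the mass of
    \<open>stays k j\<close> does not depend on k.\<close>
  also have "\<dots> = (\<Sum>k\<le>m. q (m - k))" by (simp add: measure_stays)
  also have "\<dots> = (\<Sum>k\<le>m. q k)"
    by (rule sum.reindex_bij_witness[where i = "\<lambda>k. m - k" and j = "\<lambda>k. m - k"]) auto
  finally show ?thesis by (simp add: wandering_rate_def)
qed

lemma q_nonneg: "0 \<le> q j" by (simp add: return_tail_def)

lemma q_le: "q j \<le> measure M A"
  unfolding q_eq measure_def using emeasure_excursion_le A_fin by (intro enn2real_mono) auto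

lemma wandering_pos: "0 < wandering_rate M T A m"
proof -
  have "0 < measure M A" using A_pos A_fin by (simp add: measure_def enn2real_positive_iff)
  also have "measure M A = q 0" unfolding q_eq by (rule arg_cong[where f = "measure M"]) (auto simp: excursion_iff)
  also have "q 0 \<le> (\<Sum>k\<le>m. q k)" using q_nonneg by (intro member_le_sum) auto
  finally show ?thesis by (simp add: kac_formula)
qed

lemma wandering_mono: "m \<le> m' \<Longrightarrow> wandering_rate M T A m \<le> wandering_rate M T A m'"
  unfolding kac_formula using q_nonneg by (intro sum_mono2) auto

text \<open>The points that ever visit form a subinvariant set containing \<open>A\<close>, which
  has positive measure; the complement is therefore null.\<close>

lemma AE_hits: "AE x in M. \<exists>k. (T ^^ k) x \<in> A"
proof -
  define U where "U = {x \<in> space M. \<exists>k. (T ^^ k) x \<in> A}"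
  have [measurable]: "U \<in> sets M" unfolding U_def by measurable
  have "(T ^^ Suc n) x \<in> A" if "(T ^^ n) (T x) \<in> A" for n x using that by (simp add: funpow_swap1)
  then have "x \<in> U" if "x \<in> space M" "T x \<in> U" for x using that unfolding U_def by blast
  from subinvariant_trivial[OF \<open>U \<in> sets M\<close> this] have "emeasure M U = 0 \<or> emeasure M (space M - U) = 0" .
  moreover have "emeasure M A \<le> emeasure M U"
    using sets.sets_into_space[OF A] by (intro emeasure_mono) (auto simp: U_def intro: exI[of _ 0])
  ultimately have "emeasure M (space M - U) = 0" using A_pos by auto
  then have "AE x in M. x \<notin> space M - U" by (intro AE_not_in) auto
  then show ?thesis using AE_space by eventually_elim (auto simp: U_def)
qed

lemma incseq_hit: "incseq hit"
  by (auto simp: incseq_def hit_by_def intro: order_trans)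

lemma hit_limit:
  assumes N: "N \<in> ac_probs M"
  shows "(\<lambda>m. measure N (hit m)) \<longlonglongrightarrow> 1"
proof -
  have N': "prob_space N" "sets N = sets M" "absolutely_continuous M N" using N by (auto simp: ac_probs_def)
  interpret N: prob_space N by fact
  have r: "range hit \<subseteq> sets N" unfolding N'(2) by (intro image_subsetI hit_measurable)
  then have "(\<lambda>m. measure N (hit m)) \<longlonglongrightarrow> measure N (\<Union>m. hit m)"
    by (rule N.finite_Lim_measure_incseq[OF _ incseq_hit])
  moreover have "measure N (\<Union>m. hit m) = 1"
  proof (subst N.prob_eq_1)
    show "(\<Union>m. hit m) \<in> sets N" using r by blast
    have "AE x in M. x \<in> (\<Union>m. hit m)" using AE_hits AE_space by eventually_elim (auto simp: hit_iff)
    then show "AE x in N. x \<in> (\<Union>m. hit m)" by (rule absolutely_continuous_AE[OF N'(2,3)])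
  qed
  ultimately show ?thesis by simp
qed

text \<open>The excursions decrease to the points of \<open>A\<close> that never return. These form
  a wandering set, null by conservativity, and the finite measure of \<open>A\<close> gives
  continuity from above.\<close>

lemma q_limit: "q \<longlonglongrightarrow> 0"
proof -
  define I where "I = (\<Inter>j. excursion j)"
  have I [measurable]: "I \<in> sets M" unfolding I_def by measurable
  have Iiff: "x \<in> I \<longleftrightarrow> x \<in> A \<and> (\<forall>n\<ge>1. (T ^^ n) x \<notin> A)" for x
    by (auto simp: I_def excursion_iff)
  have "False" if "n < m" "(T ^^ n) x \<in> I" "(T ^^ m) x \<in> I" for n m x
  proof -
    have "(T ^^ (m - n)) ((T ^^ n) x) = (T ^^ m) x" using that(1) funpow_add[of "m - n" n T] by (simp add: fun_eq_iff)
    then show False using that unfolding Iiff by (metis One_nat_def Suc_leI zero_less_diff)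
  qed
  then have "disjoint_family (\<lambda>n::nat. (T ^^ n) -` I \<inter> space M)"
    unfolding disjoint_family_on_def by (force simp: neq_iff)
  then have I0: "emeasure M I = 0" by (rule conservative[OF I])
  have "(\<lambda>j. measure M (excursion j)) \<longlonglongrightarrow> measure M I"
    unfolding I_def using emeasure_excursion_finite
    by (intro Lim_measure_decseq) (auto simp: decseq_def excursion_iff less_top[symmetric])
  then show ?thesis using I0 by (simp add: q_eq[abs_def] measure_def)
qed

text \<open>The sets \<open>hit m\<close> increase to almost the whole space, so W diverges exactly
  because the space has infinite measure.\<close>

lemma wandering_at_top:
  assumes "emeasure M (space M) = \<infinity>"
  shows "filterlim (wandering_rate M T A) at_top sequentially"
proof -
  have "(\<lambda>m. emeasure M (hit m)) \<longlonglongrightarrow> emeasure M (\<Union>m. hit m)"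
    by (rule Lim_emeasure_incseq[OF _ incseq_hit]) auto
  also have "emeasure M (\<Union>m. hit m) = emeasure M (space M)"
  proof (rule emeasure_eq_AE)
    show "AE x in M. x \<in> (\<Union>m. hit m) \<longleftrightarrow> x \<in> space M" using AE_hits AE_space by eventually_elim (auto simp: hit_iff)
  qed auto
  finally have lim: "(\<lambda>m. emeasure M (hit m)) \<longlonglongrightarrow> \<infinity>" using assms by simp
  show ?thesis unfolding filterlim_at_top_dense
  proof
    fix c :: real
    have "eventually (\<lambda>m. ennreal c < emeasure M (hit m)) sequentially"
      using lim by (rule order_tendstoD) (simp add: less_top)
    then show "eventually (\<lambda>m. c < wandering_rate M T A m) sequentially"
    proof eventually_elim
      case (elim m)
      have "emeasure M (hit m) = ennreal (measure M (hit m))"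
        using hit_emeasure_finite[of m] by (intro emeasure_eq_ennreal_measure) (simp add: less_top)
      then show ?case using elim unfolding wandering_rate_def
        by (metis ennreal_leI not_le)
    qed
  qed
qed

end

section \<open>The transfer operator and uniformity\<close>

context measure_preserving_system
begin

lemma transfer_funpow:
  assumes f: "integrable M f"
  shows "integrable M ((transfer M T ^^ k) f)"
    and "B \<in> sets M \<Longrightarrow> (LINT x:B|M. (transfer M T ^^ k) f x) = (LINT x:((T ^^ k) -` B \<inter> space M)|M. f x)"
proof -
  have "integrable M ((transfer M T ^^ k) f) \<and>
    (\<forall>B\<in>sets M. (LINT x:B|M. (transfer M T ^^ k) f x) = (LINT x:((T ^^ k) -` B \<inter> space M)|M. f x))"
  proof (induction k)
    case 0
    then show ?case using f sets.sets_into_space by (auto simp: Int_absorb2)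
  next
    case (Suc k)
    then have t: "is_transfer M T ((transfer M T ^^ k) f) (transfer M T ((transfer M T ^^ k) f))"
      by (intro is_transfer_transfer) auto
    have "(T ^^ k) -` (T -` B \<inter> space M) \<inter> space M = (T ^^ Suc k) -` B \<inter> space M" for B
      using funpow_space by auto
    with t Suc show ?case unfolding is_transfer_def by (auto simp: measurable_sets[OF T_measurable] comp_def)
  qed
  then show "integrable M ((transfer M T ^^ k) f)"
    and "B \<in> sets M \<Longrightarrow> (LINT x:B|M. (transfer M T ^^ k) f x) = (LINT x:((T ^^ k) -` B \<inter> space M)|M. f x)"
    by auto
qed

lemma density_integrable:
  assumes f: "f \<in> ac_densities M"
  shows "integrable M f" and "B \<in> sets M \<Longrightarrow> measure (density M (\<lambda>x. ennreal (f x))) B = (LINT x:B|M. f x)"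
proof -
  have [measurable]: "f \<in> borel_measurable M" and f0: "AE x in M. 0 \<le> f x"
    and P: "prob_space (density M (\<lambda>x. ennreal (f x)))" using f by (auto simp: ac_densities_def ac_probs_def)
  have "(\<integral>\<^sup>+x. ennreal (f x) \<partial>M) = 1"
    using prob_space.emeasure_space_1[OF P] by (simp add: emeasure_density cong: nn_integral_cong)
  then show int: "integrable M f" using f0 by (intro integrableI_nonneg) auto
  assume B [measurable]: "B \<in> sets M"
  have "emeasure (density M (\<lambda>x. ennreal (f x))) B = (\<integral>\<^sup>+x. ennreal (indicator B x * f x) \<partial>M)"
    by (auto simp: emeasure_density indicator_def intro!: nn_integral_cong)
  also have "\<dots> = ennreal (\<integral>x. indicator B x * f x \<partial>M)"
    using integrable_mult_indicator[OF B int] f0 by (intro nn_integral_eq_integral) auto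
  finally have "emeasure (density M (\<lambda>x. ennreal (f x))) B = ennreal (\<integral>x. indicator B x * f x \<partial>M)" .
  moreover have "0 \<le> (\<integral>x. indicator B x * f x \<partial>M)"
    by (rule integral_nonneg_AE) (use f0 in \<open>eventually_elim, simp add: indicator_def\<close>)
  ultimately show "measure (density M (\<lambda>x. ennreal (f x))) B = (LINT x:B|M. f x)"
    unfolding measure_def set_lebesgue_integral_def by simp
qed

text \<open>Uniformity enters only through the integrals of the partial sums over subsets of \<open>A\<close>.\<close>

lemma uniform_for_integrated:
  assumes unif: "uniform_for M T A f" and e: "0 < e"
  shows "\<exists>a K. \<forall>n\<ge>K. 0 < a n \<and> (\<forall>B\<in>sets M. B \<subseteq> A \<longrightarrow>
    \<bar>(\<Sum>k<n. measure (density M (\<lambda>x. ennreal (f x))) ((T ^^ k) -` B \<inter> space M)) - a n * measure M B\<bar> \<le> e * (a n * measure M B))"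
proof -
  let ?N = "density M (\<lambda>x. ennreal (f x))"
  let ?S = "\<lambda>n B. (\<Sum>k<n. measure ?N ((T ^^ k) -` B \<inter> space M))"
  have A [measurable]: "A \<in> sets M" and Afin: "emeasure M A < \<infinity>" and f: "f \<in> ac_densities M"
    using unif by (auto simp: uniform_for_def)
  obtain a :: "nat \<Rightarrow> real" where a: "\<And>n. 0 < a n"
    and lim: "(\<lambda>n. esssup (restrict_space M A)
               (\<lambda>x. ereal \<bar>1 / a n * (\<Sum>k<n. (transfer M T ^^ k) f x) - 1\<bar>)) \<longlonglongrightarrow> 0"
    using unif unfolding uniform_for_def by blast
  define S where "S n x = (\<Sum>k<n. (transfer M T ^^ k) f x)" for n x
  have fi: "integrable M f" by (rule density_integrable(1)[OF f])
  have Si: "integrable M (S n)" for n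
    unfolding S_def by (intro Bochner_Integration.integrable_sum transfer_funpow fi)
  have [measurable]: "S n \<in> borel_measurable M" for n using Si by auto
  have "eventually (\<lambda>n. esssup (restrict_space M A) (\<lambda>x. ereal \<bar>1 / a n * S n x - 1\<bar>) < ereal e) sequentially"
    using lim e unfolding S_def by (intro order_tendstoD(2)) auto
  then obtain K where K: "\<And>n. n \<ge> K \<Longrightarrow> esssup (restrict_space M A) (\<lambda>x. ereal \<bar>1 / a n * S n x - 1\<bar>) < ereal e"
    by (auto simp: eventually_sequentially)
  have "\<bar>?S n B - a n * measure M B\<bar> \<le> e * (a n * measure M B)"
    if n: "n \<ge> K" and B [measurable]: "B \<in> sets M" and BA: "B \<subseteq> A" for n B
  proof -
    have "AE x in restrict_space M A. ereal \<bar>1 / a n * S n x - 1\<bar> \<le> esssup (restrict_space M A) (\<lambda>x. ereal \<bar>1 / a n * S n x - 1\<bar>)"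
      by (rule esssup_AE)
    then have "AE x in restrict_space M A. ereal \<bar>1 / a n * S n x - 1\<bar> < ereal e"
      by eventually_elim (rule le_less_trans[OF _ K[OF n]])
    then have AE: "AE x in M. x \<in> A \<longrightarrow> \<bar>1 / a n * S n x - 1\<bar> < e"
      using A by (simp add: AE_restrict_space_iff sets.Int_space_eq2)
    have Bfin: "emeasure M B < \<infinity>" using emeasure_mono[OF BA A] Afin by (rule le_less_trans)
    have iB: "integrable M (\<lambda>x. indicator B x * c :: real)" for c using Bfin by (simp add: less_top)
    have iS: "integrable M (\<lambda>x. indicator B x * g x :: real)" if "integrable M g" for g
      using integrable_mult_indicator[OF B that] by simp
    have mB: "(\<integral>x. indicator B x * c \<partial>M) = c * measure M B" for c :: real
      using sets.sets_into_space[OF B] by (simp add: Int_absorb2 mult.commute)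
    have "measure ?N ((T ^^ k) -` B \<inter> space M) = (\<integral>x. indicator B x * (transfer M T ^^ k) f x \<partial>M)" for k
      using density_integrable(2)[OF f, of "(T ^^ k) -` B \<inter> space M"] transfer_funpow(2)[OF fi B, of k]
      by (simp add: set_lebesgue_integral_def)
    then have "?S n B
        = (\<Sum>k<n. \<integral>x. indicator B x * (transfer M T ^^ k) f x \<partial>M)" by simp
    also have "\<dots> = (\<integral>x. (\<Sum>k<n. indicator B x * (transfer M T ^^ k) f x) \<partial>M)"
      by (intro Bochner_Integration.integral_sum[symmetric] iS transfer_funpow fi)
    also have "\<dots> = (\<integral>x. indicator B x * S n x \<partial>M)" by (simp add: S_def sum_distrib_left)
    finally have "?S n B - a n * measure M B
        = (\<integral>x. indicator B x * S n x - indicator B x * a n \<partial>M)"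
      using iS[OF Si] iB by (subst Bochner_Integration.integral_diff) (auto simp: mB simp del: integral_mult_left_zero)
    then have "\<bar>?S n B - a n * measure M B\<bar>
        \<le> (\<integral>x. \<bar>indicator B x * S n x - indicator B x * a n\<bar> \<partial>M)"
      by (simp only: integral_abs_bound)
    also have "\<dots> \<le> (\<integral>x. indicator B x * (e * a n) \<partial>M)"
    proof (rule integral_mono_AE)
      show "AE x in M. \<bar>indicator B x * S n x - indicator B x * a n\<bar> \<le> indicator B x * (e * a n)"
        using AE
      proof eventually_elim
        case (elim x)
        show ?case
        proof (cases "x \<in> B")
          case True
          then have "\<bar>1 / a n * S n x - 1\<bar> \<le> e" using elim BA by auto
          moreover have "1 / a n * S n x - 1 = (S n x - a n) / a n" using a[of n] by (simp add: diff_divide_distrib)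
          ultimately have "\<bar>S n x - a n\<bar> \<le> e * a n" using a[of n] by (simp add: pos_divide_le_eq)
          then show ?thesis using True by simp
        qed simp
      qed
    qed (intro integrable_abs Bochner_Integration.integrable_diff iS Si iB)+
    also have "\<dots> = e * (a n * measure M B)" by (simp add: mB mult.assoc del: integral_mult_left_zero)
    finally show ?thesis .
  qed
  then show ?thesis using a by blast
qed

end

section \<open>The arcsine limit for a uniform set\<close>

locale uniform_regular_set = visited_set M T A
  for M :: "'a measure" and T :: "'a \<Rightarrow> 'a" and A :: "'a set" +
  fixes \<alpha> :: real
  assumes infinite: "emeasure M (space M) = \<infinity>"
    and uniform: "uniform_set M T A"
    and regular: "regularly_varying_seq (wandering_rate M T A) (1 - \<alpha>)"
    and \<alpha>: "0 \<le> \<alpha>" "\<alpha> \<le> 1"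
begin

abbreviation "W \<equiv> wandering_rate M T A"

text \<open>Integer factors keep the argument of W an integer. Other ratios are recovered later from
  the monotonicity of W.\<close>

lemma W_dilate:
  assumes c: "0 < c"
  shows "(\<lambda>l. W (l * c) / W l) \<longlonglongrightarrow> real c powr (1 - \<alpha>)"
proof -
  obtain R where R: "regularly_varying R (1 - \<alpha>)" and WR: "\<And>n. n \<ge> 1 \<Longrightarrow> W n = R (real n)"
    using regular by (auto simp: regularly_varying_seq_def)
  have "((\<lambda>t. R (real c * t) / R t) \<longlongrightarrow> real c powr (1 - \<alpha>)) at_top"
    using R c by (auto simp: regularly_varying_def)
  then have "(\<lambda>l. R (real c * real l) / R (real l)) \<longlonglongrightarrow> real c powr (1 - \<alpha>)"
    by (rule filterlim_compose[OF _ filterlim_real_sequentially])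
  moreover have "eventually (\<lambda>l. R (real c * real l) / R (real l) = W (l * c) / W l) sequentially"
    using eventually_ge_at_top[of 1]
  proof eventually_elim
    case (elim l)
    then have "1 \<le> l * c" using c by simp
    then show ?case using elim by (simp add: WR mult.commute)
  qed
  ultimately show ?thesis by (rule Lim_transform_eventually)
qed

lemma measure_A_pos: "0 < measure M A"
  using A_pos A_fin by (simp add: measure_def enn2real_positive_iff)

text \<open>Uniformity is applied to the sets \<open>excursion j\<close>, which all lie in
  \<open>A\<close>; the error is then proportional to their measure \<open>q j\<close>, uniformly in
  j. Applying it to \<open>A\<close> itself replaces the unknown normalisation \<open>a n\<close> by
  the partial sums of \<open>u\<close>.\<close>

lemma asymptotic_product_stays:
  assumes f: "f \<in> ac_densities M" "uniform_for M T A f"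
  defines "N \<equiv> density M (\<lambda>x. ennreal (f x))"
  shows "asymptotic_product (\<lambda>k j. measure N (stays k j)) q
    (\<lambda>k. measure N ((T ^^ k) -` A \<inter> space M) / measure M A) (measure M A) (1 / measure M A)"
proof
  have N: "N \<in> ac_probs M" using f by (auto simp: ac_densities_def N_def)
  interpret N: prob_space N using N by (auto simp: ac_probs_def)
  have N': "finite_measure N" "sets N = sets M" using N by (auto simp: ac_probs_def N.finite_measure_axioms)
  let ?u = "\<lambda>k. measure N ((T ^^ k) -` A \<inter> space M) / measure M A"
  show "0 \<le> measure N (stays k j)" "measure N (stays k j) \<le> 1" for k j by simp_all
  show "0 \<le> q k" "q k \<le> measure M A" for k by (rule q_nonneg, rule q_le)
  show "0 \<le> ?u k" "?u k \<le> 1 / measure M A" for k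
    using measure_A_pos by (simp_all add: divide_right_mono)
  show "q \<longlonglongrightarrow> 0" by (rule q_limit)
  show "filterlim (\<lambda>n. \<Sum>k\<le>n. q k) at_top sequentially"
    using wandering_at_top[OF infinite] by (simp add: kac_formula[abs_def])
  have "(\<Sum>k\<le>m. measure N (stays k (m - k))) = measure N (hit m)" for m
  proof -
    have sp: "space N = space M" using N'(2) by (rule sets_eq_imp_space_eq)
    have "1 = (\<Sum>k\<le>m. measure N (stays k (m - k))) + measure N (space N - hit m)"
      using integral_last_visit[OF N', of "\<lambda>_. 1" m] N.prob_space sp by simp
    also have "measure N (space N - hit m) = 1 - measure N (hit m)"
      using N'(2) by (intro N.prob_compl) auto
    finally show ?thesis by simp
  qed
  then show "(\<lambda>m. \<Sum>k\<le>m. measure N (stays k (m - k))) \<longlonglongrightarrow> 1" using hit_limit[OF N] by simp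
  fix \<eta> :: real assume \<eta>: "0 < \<eta>" "\<eta> \<le> 1"
  \<comment> \<open>The error for the excursion and the error for replacing \<open>b\<close> by
    \<open>U\<close> are each \<open>\<eta> / 4\<close> in units of \<open>b * q j\<close>; together
    with \<open>b \<le> 2 * U\<close> this makes \<open>\<eta>\<close>.\<close>
  obtain a K where aK: "\<And>n. n \<ge> K \<Longrightarrow> 0 < a n \<and> (\<forall>B\<in>sets M. B \<subseteq> A \<longrightarrow>
    \<bar>(\<Sum>k<n. measure N ((T ^^ k) -` B \<inter> space M)) - a n * measure M B\<bar> \<le> \<eta> / 4 * (a n * measure M B))"
    using uniform_for_integrated[OF f(2), of "\<eta> / 4"] \<eta> unfolding N_def by auto
  show "\<exists>K. \<forall>n\<ge>K. \<forall>j. \<bar>(\<Sum>k\<le>n. measure N (stays k j)) - (\<Sum>k\<le>n. ?u k) * q j\<bar> \<le> \<eta> * ((\<Sum>k\<le>n. ?u k) * q j)"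
  proof (intro exI[of _ K] allI impI)
    fix n j assume n: "K \<le> n"
    \<comment> \<open>A sum over k up to n is a sum over k < n + 1, hence the shifted index.\<close>
    define b where "b = a (Suc n)"
    define U where "U = (\<Sum>k\<le>n. ?u k)"
    have b: "0 < b" using aK[of "Suc n"] n by (simp add: b_def)
    have "\<bar>(\<Sum>k<Suc n. measure N ((T ^^ k) -` A \<inter> space M)) - b * measure M A\<bar> \<le> \<eta> / 4 * (b * measure M A)"
      using aK[of "Suc n"] n by (auto simp: b_def)
    then have "\<bar>U * measure M A - b * measure M A\<bar> \<le> \<eta> / 4 * b * measure M A"
      using measure_A_pos by (simp add: U_def sum_divide_distrib[symmetric] lessThan_Suc_atMost)
    then have "\<bar>U - b\<bar> * measure M A \<le> \<eta> / 4 * b * measure M A"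
      using measure_A_pos abs_mult[of "U - b" "measure M A"] by (simp add: left_diff_distrib)
    then have Ub: "\<bar>U - b\<bar> \<le> \<eta> / 4 * b" using measure_A_pos by (rule mult_right_le_imp_le)
    have "\<eta> / 4 * b \<le> 1 / 4 * b" using \<eta> b by (intro mult_right_mono) auto
    then have "3 / 4 * b \<le> U" using Ub by linarith
    then have "b \<le> 2 * U" using b by linarith
    then have bU: "\<eta> / 4 * b \<le> \<eta> / 4 * (2 * U)" using \<eta> by (intro mult_left_mono) auto
    have q0: "0 \<le> q j" by (rule q_nonneg)
    have "\<bar>(\<Sum>k<Suc n. measure N (stays k j)) - b * q j\<bar> \<le> \<eta> / 4 * (b * q j)"
      using aK[OF le_SucI[OF n], THEN conjunct2, rule_format, OF excursion_measurable[of j]]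
      unfolding stays_def q_eq b_def by (simp add: excursion_def)
    then have P: "\<bar>(\<Sum>k\<le>n. measure N (stays k j)) - b * q j\<bar> \<le> \<eta> / 4 * b * q j"
      by (simp add: lessThan_Suc_atMost)
    have "\<bar>U * q j - b * q j\<bar> = \<bar>U - b\<bar> * q j"
      using q0 abs_mult[of "U - b" "q j"] by (simp add: left_diff_distrib)
    also have "\<dots> \<le> \<eta> / 4 * b * q j" using Ub q0 by (rule mult_right_mono)
    finally have "\<bar>(\<Sum>k\<le>n. measure N (stays k j)) - U * q j\<bar> \<le> 2 * (\<eta> / 4 * b * q j)" using P by linarith
    also have "\<dots> \<le> 2 * (\<eta> / 4 * (2 * U) * q j)" using mult_right_mono[OF bU q0] by simp
    finally show "\<bar>(\<Sum>k\<le>n. measure N (stays k j)) - (\<Sum>k\<le>n. ?u k) * q j\<bar> \<le> \<eta> * ((\<Sum>k\<le>n. ?u k) * q j)"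
      by (simp add: U_def mult.assoc)
  qed
qed

lemma monotone_visits_last_visit:
  assumes f: "f \<in> ac_densities M" "uniform_for M T A f"
  shows "monotone_visits (density M (\<lambda>x. ennreal (f x))) Z (arcsine_law \<alpha>)"
proof -
  define N where "N = density M (\<lambda>x. ennreal (f x))"
  have N: "N \<in> ac_probs M" using f by (auto simp: ac_densities_def N_def)
  interpret N: prob_space N using N by (auto simp: ac_probs_def)
  have N': "finite_measure N" "sets N = sets M" using N by (auto simp: ac_probs_def N.finite_measure_axioms)
  have sp: "space N = space M" using N'(2) by (rule sets_eq_imp_space_eq)
  interpret P: asymptotic_product "\<lambda>k j. measure N (stays k j)" q
    "\<lambda>k. measure N ((T ^^ k) -` A \<inter> space M) / measure M A" "measure M A" "1 / measure M A"
    using asymptotic_product_stays[OF f] by (simp add: N_def)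
  define v where "v n = exp (- 1 / real (Suc n))" for n
  have v: "0 < v n" "v n < 1" for n by (auto simp: v_def divide_less_0_iff)
  have "(\<lambda>n. - 1 / real (Suc n)) \<longlonglongrightarrow> 0"
    using tendsto_minus[OF LIMSEQ_inverse_real_of_nat] by (simp add: divide_inverse)
  then have v1: "v \<longlonglongrightarrow> 1" unfolding v_def using tendsto_exp by fastforce
  have v01: "eventually (\<lambda>n. 0 \<le> v n \<and> v n < 1) sequentially"
    using v by (intro always_eventually allI conjI less_imp_le)
  have rv: "(\<lambda>l. (\<Sum>k\<le>l * c. q k) / (\<Sum>k\<le>l. q k)) \<longlonglongrightarrow> real c powr (1 - \<alpha>)" if "0 < c" for c
    using W_dilate[OF that] by (simp add: kac_formula)
  have moments: "(\<lambda>n. (1 - v n) * (\<Sum>m. v n ^ m * (\<integral>x. (v n ^ m) ^ i * (v n ^ Z m x) ^ j \<partial>N)))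
      \<longlonglongrightarrow> (\<integral>y. 1 / (1 + real i + real j * y) \<partial>arcsine_law \<alpha>)" for i j
  proof -
    let ?J = "\<lambda>n m. \<integral>x. (v n ^ m) ^ i * (v n ^ Z m x) ^ j \<partial>N"
    \<comment> \<open>One power of \<open>v n ^ m\<close> comes from the averaging weight, the other
      \<open>i\<close> from the moment.\<close>
    define a where "a = Suc i"
    have a: "0 < a" by (simp add: a_def)
    \<comment> \<open>Splitting m into k and m - k separates the weight of a last visit at time k
      into a power of \<open>v n ^ (a + j)\<close> and one of \<open>v n ^ a\<close>, so the product
      limit applies with d = a + j.\<close>
    define X where "X n m = (\<Sum>k\<le>m. (v n ^ (a + j)) ^ k * (v n ^ a) ^ (m - k) * measure N (stays k (m - k)))" for n m
    \<comment> \<open>The mass without a visit up to time m, counted with last visit 0. It tends to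
      0, and so does its Abel mean.\<close>
    define c where "c m = measure N (space M - hit m)" for m
    let ?C = "\<lambda>n. \<Sum>m. (v n ^ a) ^ m * c m"
    have va: "0 \<le> v n ^ d" "v n ^ d \<le> 1" "0 < d \<Longrightarrow> v n ^ d < 1" for n d
      using v[of n] by (auto simp: power_less_one_iff intro: power_le_one)
    have Xsum: "summable (X n)" for n
      using double_series_rearrange(2)[of "v n ^ (a + j)" "v n ^ a" "\<lambda>k j. measure N (stays k j)"] va a
      unfolding X_def by (auto simp: sums_iff)
    have csum: "summable (\<lambda>m. (v n ^ a) ^ m * c m)" for n
      using va a by (intro summable_power_bounded[where B = 1]) (auto simp: c_def)
    have split: "v n ^ m * ?J n m = X n m + (v n ^ a) ^ m * c m" for n m
    proof -
      have "?J n m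
          = (\<Sum>k\<le>m. (v n ^ m) ^ i * (v n ^ k) ^ j * measure N (stays k (m - k))) + (v n ^ m) ^ i * c m"
        using integral_last_visit[OF N', of "\<lambda>k. (v n ^ m) ^ i * (v n ^ k) ^ j" m] by (simp add: c_def)
      then have "v n ^ m * ?J n m
          = (\<Sum>k\<le>m. v n ^ m * ((v n ^ m) ^ i * (v n ^ k) ^ j * measure N (stays k (m - k)))) + v n ^ m * (v n ^ m) ^ i * c m"
        by (simp add: distrib_left sum_distrib_left)
      also have "v n ^ m * (v n ^ m) ^ i = (v n ^ a) ^ m"
        by (simp add: a_def power_mult[symmetric] power_add[symmetric] algebra_simps)
      also have "(\<Sum>k\<le>m. v n ^ m * ((v n ^ m) ^ i * (v n ^ k) ^ j * measure N (stays k (m - k)))) = X n m"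
        unfolding X_def
      proof (rule sum.cong)
        fix k assume "k \<in> {..m}"
        then obtain l where "m = k + l" using le_Suc_ex by auto
        then have "m * a + k * j = (a + j) * k + a * (m - k)" by (simp add: algebra_simps)
        then have "v n ^ (m * a + k * j) = v n ^ ((a + j) * k + a * (m - k))" by (rule arg_cong)
        then have "v n ^ m * (v n ^ m) ^ i * (v n ^ k) ^ j = (v n ^ (a + j)) ^ k * (v n ^ a) ^ (m - k)"
          by (simp only: a_def power_mult[symmetric] power_add[symmetric] mult_Suc_right)
        then show "v n ^ m * ((v n ^ m) ^ i * (v n ^ k) ^ j * measure N (stays k (m - k)))
          = (v n ^ (a + j)) ^ k * (v n ^ a) ^ (m - k) * measure N (stays k (m - k))" by (simp only: mult.assoc[symmetric])
      qed simp
      finally show ?thesis .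
    qed
    have main: "(\<lambda>n. (1 - v n) * (\<Sum>m. X n m)) \<longlonglongrightarrow> real (a + j) powr (1 - \<alpha>) / real a powr (1 - \<alpha>) / real (a + j)"
      unfolding X_def using P.P_limit[OF v1 v01 rv a, of "a + j"] a by simp
    have c0: "c \<longlonglongrightarrow> 0"
    proof -
      have "c m = 1 - measure N (hit m)" for m
        unfolding c_def using N'(2) N.prob_compl[of "hit m"] sp by simp
      then have "c = (\<lambda>m. 1 - measure N (hit m))" by (rule ext)
      then show ?thesis using tendsto_diff[OF tendsto_const hit_limit[OF N], of 1] by simp
    qed
    have "(\<lambda>n. (1 - v n ^ a) * ?C n) \<longlonglongrightarrow> 0"
      using abel_mean_tendsto[OF c0 P.pow_v[OF v1 v01 a]] .
    then have rest: "(\<lambda>n. (1 - v n) * ?C n) \<longlonglongrightarrow> 0"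
    proof (rule Lim_null_comparison[rotated], intro always_eventually allI)
      fix n
      have nn: "0 \<le> ?C n" using va by (intro suminf_nonneg csum) (auto simp: c_def)
      have "v n ^ a \<le> v n ^ 1" using a v[of n] by (intro power_decreasing) auto
      then have "(1 - v n) * ?C n \<le> (1 - v n ^ a) * ?C n"
        using nn by (intro mult_right_mono) auto
      then show "norm ((1 - v n) * ?C n) \<le> (1 - v n ^ a) * ?C n"
        using nn v[of n] by (simp add: abs_mult)
    qed
    have "(1 - v n) * (\<Sum>m. v n ^ m * ?J n m)
        = (1 - v n) * (\<Sum>m. X n m) + (1 - v n) * ?C n" for n
      unfolding split by (subst suminf_add[OF Xsum csum, symmetric]) (simp add: distrib_left)
    then have "(\<lambda>n. (1 - v n) * (\<Sum>m. v n ^ m * ?J n m))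
      \<longlonglongrightarrow> real (a + j) powr (1 - \<alpha>) / real a powr (1 - \<alpha>) / real (a + j)"
      using tendsto_add[OF main rest] by simp
    \<comment> \<open>The limit is rewritten as the Stieltjes transform of the arcsine law with
      parameters a and j.\<close>
    also have "real (a + j) powr (1 - \<alpha>) / real a powr (1 - \<alpha>) / real (a + j)
        = real a powr (\<alpha> - 1) * (real a + real j) powr (- \<alpha>)"
      using a powr_minus_divide[of "real a" "1 - \<alpha>"] powr_minus_divide[of "real a + real j" \<alpha>]
      by (simp add: powr_diff)
    also have "\<dots> = (\<integral>y. 1 / (1 + real i + real j * y) \<partial>arcsine_law \<alpha>)"
      using arcsine_stieltjes_transform[OF \<alpha>, of "real a" "real j"] a by (simp add: a_def add.commute)
    finally show ?thesis .
  qed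
  show ?thesis
    unfolding N_def[symmetric]
  proof (rule monotone_visits.intro[OF N.prob_space_axioms], rule monotone_visits_axioms.intro)
    show "Z m \<in> measurable N (count_space UNIV)" for m
      using last_visit_measurable by (simp add: measurable_cong_sets[OF N'(2) refl])
    show "Z m x \<le> Z m' x" if "x \<in> space N" "m \<le> m'" for x m m'
      using that last_visit_mono by (simp add: sp)
    show "real_distribution (arcsine_law \<alpha>)" by (rule real_distribution_arcsine[OF \<alpha>])
    show "AE y in arcsine_law \<alpha>. 0 \<le> y \<and> y \<le> 1" by (rule AE_arcsine_law)
    show "(\<lambda>n. (1 - exp (- 1 / real (Suc n))) * (\<Sum>m. exp (- 1 / real (Suc n)) ^ m *
          (\<integral>x. (exp (- 1 / real (Suc n)) ^ m) ^ i * (exp (- 1 / real (Suc n)) ^ Z m x) ^ j \<partial>N)))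
      \<longlonglongrightarrow> (\<integral>y. 1 / (1 + real i + real j * y) \<partial>arcsine_law \<alpha>)" for i j
      using moments[of i j] unfolding v_def .
  qed
qed

theorem arcsine_limit:
  fixes \<beta> :: "real \<Rightarrow> real"
  assumes N: "N \<in> ac_probs M"
    and cont: "continuous_on UNIV \<beta>" and anti: "antimono \<beta>"
    and const: "\<And>z. z \<le> 0 \<Longrightarrow> \<beta> z = \<beta> 0" "\<And>z. 1 \<le> z \<Longrightarrow> \<beta> z = \<beta> 1"
    and \<beta>01: "\<And>z. 0 \<le> \<beta> z \<and> \<beta> z \<le> 1"
  shows "(\<lambda>n. \<integral>x. \<beta> (real (Z n x) / real n) \<partial>N) \<longlonglongrightarrow> (\<integral>y. \<beta> y \<partial>arcsine_law \<alpha>)"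
proof -
  obtain f where f: "f \<in> ac_densities M" "uniform_for M T A f" using uniform by (auto simp: uniform_set_def)
  define N0 where "N0 = density M (\<lambda>x. ennreal (f x))"
  have N0: "N0 \<in> ac_probs M" using f by (auto simp: ac_densities_def N0_def)
  interpret V: monotone_visits N0 Z "arcsine_law \<alpha>"
    using monotone_visits_last_visit[OF f] by (simp add: N0_def)
  define h where "h n x = \<beta> (real (Z (Suc n) x) / real (Suc n))" for n x
  have l0: "(\<lambda>n. \<integral>x. h n x \<partial>N0) \<longlonglongrightarrow> (\<integral>y. \<beta> y \<partial>arcsine_law \<alpha>)"
    unfolding h_def by (rule V.monotone_law_limit[OF cont anti const(2)])
  have [measurable]: "\<beta> \<in> borel_measurable borel" using cont by (rule borel_measurable_continuous_onI)
  have "(\<lambda>n. (\<integral>x. h n x \<partial>N) - (\<integral>x. h n x \<partial>N0)) \<longlonglongrightarrow> 0"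
  proof (rule asymptotic_independence[OF _ _ _ N N0])
    show "h n \<in> borel_measurable M" for n unfolding h_def by measurable
    show "0 \<le> h n x \<and> h n x \<le> 1" for n x unfolding h_def by (rule \<beta>01)
    fix e :: real assume e: "0 < e"
    \<comment> \<open>The left end is -1 because the shifted point \<open>?z - inverse ?n\<close>
      can be negative, but not below -1.\<close>
    have "uniformly_continuous_on {-1..1} \<beta>"
      by (intro compact_uniformly_continuous continuous_on_subset[OF cont]) auto
    then obtain d where d: "0 < d" "\<And>s t. s \<in> {-1..1} \<Longrightarrow> t \<in> {-1..1} \<Longrightarrow> dist t s < d \<Longrightarrow> dist (\<beta> t) (\<beta> s) < e"
      using e by (elim uniformly_continuous_onE[of _ _ e]) auto
    have "eventually (\<lambda>n. inverse (real (Suc n)) < d) sequentially"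
      using LIMSEQ_inverse_real_of_nat d(1) by (rule order_tendstoD(2))
    then show "eventually (\<lambda>n. \<forall>x\<in>space M. h n (T x) \<le> h n x + e) sequentially"
    proof eventually_elim
      case (elim n)
      show ?case
      proof
        fix x assume x: "x \<in> space M"
        let ?n = "real (Suc n)"
        let ?z = "real (Z (Suc n) x) / ?n"
        have n0: "0 < ?n" by simp
        have z: "0 \<le> ?z" "?z \<le> 1" using last_visit_le[of "Suc n" x] by (auto simp: pos_divide_le_eq simp del: of_nat_Suc)
        have i: "0 < inverse ?n" "inverse ?n \<le> 1" by (auto simp: inverse_le_1_iff)
        have "real (Z (Suc n) x) \<le> real (Z (Suc n) (T x)) + 1" using last_visit_T[OF x, of "Suc n"] by simp
        then have "(real (Z (Suc n) x) - 1) / ?n \<le> real (Z (Suc n) (T x)) / ?n"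
          using n0 by (intro divide_right_mono) auto
        then have "?z - inverse ?n \<le> real (Z (Suc n) (T x)) / ?n" by (simp only: diff_divide_distrib inverse_eq_divide)
        then have "h n (T x) \<le> \<beta> (?z - inverse ?n)" unfolding h_def by (rule antimonoD[OF anti])
        moreover have "dist (\<beta> (?z - inverse ?n)) (\<beta> ?z) < e"
        proof (rule d(2))
          show "?z \<in> {-1..1}" "?z - inverse ?n \<in> {-1..1}" using z i unfolding atLeastAtMost_iff by linarith+
          show "dist (?z - inverse ?n) ?z < d" using elim i unfolding dist_real_def by linarith
        qed
        ultimately show "h n (T x) \<le> h n x + e" unfolding h_def dist_real_def by linarith
      qed
    qed
  qed
  from tendsto_add[OF this l0] have "(\<lambda>n. \<integral>x. h n x \<partial>N) \<longlonglongrightarrow> (\<integral>y. \<beta> y \<partial>arcsine_law \<alpha>)" by simp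
  then show ?thesis unfolding h_def by (rule LIMSEQ_imp_Suc)
qed

end

section \<open>The Kac processes\<close>

lemma cts_step_01: "x < y \<Longrightarrow> 0 \<le> cts_step x y t \<and> cts_step x y t \<le> 1"
  by (simp add: cts_step_def)

text \<open>Convergence of the integrals of these ramps implies weak convergence. Being monotone,
  they remain so after composition with a monotone map, so a limit theorem for monotone test
  functions suffices.\<close>

lemma cts_step_antimono: "x < y \<Longrightarrow> s \<le> t \<Longrightarrow> cts_step x y t \<le> cts_step x y s"
  by (auto simp: cts_step_def divide_right_mono)

lemma continuous_on_cts_step: "x < y \<Longrightarrow> continuous_on S (cts_step x y)"
  using uniformly_continuous_imp_continuous[OF cts_step_uniformly_continuous] continuous_on_subset by blast

section \<open>Regular variation of the wandering rate, uniformly in the ratio\<close>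

context uniform_regular_set
begin

lemma kac_process_eq: "kac_process M T A n x = W (Z n x) / W n"
  by (simp add: kac_process_def kac_formula[symmetric]) (simp add: wandering_rate_def)

lemma spent_time_kac_process_eq: "spent_time_kac_process M T A n x = W (n - Z n x) / W n"
  by (simp add: spent_time_kac_process_def kac_formula[symmetric]) (simp add: wandering_rate_def)

lemma kac_process_measurable [measurable]: "kac_process M T A n \<in> borel_measurable M"
  and spent_time_kac_process_measurable [measurable]: "spent_time_kac_process M T A n \<in> borel_measurable M"
  unfolding kac_process_eq[abs_def] spent_time_kac_process_eq[abs_def] by measurable

text \<open>The increments of W are return tails, which tend to 0 while W stays above
  \<open>W 0\<close>.\<close>

lemma W_Suc_limit: "(\<lambda>n. W (Suc n) / W n) \<longlonglongrightarrow> 1"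
proof -
  have "(\<lambda>n. q (Suc n) / W 0) \<longlonglongrightarrow> 0 / W 0"
    using wandering_pos[of 0] by (intro tendsto_divide LIMSEQ_Suc[OF q_limit] tendsto_const) auto
  then have "(\<lambda>n. q (Suc n) / W 0) \<longlonglongrightarrow> 0" by simp
  then have "(\<lambda>n. q (Suc n) / W n) \<longlonglongrightarrow> 0"
  proof (rule Lim_null_comparison[rotated], intro always_eventually allI)
    fix n
    have "q (Suc n) / W n \<le> q (Suc n) / W 0"
      using wandering_mono[of 0 n] wandering_pos q_nonneg by (intro divide_left_mono mult_pos_pos) auto
    then show "norm (q (Suc n) / W n) \<le> q (Suc n) / W 0"
      using q_nonneg wandering_pos[of n] by simp
  qed
  then have "(\<lambda>n. 1 + q (Suc n) / W n) \<longlonglongrightarrow> 1 + 0" by (intro tendsto_intros)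
  moreover have "1 + q (Suc n) / W n = W (Suc n) / W n" for n
    using wandering_pos[of n] by (simp add: kac_formula field_simps)
  ultimately show ?thesis by simp
qed

text \<open>Put m = n div r, so that n lies between m r and (m + 1) r. By monotonicity the ratio is
  squeezed between W (m p) / W ((m + 1) r) and W ((m + 1) p) / W (m r). Both are quotients of
  integer dilations, up to the factor W (m + 1) / W m, which tends to 1.\<close>

lemma W_rational:
  assumes r: "0 < r" and p: "0 < p"
  shows "(\<lambda>n. W (n * p div r) / W n) \<longlonglongrightarrow> (real p / real r) powr (1 - \<alpha>)"
proof -
  let ?\<rho> = "1 - \<alpha>"
  have div: "filterlim (\<lambda>n. n div r) sequentially sequentially"
    unfolding filterlim_at_top
  proof
    fix m
    show "eventually (\<lambda>n. m \<le> n div r) sequentially"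
      using eventually_ge_at_top[of "m * r"] by eventually_elim (use r in \<open>simp add: less_eq_div_iff_mult_less_eq\<close>)
  qed
  have W0: "W n \<noteq> 0" for n using wandering_pos[of n] by simp
  have P: "(\<lambda>m. W (m * c) / W m) \<longlonglongrightarrow> real c powr ?\<rho>" if "0 < c" for c by (rule W_dilate[OF that])
  have PS: "(\<lambda>m. W (Suc m * c) / W (Suc m)) \<longlonglongrightarrow> real c powr ?\<rho>" if "0 < c" for c
    using LIMSEQ_Suc[OF P[OF that]] .
  have "(\<lambda>m. W (Suc m * p) / W (Suc m) * (W (Suc m) / W m) / (W (m * r) / W m)) \<longlonglongrightarrow> real p powr ?\<rho> * 1 / real r powr ?\<rho>"
    using r p by (intro tendsto_mult tendsto_divide PS P W_Suc_limit) auto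
  then have "(\<lambda>m. W (Suc m * p) / W (m * r)) \<longlonglongrightarrow> (real p / real r) powr ?\<rho>"
    using W0 r p by (simp add: powr_divide)
  then have up: "(\<lambda>n. W (Suc (n div r) * p) / W (n div r * r)) \<longlonglongrightarrow> (real p / real r) powr ?\<rho>"
    by (rule filterlim_compose[OF _ div])
  have "(\<lambda>m. W (m * p) / W m / (W (Suc m) / W m) / (W (Suc m * r) / W (Suc m))) \<longlonglongrightarrow> real p powr ?\<rho> / 1 / real r powr ?\<rho>"
    using r p by (intro tendsto_divide PS P W_Suc_limit) auto
  then have "(\<lambda>m. W (m * p) / W (Suc m * r)) \<longlonglongrightarrow> (real p / real r) powr ?\<rho>"
    using W0 r p by (simp add: powr_divide)
  then have lo: "(\<lambda>n. W (n div r * p) / W (Suc (n div r) * r)) \<longlonglongrightarrow> (real p / real r) powr ?\<rho>"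
    by (rule filterlim_compose[OF _ div])
  show ?thesis
  proof (rule tendsto_sandwich[OF _ _ lo up]; intro always_eventually allI)
    fix n
    define m where "m = n div r"
    have n: "m * r \<le> n" "n \<le> Suc m * r"
      using r dividend_less_div_times[of r n] by (auto simp: m_def add.commute)
    have "m * p * r \<le> n * p" using mult_le_mono1[OF n(1), of p] by (simp add: mult_ac)
    then have a: "m * p \<le> n * p div r" using r by (simp add: less_eq_div_iff_mult_less_eq)
    have "n * p \<le> Suc m * p * r" using mult_le_mono1[OF n(2), of p] by (simp add: algebra_simps)
    then have "n * p div r \<le> Suc m * p * r div r" by (rule div_le_mono)
    then have b: "n * p div r \<le> Suc m * p" using r by simp
    show "W (n div r * p) / W (Suc (n div r) * r) \<le> W (n * p div r) / W n"
      using a n wandering_pos by (intro frac_le wandering_mono) (auto simp: m_def less_imp_le)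
    show "W (n * p div r) / W n \<le> W (Suc (n div r) * p) / W (n div r * r)"
      using b n wandering_pos by (intro frac_le wandering_mono) (auto simp: m_def less_imp_le)
  qed
qed

text \<open>Polya's argument: monotone functions converging on a fine grid to a continuous limit
  converge uniformly. Continuity of the limit at 0 is where \<alpha> < 1 enters.\<close>

lemma W_uniform:
  assumes \<alpha>1: "\<alpha> < 1" and e: "0 < e"
  shows "eventually (\<lambda>n. \<forall>k\<le>n. \<bar>W k / W n - (real k / real n) powr (1 - \<alpha>)\<bar> \<le> e) sequentially"
proof -
  let ?p = "\<lambda>t::real. t powr (1 - \<alpha>)"
  have "uniformly_continuous_on {0..1} ?p"
    using \<alpha>1 by (intro compact_uniformly_continuous continuous_on_powr' continuous_intros) auto
  then obtain d where d: "0 < d" "\<And>s t. s \<in> {0..1} \<Longrightarrow> t \<in> {0..1} \<Longrightarrow> dist t s < d \<Longrightarrow> dist (?p t) (?p s) < e / 2"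
    using e by (elim uniformly_continuous_onE[of _ _ "e / 2"]) auto
  obtain r where r: "0 < r" "1 / real r < d" using d(1) by (metis nat_approx_posE of_nat_0_less_iff zero_less_Suc)
  have lim: "(\<lambda>n. W (n * i div r) / W n) \<longlonglongrightarrow> ?p (real i / real r)" for i
  proof (cases "i = 0")
    case True
    \<comment> \<open>At the grid point 0 the convergence comes from the divergence of W, not from
      regular variation.\<close>
    have "(\<lambda>n. W 0 / W n) \<longlonglongrightarrow> 0"
      by (intro tendsto_divide_0[OF tendsto_const] filterlim_at_top_imp_at_infinity wandering_at_top infinite)
    then show ?thesis using True by simp
  next
    case False
    then show ?thesis using W_rational[OF r(1), of i] by simp
  qed
  have "eventually (\<lambda>n. \<forall>i\<in>{..r}. dist (W (n * i div r) / W n) (?p (real i / real r)) < e / 2) sequentially"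
    using e by (intro eventually_ball_finite ballI tendstoD[OF lim]) auto
  then show ?thesis using eventually_gt_at_top[of 0]
  proof eventually_elim
    case (elim n)
    show ?case
    proof (intro allI impI)
      fix k assume k: "k \<le> n"
      \<comment> \<open>The largest grid index with i / r at most k / n.\<close>
      define i where "i = k * r div n"
      have n: "0 < n" using elim by simp
      have i: "i * n \<le> k * r" "k * r < Suc i * n"
        unfolding i_def using n dividend_less_div_times[of n "k * r"] by (auto simp: add.commute)
      have "k * r \<le> n * r" using k by simp
      then have "i \<le> n * r div n" unfolding i_def by (rule div_le_mono)
      then have ir: "i \<le> r" using n by simp
      show "\<bar>W k / W n - ?p (real k / real n)\<bar> \<le> e"
      \<comment> \<open>At k = n the upper neighbour i + 1 would leave the grid; there both
        quantities equal 1.\<close>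
      proof (cases "k = n")
        case True
        then show ?thesis using e n wandering_pos[of n] by simp
      next
        case False
        have "Suc i \<le> r"
        proof (rule ccontr)
          assume "\<not> Suc i \<le> r"
          then have "i = r" using ir by simp
          then have "r * n \<le> r * k" using i(1) by (simp add: mult.commute)
          then show False using r(1) k False by simp
        qed
        have ri: "real i * real n \<le> real k * real r" "real k * real r \<le> real (Suc i) * real n"
          using i by (metis of_nat_le_iff of_nat_mult, metis less_imp_le of_nat_le_iff of_nat_mult)
        then have lo: "real i / real r \<le> real k / real n" and up: "real k / real n \<le> real (Suc i) / real r"
          using n r(1) by (auto simp: divide_simps mult_ac)
        have sr: "real (Suc i) / real r = real i / real r + 1 / real r" by (simp add: add_divide_distrib)
        have in01: "real i / real r \<in> {0..1}" "real (Suc i) / real r \<in> {0..1}" "real k / real n \<in> {0..1}"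
          using ir \<open>Suc i \<le> r\<close> k n r(1) by (auto simp: divide_simps)
        have dl: "dist (?p (real i / real r)) (?p (real k / real n)) < e / 2"
          and du: "dist (?p (real (Suc i) / real r)) (?p (real k / real n)) < e / 2"
          using lo up sr r(2) by (intro d(2) in01; simp add: dist_real_def; linarith)+
        have "n * i div r \<le> k * r div r" using i(1) by (intro div_le_mono) (simp add: mult.commute)
        then have "W (n * i div r) / W n \<le> W k / W n"
          using r(1) wandering_pos[of n] by (intro divide_right_mono wandering_mono) auto
        moreover have "k \<le> n * Suc i div r"
          using i(2) r(1) by (simp add: less_eq_div_iff_mult_less_eq mult.commute)
        then have "W k / W n \<le> W (n * Suc i div r) / W n"
          using wandering_pos[of n] by (intro divide_right_mono wandering_mono) auto
        moreover have "dist (W (n * i div r) / W n) (?p (real i / real r)) < e / 2"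
          "dist (W (n * Suc i div r) / W n) (?p (real (Suc i) / real r)) < e / 2"
          using elim ir \<open>Suc i \<le> r\<close> by blast+
        ultimately show ?thesis using dl du unfolding dist_real_def by linarith
      qed
    qed
  qed
qed

text \<open>The values of \<open>R n\<close> are uniformly close to \<open>\<gamma>\<close> at Z_n /
  n, so a ramp of one may be replaced by a ramp of the other. A ramp of a monotone
  \<open>\<gamma>\<close> is a monotone test function, as the arcsine limit requires.\<close>

lemma strong_distr_conv_of_uniform:
  fixes R :: "nat \<Rightarrow> 'a \<Rightarrow> real" and \<gamma> :: "real \<Rightarrow> real"
  assumes R [measurable]: "\<And>n. R n \<in> borel_measurable M"
    and \<gamma> [measurable]: "\<gamma> \<in> borel_measurable borel" and cont: "continuous_on {0..1} \<gamma>"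
    and mono: "(\<forall>s t. 0 \<le> s \<longrightarrow> s \<le> t \<longrightarrow> t \<le> 1 \<longrightarrow> \<gamma> s \<le> \<gamma> t) \<or> (\<forall>s t. 0 \<le> s \<longrightarrow> s \<le> t \<longrightarrow> t \<le> 1 \<longrightarrow> \<gamma> t \<le> \<gamma> s)"
    and approx: "\<And>e. 0 < e \<Longrightarrow> eventually (\<lambda>n. \<forall>x\<in>space M. \<bar>R n x - \<gamma> (real (Z n x) / real n)\<bar> \<le> e) sequentially"
  shows "strong_distr_conv M R (distr (arcsine_law \<alpha>) borel \<gamma>)"
  unfolding strong_distr_conv_def
proof (intro conjI allI ballI R)
  interpret \<kappa>: real_distribution "arcsine_law \<alpha>" by (rule real_distribution_arcsine[OF \<alpha>])
  show rd: "real_distribution (distr (arcsine_law \<alpha>) borel \<gamma>)"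
    by (auto simp: real_distribution_def real_distribution_axioms_def intro!: \<kappa>.prob_space_distr)
  fix N assume N: "N \<in> ac_probs M"
  then have sN: "sets N = sets M" by (auto simp: ac_probs_def)
  note [measurable_cong] = sN
  have sp: "space N = space M" using sN by (rule sets_eq_imp_space_eq)
  interpret N: prob_space N using N by (auto simp: ac_probs_def)
  show "weak_conv_m (\<lambda>n. distr N borel (R n)) (distr (arcsine_law \<alpha>) borel \<gamma>)"
  proof (rule integral_cts_step_conv_imp_weak_conv[OF _ rd])
    show "real_distribution (distr N borel (R n))" for n
      by (auto simp: real_distribution_def real_distribution_axioms_def intro!: N.prob_space_distr)
    fix x y :: real assume xy: "x < y"
    \<comment> \<open>Clamping makes the test function constant outside [0, 1] and leaves it
      unchanged at the possible values of Z_n / n.\<close>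
    define \<beta> where "\<beta> t = cts_step x y (\<gamma> (clamp01 t))" for t
    have cl: "continuous_on UNIV clamp01" unfolding clamp01_def by (intro continuous_intros)
    have "continuous_on UNIV (\<lambda>t. \<gamma> (clamp01 t))"
      by (rule continuous_on_compose2[OF cont cl]) (auto simp: clamp01)
    then have \<beta>cont: "continuous_on UNIV \<beta>"
      unfolding \<beta>_def by (rule continuous_on_compose2[OF continuous_on_cts_step[OF xy, of UNIV]]) auto
    have [measurable]: "\<beta> \<in> borel_measurable borel" using \<beta>cont by (rule borel_measurable_continuous_onI)
    have [measurable]: "cts_step x y \<in> borel_measurable borel"
      using continuous_on_cts_step[OF xy] by (rule borel_measurable_continuous_onI)
    have \<beta>01: "0 \<le> \<beta> t \<and> \<beta> t \<le> 1" for t unfolding \<beta>_def by (rule cts_step_01[OF xy])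
    have \<beta>c: "t \<le> 0 \<Longrightarrow> \<beta> t = \<beta> 0" "1 \<le> t \<Longrightarrow> \<beta> t = \<beta> 1" for t by (auto simp: \<beta>_def clamp01_def)
    have clm: "clamp01 s \<le> clamp01 t" if "s \<le> t" for s t using that by (auto simp: clamp01_def)
    have int\<beta>: "integrable N (\<lambda>x. \<beta> (real (Z n x) / real n))" for n
      by (rule N.integrable_const_bound[where B = 1]) (use \<beta>01 in auto)
    have lim: "(\<lambda>n. \<integral>x. \<beta> (real (Z n x) / real n) \<partial>N) \<longlonglongrightarrow> (\<integral>t. \<beta> t \<partial>arcsine_law \<alpha>)"
      using mono
    proof
      assume "\<forall>s t. 0 \<le> s \<longrightarrow> s \<le> t \<longrightarrow> t \<le> 1 \<longrightarrow> \<gamma> s \<le> \<gamma> t"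
      then have "antimono \<beta>" unfolding \<beta>_def by (intro antimonoI cts_step_antimono[OF xy]) (simp add: clm clamp01)
      then show ?thesis by (intro arcsine_limit[OF N \<beta>cont] \<beta>c \<beta>01)
    next
      assume "\<forall>s t. 0 \<le> s \<longrightarrow> s \<le> t \<longrightarrow> t \<le> 1 \<longrightarrow> \<gamma> t \<le> \<gamma> s"
      \<comment> \<open>For nonincreasing \<open>\<gamma>\<close> the ramp of
        \<open>\<gamma>\<close> is nondecreasing, so the complementary function takes its
        place.\<close>
      then have "antimono (\<lambda>t. 1 - \<beta> t)" unfolding \<beta>_def by (intro antimonoI diff_mono cts_step_antimono[OF xy]) (auto simp: clm clamp01)
      then have "(\<lambda>n. \<integral>x. 1 - \<beta> (real (Z n x) / real n) \<partial>N) \<longlonglongrightarrow> (\<integral>t. 1 - \<beta> t \<partial>arcsine_law \<alpha>)"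
      proof (rule arcsine_limit[OF N continuous_on_diff[OF continuous_on_const \<beta>cont]])
        show "0 \<le> 1 - \<beta> t \<and> 1 - \<beta> t \<le> 1" for t using \<beta>01[of t] by simp
        show "1 - \<beta> t = 1 - \<beta> 0" if "t \<le> 0" for t using \<beta>c(1)[OF that] by simp
        show "1 - \<beta> t = 1 - \<beta> 1" if "1 \<le> t" for t using \<beta>c(2)[OF that] by simp
      qed
      moreover have "integrable (arcsine_law \<alpha>) \<beta>" by (rule \<kappa>.integrable_const_bound[where B = 1]) (use \<beta>01 in auto)
      ultimately have "(\<lambda>n. 1 - (\<integral>x. \<beta> (real (Z n x) / real n) \<partial>N)) \<longlonglongrightarrow> 1 - (\<integral>t. \<beta> t \<partial>arcsine_law \<alpha>)"
        using int\<beta> \<kappa>.prob_space by (simp add: N.prob_space)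
      from tendsto_diff[OF tendsto_const this, of 1] show ?thesis by simp
    qed
    have "(\<lambda>n. (\<integral>x'. cts_step x y (R n x') \<partial>N) - (\<integral>x. \<beta> (real (Z n x) / real n) \<partial>N)) \<longlonglongrightarrow> 0"
    proof (rule tendstoI)
      fix e :: real assume e: "0 < e"
      obtain d where d: "0 < d" "\<And>s t. dist t s < d \<Longrightarrow> dist (cts_step x y t) (cts_step x y s) < e / 2"
        using uniformly_continuous_onE[OF cts_step_uniformly_continuous[OF xy], of "e / 2"] e by (metis UNIV_I half_gt_zero)
      show "eventually (\<lambda>n. dist ((\<integral>x'. cts_step x y (R n x') \<partial>N) - (\<integral>x. \<beta> (real (Z n x) / real n) \<partial>N)) 0 < e) sequentially"
        using approx[OF half_gt_zero[OF d(1)]]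
      proof eventually_elim
        case (elim n)
        have iR: "integrable N (\<lambda>x'. cts_step x y (R n x'))"
          by (rule N.integrable_const_bound[where B = 1]) (use cts_step_01[OF xy] in auto)
        have pt: "\<bar>cts_step x y (R n z) - \<beta> (real (Z n z) / real n)\<bar> \<le> e / 2" if z: "z \<in> space N" for z
        proof -
          have "0 \<le> real (Z n z) / real n" "real (Z n z) / real n \<le> 1" using last_visit_le[of n z] by (auto simp: divide_le_eq_1)
          then have "\<beta> (real (Z n z) / real n) = cts_step x y (\<gamma> (real (Z n z) / real n))" by (simp add: \<beta>_def clamp01)
          moreover have "dist (R n z) (\<gamma> (real (Z n z) / real n)) < d"
          proof -
            have "\<bar>R n z - \<gamma> (real (Z n z) / real n)\<bar> \<le> d / 2" using elim z sp by blast
            then show ?thesis using d(1) unfolding dist_real_def by linarith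
          qed
          ultimately show ?thesis using d(2)[of "R n z" "\<gamma> (real (Z n z) / real n)"] by (simp add: dist_real_def)
        qed
        have "\<bar>(\<integral>x'. cts_step x y (R n x') \<partial>N) - (\<integral>x. \<beta> (real (Z n x) / real n) \<partial>N)\<bar>
            = \<bar>\<integral>z. cts_step x y (R n z) - \<beta> (real (Z n z) / real n) \<partial>N\<bar>"
          using iR int\<beta> by simp
        also have "\<dots> \<le> (\<integral>z. \<bar>cts_step x y (R n z) - \<beta> (real (Z n z) / real n)\<bar> \<partial>N)" by (rule integral_abs_bound)
        also have "\<dots> \<le> (\<integral>z. e / 2 \<partial>N)"
          using pt iR int\<beta> by (intro integral_mono integrable_abs Bochner_Integration.integrable_diff) auto
        also have "\<dots> < e" using e by (simp add: N.prob_space)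
        finally show ?case by simp
      qed
    qed
    from tendsto_add[OF this lim] have "(\<lambda>n. \<integral>x'. cts_step x y (R n x') \<partial>N) \<longlonglongrightarrow> (\<integral>t. \<beta> t \<partial>arcsine_law \<alpha>)" by simp
    also have "(\<integral>t. \<beta> t \<partial>arcsine_law \<alpha>) = (\<integral>t. cts_step x y (\<gamma> t) \<partial>arcsine_law \<alpha>)"
    proof (rule integral_cong_AE)
      show "AE t in arcsine_law \<alpha>. \<beta> t = cts_step x y (\<gamma> t)"
        using AE_arcsine_law[of \<alpha>] by eventually_elim (simp add: \<beta>_def clamp01)
    qed auto
    finally show "(\<lambda>n. integral\<^sup>L (distr N borel (R n)) (cts_step x y)) \<longlonglongrightarrow> integral\<^sup>L (distr (arcsine_law \<alpha>) borel \<gamma>) (cts_step x y)"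
      by (simp add: integral_distr)
  qed
qed

section \<open>Convergence of the two Kac processes\<close>

lemma continuous_on_powr_unit:
  assumes "\<alpha> < 1"
  shows "continuous_on {0..1} (\<lambda>t::real. t powr (1 - \<alpha>))" "continuous_on {0..1} (\<lambda>t::real. (1 - t) powr (1 - \<alpha>))"
proof -
  show "continuous_on {0..1} (\<lambda>t::real. t powr (1 - \<alpha>))"
    by (rule continuous_on_powr'[OF continuous_on_id continuous_on_const]) (use assms in auto)
  show "continuous_on {0..1} (\<lambda>t::real. (1 - t) powr (1 - \<alpha>))"
    by (rule continuous_on_powr'[OF continuous_on_diff[OF continuous_on_const continuous_on_id] continuous_on_const]) (use assms in auto)
qed

lemma kac_process_conv:
  assumes \<alpha>1: "\<alpha> < 1"
  shows "strong_distr_conv M (kac_process M T A) (X_law \<alpha>)"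
  unfolding X_law_eq_distr[OF \<alpha>]
proof (rule strong_distr_conv_of_uniform[OF kac_process_measurable _ continuous_on_powr_unit(1)[OF \<alpha>1]])
  show "(\<forall>s t::real. 0 \<le> s \<longrightarrow> s \<le> t \<longrightarrow> t \<le> 1 \<longrightarrow> s powr (1 - \<alpha>) \<le> t powr (1 - \<alpha>))
      \<or> (\<forall>s t. 0 \<le> s \<longrightarrow> s \<le> t \<longrightarrow> t \<le> 1 \<longrightarrow> t powr (1 - \<alpha>) \<le> s powr (1 - \<alpha>))"
    using \<alpha>1 by (auto intro!: powr_mono2)
  fix e :: real assume "0 < e"
  from W_uniform[OF \<alpha>1 this]
  show "eventually (\<lambda>n. \<forall>x\<in>space M. \<bar>kac_process M T A n x - (real (Z n x) / real n) powr (1 - \<alpha>)\<bar> \<le> e) sequentially"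
    by eventually_elim (simp add: kac_process_eq last_visit_le)
qed measurable

lemma spent_time_kac_process_conv:
  assumes \<alpha>1: "\<alpha> < 1"
  shows "strong_distr_conv M (spent_time_kac_process M T A) (Y_law \<alpha>)"
  unfolding Y_law_eq_distr[OF \<alpha>(1) \<alpha>1]
proof (rule strong_distr_conv_of_uniform[OF spent_time_kac_process_measurable _ continuous_on_powr_unit(2)[OF \<alpha>1]])
  show "(\<forall>s t::real. 0 \<le> s \<longrightarrow> s \<le> t \<longrightarrow> t \<le> 1 \<longrightarrow> (1 - s) powr (1 - \<alpha>) \<le> (1 - t) powr (1 - \<alpha>))
      \<or> (\<forall>s t. 0 \<le> s \<longrightarrow> s \<le> t \<longrightarrow> t \<le> 1 \<longrightarrow> (1 - t) powr (1 - \<alpha>) \<le> (1 - s) powr (1 - \<alpha>))"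
    using \<alpha>1 by (auto intro!: powr_mono2)
  fix e :: real assume "0 < e"
  \<comment> \<open>Uniformity in k allows the random index \<open>n - Z n x\<close>. The case n = 0
    is set aside because \<open>1 - 0 / 0\<close> is 1 while \<open>0 / 0\<close> is 0.\<close>
  from W_uniform[OF \<alpha>1 this] eventually_gt_at_top[of 0]
  show "eventually (\<lambda>n. \<forall>x\<in>space M. \<bar>spent_time_kac_process M T A n x - (1 - real (Z n x) / real n) powr (1 - \<alpha>)\<bar> \<le> e) sequentially"
  proof eventually_elim
    case (elim n)
    have "real (n - Z n x) / real n = 1 - real (Z n x) / real n" for x
      using elim(2) last_visit_le[of n x] by (simp add: of_nat_diff diff_divide_distrib)
    then show ?case using elim(1) by (metis diff_le_self spent_time_kac_process_eq)
  qed
qed measurable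

lemma kac_process_conv_1:
  assumes \<alpha>1: "\<alpha> = 1"
  shows "strong_distr_conv M (kac_process M T A) (X_law \<alpha>)"
  unfolding strong_distr_conv_def
proof (intro conjI allI ballI kac_process_measurable)
  have X: "X_law \<alpha> = return borel 1" using \<alpha>1 by (simp add: X_law_def)
  show rd: "real_distribution (X_law \<alpha>)"
    unfolding X by (auto simp: real_distribution_def real_distribution_axioms_def intro!: prob_space_return)
  fix N assume N: "N \<in> ac_probs M"
  then have sN: "sets N = sets M" by (auto simp: ac_probs_def)
  note [measurable_cong] = sN
  have sp: "space N = space M" using sN by (rule sets_eq_imp_space_eq)
  interpret N: prob_space N using N by (auto simp: ac_probs_def)
  let ?R = "kac_process M T A"
  \<comment> \<open>This ramp is 1 up to 1/2 and 0 at 1; its mean tends to 0 and bounds the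
    probability that \<open>Z n \<le> n / 2\<close>.\<close>
  define \<beta> where "\<beta> t = cts_step (1/2) 1 t" for t :: real
  have \<beta>: "continuous_on UNIV \<beta>" unfolding \<beta>_def by (intro continuous_on_cts_step) simp
  have \<beta>01: "0 \<le> \<beta> t \<and> \<beta> t \<le> 1" for t unfolding \<beta>_def by (intro cts_step_01) simp
  have [measurable]: "\<beta> \<in> borel_measurable borel" using \<beta> by (rule borel_measurable_continuous_onI)
  have "(\<lambda>n. \<integral>x. \<beta> (real (Z n x) / real n) \<partial>N) \<longlonglongrightarrow> (\<integral>t. \<beta> t \<partial>arcsine_law \<alpha>)"
  proof (rule arcsine_limit[OF N \<beta> _ _ _ \<beta>01])
    show "antimono \<beta>" unfolding \<beta>_def by (intro antimonoI cts_step_antimono) auto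
  qed (auto simp: \<beta>_def cts_step_def)
  also have "(\<integral>t. \<beta> t \<partial>arcsine_law \<alpha>) = 0"
    using \<alpha>1 by (simp add: arcsine_law_def integral_return) (simp add: \<beta>_def cts_step_def)
  finally have lim: "(\<lambda>n. \<integral>x. \<beta> (real (Z n x) / real n) \<partial>N) \<longlonglongrightarrow> 0" .
  have half: "(\<lambda>n. W (n * 1 div 2) / W n) \<longlonglongrightarrow> 1" using W_rational[of 2 1] \<alpha>1 by simp
  show "weak_conv_m (\<lambda>n. distr N borel (?R n)) (X_law \<alpha>)"
  proof (rule integral_cts_step_conv_imp_weak_conv[OF _ rd])
    show "real_distribution (distr N borel (?R n))" for n
      by (auto simp: real_distribution_def real_distribution_axioms_def intro!: N.prob_space_distr)
    fix x y :: real assume xy: "x < y"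
    have [measurable]: "cts_step x y \<in> borel_measurable borel"
      using continuous_on_cts_step[OF xy] by (rule borel_measurable_continuous_onI)
    define c where "c = cts_step x y 1"
    have "(\<lambda>n. \<integral>z. cts_step x y (?R n z) \<partial>N) \<longlonglongrightarrow> c"
    proof (rule tendstoI)
      fix e :: real assume e: "0 < e"
      obtain d where d: "0 < d" "\<And>s t. dist t s < d \<Longrightarrow> dist (cts_step x y t) (cts_step x y s) < e / 2"
        using uniformly_continuous_onE[OF cts_step_uniformly_continuous[OF xy], of "e / 2"] e by (metis UNIV_I half_gt_zero)
      have "eventually (\<lambda>n. (\<integral>x. \<beta> (real (Z n x) / real n) \<partial>N) < e / 2) sequentially"
        using lim e by (intro order_tendstoD(2)) auto
      moreover have "eventually (\<lambda>n. 1 - d < W (n * 1 div 2) / W n) sequentially"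
        using half d(1) by (intro order_tendstoD(1)) auto
      ultimately show "eventually (\<lambda>n. dist (\<integral>z. cts_step x y (?R n z) \<partial>N) c < e) sequentially"
        using eventually_gt_at_top[of 0]
      proof eventually_elim
        case (elim n)
        have iR: "integrable N (\<lambda>z. cts_step x y (?R n z))"
          by (rule N.integrable_const_bound[where B = 1]) (use cts_step_01[OF xy] in auto)
        have i\<beta>: "integrable N (\<lambda>z. \<beta> (real (Z n z) / real n))"
          by (rule N.integrable_const_bound[where B = 1]) (use \<beta>01 in auto)
        \<comment> \<open>The second term pays for the points whose last visit comes before half
          time, where the ramps differ by at most 1.\<close>
        have pt: "\<bar>cts_step x y (?R n z) - c\<bar> \<le> e / 2 + \<beta> (real (Z n z) / real n)" for z
        proof (cases "n div 2 \<le> Z n z")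
          case True
          have "W (n * 1 div 2) / W n \<le> ?R n z" unfolding kac_process_eq
            using True wandering_pos[of n] by (intro divide_right_mono wandering_mono) auto
          moreover have "?R n z \<le> 1" unfolding kac_process_eq
            using wandering_mono[OF last_visit_le[of n z]] wandering_pos[of n] by simp
          ultimately have "dist (?R n z) 1 < d" using elim d(1) unfolding dist_real_def by linarith
          from d(2)[OF this] show ?thesis using \<beta>01[of "real (Z n z) / real n"] by (simp add: dist_real_def c_def)
        next
          case False
          then have "2 * Z n z \<le> n" by simp
          then have "2 * real (Z n z) \<le> real n" by (metis of_nat_le_iff of_nat_mult of_nat_numeral)
          then have "real (Z n z) / real n \<le> 1 / 2" using elim by (simp add: pos_divide_le_eq)
          then have "\<beta> (real (Z n z) / real n) = 1" by (simp add: \<beta>_def cts_step_def)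
          then show ?thesis using cts_step_01[OF xy, of "?R n z"] cts_step_01[OF xy, of 1] e unfolding c_def by linarith
        qed
        have "\<bar>(\<integral>z. cts_step x y (?R n z) \<partial>N) - c\<bar> = \<bar>\<integral>z. cts_step x y (?R n z) - c \<partial>N\<bar>"
          using iR by (simp add: N.prob_space)
        also have "\<dots> \<le> (\<integral>z. \<bar>cts_step x y (?R n z) - c\<bar> \<partial>N)" by (rule integral_abs_bound)
        also have "\<dots> \<le> (\<integral>z. e / 2 + \<beta> (real (Z n z) / real n) \<partial>N)"
          using iR i\<beta> by (intro integral_mono integrable_abs Bochner_Integration.integrable_diff Bochner_Integration.integrable_add pt) auto
        also have "\<dots> = e / 2 + (\<integral>z. \<beta> (real (Z n z) / real n) \<partial>N)" using i\<beta> by (simp add: N.prob_space)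
        also have "\<dots> < e" using elim by simp
        finally show ?case by (simp add: dist_real_def)
      qed
    qed
    then show "(\<lambda>n. integral\<^sup>L (distr N borel (?R n)) (cts_step x y)) \<longlonglongrightarrow> integral\<^sup>L (X_law \<alpha>) (cts_step x y)"
      by (simp add: X integral_distr integral_return c_def)
  qed
qed

end

theorem corollary1p4:
  fixes M :: "'a measure" and T :: "'a \<Rightarrow> 'a" and A :: "'a set" and \<alpha> :: real
  assumes "conservative_ergodic_system M T"
    and "emeasure M (space M) = \<infinity>"
    and "A \<in> sets M" and "0 < emeasure M A" and "emeasure M A < \<infinity>"
    and "uniform_set M T A"
    and "regularly_varying_seq (wandering_rate M T A) (1 - \<alpha>)"
  shows "(0 \<le> \<alpha> \<and> \<alpha> \<le> 1 \<longrightarrow> strong_distr_conv M (kac_process M T A) (X_law \<alpha>)) \<and>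
         (0 \<le> \<alpha> \<and> \<alpha> < 1 \<longrightarrow> strong_distr_conv M (spent_time_kac_process M T A) (Y_law \<alpha>))"
proof -
  have sys: "uniform_regular_set M T A \<alpha>" if "0 \<le> \<alpha>" "\<alpha> \<le> 1"
    using assms that
    by (auto simp: uniform_regular_set_def visited_set_def visited_set_axioms_def uniform_regular_set_axioms_def)
  show ?thesis
  proof (intro conjI impI; elim conjE)
    assume a: "0 \<le> \<alpha>" "\<alpha> \<le> 1"
    show "strong_distr_conv M (kac_process M T A) (X_law \<alpha>)"
      using uniform_regular_set.kac_process_conv[OF sys[OF a]] uniform_regular_set.kac_process_conv_1[OF sys[OF a]] a
      by (cases "\<alpha> = 1") auto
  next
    assume a: "0 \<le> \<alpha>" "\<alpha> < 1"
    then show "strong_distr_conv M (spent_time_kac_process M T A) (Y_law \<alpha>)"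
      using uniform_regular_set.spent_time_kac_process_conv[OF sys] by simp
  qed
qed

end
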